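(* Let $\omega$ and $\rho$ be hermitian functionals on a unital C$^*$-algebra $A$. Then $\rho$ is in the weak* closure $\overline{\omega\circ\mathrm{E}(A)}$ of the set $\omega\circ\mathrm{E}(A)=\{\omega\circ\psi:\ \psi\in\mathrm{E}(A)\}$ if and only if there exist positive functionals $\rho_1$ and $\rho_2$ on $A$ satisfying the following condition: (B) $\rho=\rho_1-\rho_2$, $\rho_1(1)=\omega_+(1)$, $\rho_2(1)=\omega_-(1)$, and $\|\rho_1|J\|\leq\|\omega_+|J\|$ and $\|\rho_2|J\|\leq\|\omega_-|J\|$ for all ideals $J$ in $A$. (In particular, in this case $\|\rho|J\|\leq\|\omega|J\|$ for all ideals $J$ in $A$.) If $\omega$ is positive, then condition (B) simplifies to: $\rho(1)=\omega(1)$ and $\|\rho|J\|\leq\|\omega|J\|$ for all ideals $J$ of $A$ (that is, for positive $\omega$, $\rho\in\overline{\omega\circ\mathrm{E}(A)}$ if and only if this holds).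
   Context: Ideals are norm closed and two-sided. Hermitian functionals are bounded. $\omega=\omega_+-\omega_-$ is the Jordan decomposition of $\omega$, i.e. $\omega_\pm$ are the positive functionals with $\|\omega\|=\|\omega_+\|+\|\omega_-\|$. $\mathrm{E}(A)$ denotes the set of all maps $A\to A$ of the form $x\mapsto\sum_{i=1}^n a_i^*xa_i$ with $n\in\mathbb{N}$, $a_i\in A$ and $\sum_{i=1}^n a_i^*a_i=1$. *)

theory Defs
  imports "HOL-Analysis.Analysis"
begin

section \<open>Unital C*-algebras\<close>

text \<open>
  As usual for unital algebras, \<open>1 \<noteq> 0\<close> (this is part of \<^class>\<open>real_normed_algebra_1\<close>).
  The library's real Banach algebra structure is the one underlying the complex one, by
  \<open>scaleR_scaleC\<close>.
\<close>

class cstar_algebra = real_normed_algebra_1 + banach +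
  fixes scaleC :: "complex \<Rightarrow> 'a \<Rightarrow> 'a" (infixr "*\<^sub>C" 75)
    and star :: "'a \<Rightarrow> 'a"
  assumes scaleR_scaleC: "r *\<^sub>R x = complex_of_real r *\<^sub>C x"
    and scaleC_add_right: "c *\<^sub>C (x + y) = c *\<^sub>C x + c *\<^sub>C y"
    and scaleC_add_left: "(c + d) *\<^sub>C x = c *\<^sub>C x + d *\<^sub>C x"
    and scaleC_scaleC: "c *\<^sub>C (d *\<^sub>C x) = (c * d) *\<^sub>C x"
    and scaleC_one: "1 *\<^sub>C x = x"
    and mult_scaleC_left: "(c *\<^sub>C x) * y = c *\<^sub>C (x * y)"
    and mult_scaleC_right: "x * (c *\<^sub>C y) = c *\<^sub>C (x * y)"
    and norm_scaleC: "norm (c *\<^sub>C x) = cmod c * norm x"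
    and star_star: "star (star x) = x"
    and star_add: "star (x + y) = star x + star y"
    and star_scaleC: "star (c *\<^sub>C x) = cnj c *\<^sub>C star x"
    and star_mult: "star (x * y) = star y * star x"
    and cstar_identity: "norm (star x * x) = (norm x)\<^sup>2"

definition closed_ideal :: "'a::cstar_algebra set \<Rightarrow> bool" where
  "closed_ideal J \<longleftrightarrow>
     0 \<in> J \<and>
     (\<forall>x\<in>J. \<forall>y\<in>J. x + y \<in> J) \<and>
     (\<forall>c. \<forall>x\<in>J. c *\<^sub>C x \<in> J) \<and>
     (\<forall>a. \<forall>x\<in>J. a * x \<in> J \<and> x * a \<in> J) \<and>
     closed J"


section \<open>Functionals\<close>

definition dual_space :: "('a::cstar_algebra \<Rightarrow> complex) set" where
  "dual_space = {f. bounded_linear f \<and> (\<forall>c x. f (c *\<^sub>C x) = c * f x)}"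

definition hermitian_functional :: "('a::cstar_algebra \<Rightarrow> complex) \<Rightarrow> bool" where
  "hermitian_functional f \<longleftrightarrow> f \<in> dual_space \<and> (\<forall>x. f (star x) = cnj (f x))"

text \<open>
  A positive linear functional on a C*-algebra is automatically bounded, so requiring
  membership in the dual space here is no restriction.
\<close>

definition positive_functional :: "('a::cstar_algebra \<Rightarrow> complex) \<Rightarrow> bool" where
  "positive_functional f \<longleftrightarrow> f \<in> dual_space \<and> (\<forall>x. f (star x * x) \<in> \<real>\<^sub>\<ge>\<^sub>0)"

text \<open>
  The norm \<open>\<parallel>f|J\<parallel>\<close> of the restriction; it specializes to the library's operator norm
  \<^const>\<open>onorm\<close> for \<open>J = UNIV\<close>. The point \<open>x = 0\<close> contributes \<open>0\<close>.
\<close>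

definition restr_norm :: "('a::cstar_algebra \<Rightarrow> complex) \<Rightarrow> 'a set \<Rightarrow> real" where
  "restr_norm f J = (SUP x\<in>J. cmod (f x) / norm x)"

definition jordan_decomposition ::
    "('a::cstar_algebra \<Rightarrow> complex) \<Rightarrow> ('a \<Rightarrow> complex) \<Rightarrow> ('a \<Rightarrow> complex) \<Rightarrow> bool" where
  "jordan_decomposition f p m \<longleftrightarrow>
     positive_functional p \<and> positive_functional m \<and>
     f = (\<lambda>x. p x - m x) \<and> onorm f = onorm p + onorm m"

text \<open>
  Every hermitian functional has exactly one Jordan decomposition, so the choice operator
  selects the two parts \<open>f\<^sub>+\<close> and \<open>f\<^sub>-\<close>; on other functionals they are meaningless.
\<close>

definition jordan_parts ::
    "('a::cstar_algebra \<Rightarrow> complex) \<Rightarrow> ('a \<Rightarrow> complex) \<times> ('a \<Rightarrow> complex)" where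
  "jordan_parts f = (SOME (p, m). jordan_decomposition f p m)"

definition pos_part :: "('a::cstar_algebra \<Rightarrow> complex) \<Rightarrow> 'a \<Rightarrow> complex" where
  "pos_part f = fst (jordan_parts f)"

definition neg_part :: "('a::cstar_algebra \<Rightarrow> complex) \<Rightarrow> 'a \<Rightarrow> complex" where
  "neg_part f = snd (jordan_parts f)"

text \<open>The topology of pointwise convergence on the dual space.\<close>

definition weak_star_topology :: "('a::cstar_algebra \<Rightarrow> complex) topology" where
  "weak_star_topology = subtopology (product_topology (\<lambda>_. euclidean) UNIV) dual_space"


section \<open>The maps in \<open>E(A)\<close> and condition (B)\<close>

definition E_maps :: "('a::cstar_algebra \<Rightarrow> 'a) set" where
  "E_maps = {\<psi>. \<exists>(n::nat) a.
      (\<Sum>i=1..n. star (a i) * a i) = 1 \<and>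
      \<psi> = (\<lambda>x. \<Sum>i=1..n. star (a i) * x * a i)}"

definition condition_B ::
    "('a::cstar_algebra \<Rightarrow> complex) \<Rightarrow> ('a \<Rightarrow> complex) \<Rightarrow>
     ('a \<Rightarrow> complex) \<Rightarrow> ('a \<Rightarrow> complex) \<Rightarrow> bool" where
  "condition_B \<omega> \<rho> \<rho>\<^sub>1 \<rho>\<^sub>2 \<longleftrightarrow>
     \<rho> = (\<lambda>x. \<rho>\<^sub>1 x - \<rho>\<^sub>2 x) \<and>
     \<rho>\<^sub>1 1 = pos_part \<omega> 1 \<and> \<rho>\<^sub>2 1 = neg_part \<omega> 1 \<and>
     (\<forall>J. closed_ideal J \<longrightarrow>
        restr_norm \<rho>\<^sub>1 J \<le> restr_norm (pos_part \<omega>) J \<and>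
        restr_norm \<rho>\<^sub>2 J \<le> restr_norm (neg_part \<omega>) J)"

end

theory Submission
  imports Defs
begin

text \<open>
  Write \<open>\<omega> = p - n\<close> for the Jordan decomposition. A map \<open>\<psi>\<close> in \<open>E(A)\<close> is a positive unital
  contraction (\<open>norm_kraus_le\<close>) that leaves every ideal invariant, so \<open>p \<circ> \<psi>\<close> and \<open>n \<circ> \<psi>\<close> are
  positive functionals with the same values at \<open>1\<close> and no larger norms on ideals. The set of all
  such functionals is weak* compact, hence so is the set of differences
  (\<open>closed_dominated_differences\<close>); this gives condition (B) for everything in the closure of
  \<open>\<omega> \<circ> E(A)\<close>.

  Conversely, let first \<open>\<omega>\<close> and \<open>\<rho>\<close> be positive with \<open>\<rho> 1 = \<omega> 1\<close> and \<open>\<parallel>\<rho>|J\<parallel> \<le> \<parallel>\<omega>|J\<parallel>\<close> for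
  all ideals \<open>J\<close>. Since \<open>\<omega> \<circ> E(A)\<close> is convex, it suffices by separation in finitely many
  coordinates (\<open>convex_approximation\<close>) to show \<open>\<rho> h \<le> sup \<omega> (\<psi> h)\<close> for every selfadjoint \<open>h\<close>,
  and one may take \<open>0 \<preceq> h \<preceq> 1\<close>. Let \<open>J\<^sub>t\<close> be the ideal generated by \<open>(h - t)\<^sub>+\<close>. Cutting \<open>h\<close> into
  thin slices \<open>min ((h - t)\<^sub>+) d\<close>, each of norm at most \<open>d\<close> and lying in \<open>J\<^sub>t\<close>, bounds \<open>\<rho> h\<close> by
  the integral of \<open>\<parallel>\<rho>|J\<^sub>t\<parallel>\<close> over \<open>t\<close>, hence by that of \<open>\<parallel>\<omega>|J\<^sub>t\<parallel>\<close>. On the other hand, \<open>J\<^sub>t\<close> has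
  approximate units that are exactly of the form \<open>\<Sum> star b * b\<close> with \<open>b\<close> in \<open>(h - t)\<^sub>+ A\<close>
  (\<open>approximate_unit\<close>), for which \<open>\<Sum> star b * h * b\<close> is at least \<open>t \<Sum> star b * b\<close>, and \<open>\<omega>\<close> almost
  attains its norm on \<open>J\<^sub>t\<close> at such units. Starting from the largest \<open>t\<close> and always compressing by
  what is left of the unit, one assembles a \<open>\<psi>\<close> for which \<open>\<omega> (\<psi> h)\<close> reaches the integral
  (\<open>layered_kraus\<close>, \<open>kraus_dominates\<close>).

  For hermitian \<open>\<omega>\<close>, the two parts are almost supported on complementary elements
  (\<open>jordan_almost_orthogonal\<close>), so that maps found separately for \<open>p\<close> and for \<open>n\<close> can be glued to
  one (\<open>hermitian_kraus_approximation\<close>).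

  The C*-algebra theory needed for this is developed in an elementary way: positive elements are
  described by norms, square roots by an iteration, the continuous functional calculus by Bernstein
  operators, and the Jordan decomposition comes from one application of the Hahn-Banach theorem.
  No spectra and no representations occur.
\<close>

section \<open>The involution and the norm\<close>

lemma star_0 [simp]: "star (0::'a::cstar_algebra) = 0"
  using star_add[of 0 "0::'a"] by simp

lemma star_1 [simp]: "star (1::'a::cstar_algebra) = 1"
  by (metis mult_1_right star_mult star_star)

lemma star_scaleR [simp]: "star (r *\<^sub>R x) = r *\<^sub>R star (x::'a::cstar_algebra)"
  by (simp add: scaleR_scaleC star_scaleC)

lemma star_minus [simp]: "star (- x) = - star (x::'a::cstar_algebra)"
  using star_scaleR[of "-1" x] by simp

lemma star_diff: "star (x - y) = star x - star (y::'a::cstar_algebra)"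
  using star_add[of x "- y"] by simp

lemma star_of_real [simp]: "star (of_real r) = (of_real r :: 'a::cstar_algebra)"
  by (simp add: of_real_def)

lemma star_sum: "star (sum f I) = (\<Sum>i\<in>I. star (f i :: 'a::cstar_algebra))"
  by (induction I rule: infinite_finite_induct) (simp_all add: star_add)

lemma norm_star [simp]: "norm (star x) = norm (x::'a::cstar_algebra)"
proof -
  have le: "norm x \<le> norm (star x)" for x :: 'a
  proof (cases "x = 0")
    case False
    have "(norm x)\<^sup>2 \<le> norm (star x) * norm x"
      using cstar_identity[of x] norm_mult_ineq[of "star x" x] by simp
    then show ?thesis using False by (simp add: power2_eq_square)
  qed simp
  show ?thesis using le[of x] le[of "star x"] by (simp add: star_star)
qed

lemma norm_square_selfadjoint: "star x = x \<Longrightarrow> norm (x * x) = (norm (x::'a::cstar_algebra))\<^sup>2"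
  using cstar_identity[of x] by simp

lemma bounded_linear_star: "bounded_linear (star :: 'a::cstar_algebra \<Rightarrow> 'a)"
  by (rule bounded_linear_intro[where K = 1]) (auto simp: star_add)

lemmas tendsto_star = bounded_linear.tendsto[OF bounded_linear_star]

lemma scaleC_scaleR_commute: "c *\<^sub>C (r *\<^sub>R x) = r *\<^sub>R (c *\<^sub>C (x::'a::cstar_algebra))"
  by (simp add: scaleR_scaleC scaleC_scaleC mult.commute)

lemma scaleC_0_left [simp]: "0 *\<^sub>C x = (0::'a::cstar_algebra)"
  using norm_scaleC[of 0 x] by simp

lemma scaleC_minus_left: "(- c) *\<^sub>C x = - (c *\<^sub>C (x::'a::cstar_algebra))"
  using scaleC_add_left[of "-c" c x] by (simp add: eq_neg_iff_add_eq_0)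

lemma scaleC_minus_right: "c *\<^sub>C (- x) = - (c *\<^sub>C (x::'a::cstar_algebra))"
  using scaleC_add_right[of c x "- x"] scaleC_add_right[of c 0 "0::'a"]
  by (simp add: eq_neg_iff_add_eq_0 add.commute)

lemma bounded_linear_scaleC: "bounded_linear (\<lambda>x::'a::cstar_algebra. c *\<^sub>C x)"
  by (rule bounded_linear_intro[where K = "cmod c"])
    (simp_all add: scaleC_add_right scaleC_scaleR_commute norm_scaleC mult.commute)

lemma scaleC_diff_right: "c *\<^sub>C (x - y) = c *\<^sub>C x - c *\<^sub>C (y::'a::cstar_algebra)"
  using scaleC_add_right[of c x "- y"] by (simp add: scaleC_minus_right)

lemma norm_unitary:
  fixes u :: "'a::cstar_algebra"
  assumes "star u * u = 1"
  shows "norm u = 1"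
proof -
  have "(norm u)\<^sup>2 = 1\<^sup>2" using cstar_identity[of u] assms by simp
  then show ?thesis by (rule power2_eq_imp_eq) simp_all
qed

definition re_part :: "'a::cstar_algebra \<Rightarrow> 'a" where
  "re_part x = (1/2) *\<^sub>R (x + star x)"

definition im_part :: "'a::cstar_algebra \<Rightarrow> 'a" where
  "im_part x = re_part ((- \<i>) *\<^sub>C x)"

lemma star_re_part [simp]: "star (re_part x) = re_part x"
  by (simp add: re_part_def star_add star_star add.commute)

lemma star_im_part [simp]: "star (im_part x) = im_part x"
  by (simp add: im_part_def)

lemma re_part_selfadjoint: "star x = x \<Longrightarrow> re_part x = x"
  by (simp add: re_part_def scaleR_2[symmetric] del: scaleR_2)

lemma re_im_decomp: "x = re_part x + \<i> *\<^sub>C im_part (x::'a::cstar_algebra)"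
proof -
  have "\<i> *\<^sub>C im_part x = (1/2) *\<^sub>R (x - star x)"
    by (simp add: im_part_def re_part_def scaleC_scaleR_commute scaleC_add_right star_scaleC
        scaleC_scaleC scaleC_one scaleC_minus_left scaleC_minus_right scaleC_diff_right)
  then show ?thesis
    by (simp add: re_part_def scaleR_add_right[symmetric] scaleR_2[symmetric] del: scaleR_2)
qed

lemma norm_re_part: "norm (re_part x) \<le> norm (x::'a::cstar_algebra)"
  using norm_triangle_ineq[of x "star x"] by (simp add: re_part_def)

lemma re_part_add: "re_part (x + y) = re_part x + re_part (y::'a::cstar_algebra)"
  by (simp add: re_part_def star_add algebra_simps)

lemma re_part_scaleR: "re_part (r *\<^sub>R x) = r *\<^sub>R re_part (x::'a::cstar_algebra)"
  by (simp add: re_part_def algebra_simps)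


section \<open>Positive elements\<close>

text \<open>
  The textbook definition by the spectrum would require spectral theory. Measuring the distance
  to a large multiple of \<open>1\<close> (Kelley and Vaught) characterizes the same elements, and
  makes it evident that they form a convex cone.
\<close>

definition pos :: "'a::cstar_algebra \<Rightarrow> bool" where
  "pos x \<longleftrightarrow> star x = x \<and> (\<exists>t\<ge>0. norm (of_real t - x) \<le> t)"

abbreviation le_pos :: "'a::cstar_algebra \<Rightarrow> 'a \<Rightarrow> bool" (infix "\<preceq>" 50) where
  "x \<preceq> y \<equiv> pos (y - x)"

lemma pos_star: "pos x \<Longrightarrow> star x = x"
  by (simp add: pos_def)

lemma pos_0 [simp]: "pos 0"
  by (auto simp: pos_def intro: exI[of _ 0])

lemma pos_of_real: "0 \<le> r \<Longrightarrow> pos (of_real r)"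
  by (auto simp: pos_def intro: exI[of _ r])

lemma pos_1 [simp]: "pos 1"
  using pos_of_real[of 1] by simp

lemma pos_add: "pos x \<Longrightarrow> pos y \<Longrightarrow> pos (x + y :: 'a::cstar_algebra)"
proof -
  assume "pos x" "pos y"
  then obtain s t where st: "0 \<le> s" "0 \<le> t" "norm (of_real s - x) \<le> s" "norm (of_real t - y) \<le> t"
    by (auto simp: pos_def)
  have "of_real (s + t) - (x + y) = (of_real s - x) + (of_real t - y)" by simp
  then have "norm (of_real (s + t) - (x + y)) \<le> s + t"
    using norm_triangle_mono[OF st(3,4)] by (simp only:)
  then show ?thesis using st \<open>pos x\<close> \<open>pos y\<close>
    by (auto simp: pos_def star_add intro!: exI[of _ "s + t"])
qed

lemma pos_sum: "(\<And>i. i \<in> I \<Longrightarrow> pos (f i)) \<Longrightarrow> pos (sum f I :: 'a::cstar_algebra)"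
  by (induction I rule: infinite_finite_induct) (auto intro: pos_add)

lemma pos_scaleR: "0 \<le> r \<Longrightarrow> pos x \<Longrightarrow> pos (r *\<^sub>R x :: 'a::cstar_algebra)"
proof -
  assume r: "0 \<le> r" and "pos x"
  then obtain t where t: "0 \<le> t" "norm (of_real t - x) \<le> t" by (auto simp: pos_def)
  have "of_real (r * t) - r *\<^sub>R x = r *\<^sub>R (of_real t - x)"
    by (simp add: of_real_def algebra_simps)
  then have "norm (of_real (r * t) - r *\<^sub>R x) \<le> r * t" using r t by (simp add: mult_left_mono)
  then show ?thesis using r t \<open>pos x\<close> by (auto simp: pos_def intro!: exI[of _ "r * t"])
qed

lemma le_pos_trans: "x \<preceq> y \<Longrightarrow> y \<preceq> z \<Longrightarrow> x \<preceq> (z::'a::cstar_algebra)"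
  using pos_add[of "y - x" "z - y"] by simp

lemma le_norm: "star x = x \<Longrightarrow> norm x \<le> r \<Longrightarrow> x \<preceq> (of_real r :: 'a::cstar_algebra)"
  using order_trans[OF norm_ge_zero] by (auto simp: pos_def star_diff intro!: exI[of _ r])

lemma minus_norm_le: "star x = x \<Longrightarrow> norm x \<le> r \<Longrightarrow> pos (x + of_real r :: 'a::cstar_algebra)"
  using le_norm[of "- x" r] by (simp add: add.commute)

text \<open>
  The fixed point iteration \<open>y \<mapsto> (b + y\<^sup>2) / 2\<close> converges to \<open>1 - sqrt (1 - b)\<close>. It is
  dominated by the same iteration for the number \<open>1\<close> in place of \<open>b\<close>, which is monotone and
  bounded by \<open>1\<close>. Unlike the binomial series this needs no estimate of coefficients when
  \<open>norm b = 1\<close>.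
\<close>

lemma one_minus_sqrt_exists:
  fixes b :: "'a::cstar_algebra"
  assumes sa: "star b = b" and nb: "norm b \<le> 1"
  shows "\<exists>y. star y = y \<and> norm y \<le> 1 \<and> (1 - y) * (1 - y) = 1 - b \<and>
           (\<forall>c. c * b = b * c \<longrightarrow> c * y = y * c)"
proof -
  define y where "y = rec_nat 0 (\<lambda>_ z. (1/2) *\<^sub>R (b + z * z))"
  define r where "r = rec_nat (0::real) (\<lambda>_ z. (1 + z * z) / 2)"
  have y0: "y 0 = 0" and yS: "y (Suc n) = (1/2) *\<^sub>R (b + y n * y n)" for n
    by (simp_all add: y_def)
  have r0: "r 0 = 0" and rS: "r (Suc n) = (1 + r n * r n) / 2" for n
    by (simp_all add: r_def)
  have r01: "0 \<le> r n \<and> r n \<le> 1" for n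
    by (induction n) (auto simp: r0 rS mult_le_one)
  have ny: "norm (y n) \<le> r n" for n
  proof (induction n)
    case (Suc n)
    have "norm (y n * y n) \<le> r n * r n"
      using norm_mult_ineq[of "y n" "y n"] Suc r01[of n] mult_mono[OF Suc Suc] by auto
    then have "norm (b + y n * y n) \<le> 1 + r n * r n"
      using norm_triangle_ineq[of b "y n * y n"] nb by linarith
    then show ?case by (simp add: yS rS)
  qed (simp add: y0 r0)
  have comm: "c * y n = y n * c" if "c * b = b * c" for c n
  proof (induction n)
    case (Suc n)
    have "c * (y n * y n) = (y n * y n) * c" by (metis Suc mult.assoc)
    then show ?case using that by (simp add: yS distrib_left distrib_right)
  qed (simp add: y0)
  have saY: "star (y n) = y n" for n
    by (induction n) (simp_all add: y0 yS star_add star_mult sa)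
  have cyy: "y m * y n = y n * y m" for m n
    using comm[OF comm[of b n, OF refl, symmetric]] by simp
  have step: "norm (y (Suc n) - y n) \<le> r (Suc n) - r n" for n
  proof (induction n)
    case 0
    then show ?case using nb by (simp add: y0 yS r0 rS)
  next
    case (Suc n)
    have eq: "y (Suc (Suc n)) - y (Suc n) = (1/2) *\<^sub>R ((y (Suc n) - y n) * (y (Suc n) + y n))"
      unfolding yS[of "Suc n"] yS[of n, symmetric]
      apply (subst (3) yS)
      using cyy[of "Suc n" n] by (simp add: algebra_simps)
    have "norm ((y (Suc n) - y n) * (y (Suc n) + y n)) \<le> (r (Suc n) - r n) * (r (Suc n) + r n)"
      using norm_triangle_mono[OF ny ny] order_trans[OF norm_ge_zero Suc] Suc
      by (intro order.trans[OF norm_mult_ineq] mult_mono) auto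
    also have "\<dots> = 2 * (r (Suc (Suc n)) - r (Suc n))"
    proof -
      have "2 * r (Suc m) = 1 + r m * r m" for m by (simp add: rS)
      from this[of "Suc n"] this[of n] show ?thesis by algebra
    qed
    finally show ?case by (simp add: eq)
  qed
  have "convergent r"
  proof (rule Bseq_monoseq_convergent)
    show "Bseq r" using r01 by (intro BseqI'[where K = 1]) auto
    show "monoseq r"
      using order_trans[OF norm_ge_zero step] by (intro mono_SucI1) auto
  qed
  then obtain l where "r \<longlonglongrightarrow> l" by (auto simp: convergent_def)
  then have sr: "summable (\<lambda>n. r (Suc n) - r n)" by (rule telescope_summable)
  have "summable (\<lambda>n. y (Suc n) - y n)"
    by (rule summable_comparison_test'[OF sr, of 0]) (rule step)
  then have "convergent (\<lambda>n. \<Sum>i<n. y (Suc i) - y i)"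
    by (simp add: summable_iff_convergent)
  then obtain z where z: "y \<longlonglongrightarrow> z"
    by (auto simp: sum_lessThan_telescope y0 convergent_def)
  have "(\<lambda>n. y (Suc n)) \<longlonglongrightarrow> (1/2) *\<^sub>R (b + z * z)"
    unfolding yS by (intro tendsto_intros z)
  then have fix_eq: "z = (1/2) *\<^sub>R (b + z * z)"
    by (rule LIMSEQ_unique[OF LIMSEQ_Suc[OF z]])
  show ?thesis
  proof (intro exI conjI allI impI)
    show "star z = z" using LIMSEQ_unique[OF tendsto_star[OF z]] z by (simp add: saY)
    show "norm z \<le> 1"
      using ny r01 by (intro LIMSEQ_le_const2[OF tendsto_norm[OF z]]) (meson order_trans)
    have "2 *\<^sub>R z = 2 *\<^sub>R ((1/2) *\<^sub>R (b + z * z))" using fix_eq by simp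
    then have "z * z = z + z - b" by (simp add: algebra_simps scaleR_2)
    then show "(1 - z) * (1 - z) = 1 - b" by (simp add: algebra_simps)
    fix c assume "c * b = b * c"
    then have "(\<lambda>n. c * y n) \<longlonglongrightarrow> z * c"
      using comm by (simp add: tendsto_mult_right z)
    then show "c * z = z * c"
      by (rule LIMSEQ_unique[OF tendsto_mult_left[OF z]])
  qed
qed

text \<open>
  The square of a selfadjoint contraction \<open>h\<close> is \<open>1 - k\<^sup>2\<close>, where \<open>h + i k\<close> is unitary; hence
  \<open>k\<close> is a contraction as well.
\<close>

lemma norm_one_minus_square:
  fixes h :: "'a::cstar_algebra"
  assumes sa: "star h = h" and nh: "norm h \<le> 1"
  shows "norm (1 - h * h) \<le> 1"
proof -
  have "norm (h * h) \<le> 1" using norm_square_selfadjoint[OF sa] nh by (simp add: power_le_one)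
  then obtain y where y: "star y = y" "(1 - y) * (1 - y) = 1 - h * h"
      "\<forall>c. c * (h * h) = h * h * c \<longrightarrow> c * y = y * c"
    using one_minus_sqrt_exists[of "h * h"] sa by (auto simp: star_mult)
  define k where "k = 1 - y"
  have k: "star k = k" "k * k = 1 - h * h" "h * k = k * h"
    using y by (auto simp: k_def star_diff algebra_simps mult.assoc)
  define u where "u = h + \<i> *\<^sub>C k"
  have su: "star u = h - \<i> *\<^sub>C k"
    by (simp add: u_def star_add star_scaleC sa k scaleC_minus_left)
  have "star u * u = h * h + k * k"
    unfolding su unfolding u_def
    by (simp add: algebra_simps mult_scaleC_left mult_scaleC_right scaleC_scaleC
        scaleC_minus_left scaleC_one scaleC_diff_right scaleC_add_right k(3))
  then have "star u * u = 1" by (simp add: k)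
  then have nu: "norm u = 1" by (rule norm_unitary)
  have "u - star u = 2 *\<^sub>C (\<i> *\<^sub>C k)"
    unfolding su unfolding u_def using scaleC_add_left[of 1 1 "\<i> *\<^sub>C k"] by (simp add: scaleC_one)
  then have "2 * norm k = norm (u - star u)" by (simp add: norm_scaleC)
  also have "\<dots> \<le> 2" using norm_triangle_ineq4[of u "star u"] nu by simp
  finally have "norm k \<le> 1" by simp
  then have "(norm k)\<^sup>2 \<le> 1" by (simp add: power_le_one)
  then show ?thesis
    by (simp only: norm_square_selfadjoint[OF k(1)] k(2)[symmetric])
qed

lemma pos_square:
  fixes x :: "'a::cstar_algebra"
  assumes "star x = x"
  shows "pos (x * x)"
proof (cases "x = 0")
  case False
  define h where "h = (1 / norm x) *\<^sub>R x"
  have "pos (h * h)"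
    using norm_one_minus_square[of h] assms False
    by (auto simp: pos_def h_def star_mult intro!: exI[of _ 1])
  then have "pos ((norm x)\<^sup>2 *\<^sub>R (h * h))" by (intro pos_scaleR) auto
  then show ?thesis using False by (simp add: h_def power2_eq_square)
qed simp

text \<open>
  The last clause, that the root lies in the bicommutant of \<open>x\<close>, is what makes the product of
  commuting positive elements positive.
\<close>

lemma pos_sqrt:
  fixes x :: "'a::cstar_algebra"
  assumes "pos x"
  obtains y where "pos y" "y * y = x" "\<And>c. c * x = x * c \<Longrightarrow> c * y = y * c"
proof (cases "x = 0")
  case True
  then show ?thesis using that[of 0] by simp
next
  case False
  obtain t where t: "0 \<le> t" "norm (of_real t - x) \<le> t" using assms by (auto simp: pos_def)
  then have tpos: "t > 0" using False by (cases "t = 0") auto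
  define b where "b = 1 - (1/t) *\<^sub>R x"
  have "of_real t - x = t *\<^sub>R b" using tpos by (simp add: b_def of_real_def algebra_simps)
  then have nb: "norm b \<le> 1" using t tpos by simp
  have sb: "star b = b" using assms by (simp add: b_def star_diff pos_star)
  obtain z where z: "star z = z" "norm z \<le> 1" "(1 - z) * (1 - z) = 1 - b"
      "\<And>c. c * b = b * c \<Longrightarrow> c * z = z * c"
    using one_minus_sqrt_exists[OF sb nb] by blast
  have "pos (1 - z)"
    using z by (auto simp: pos_def star_diff intro!: exI[of _ 1])
  then have "pos (sqrt t *\<^sub>R (1 - z))" using tpos by (intro pos_scaleR) auto
  moreover have "(sqrt t *\<^sub>R (1 - z)) * (sqrt t *\<^sub>R (1 - z)) = x"
    using tpos by (simp add: z(3) b_def)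
  moreover have "c * (sqrt t *\<^sub>R (1 - z)) = (sqrt t *\<^sub>R (1 - z)) * c" if "c * x = x * c" for c
  proof -
    have "c * b = b * c" using that by (simp add: b_def algebra_simps)
    from z(4)[OF this] show ?thesis by (simp add: algebra_simps)
  qed
  ultimately show ?thesis by (rule that)
qed

lemma pos_mult_commute:
  fixes x y :: "'a::cstar_algebra"
  assumes "pos x" "pos y" "x * y = y * x"
  shows "pos (x * y)"
proof -
  obtain a where a: "pos a" "a * a = x" "\<And>c. c * x = x * c \<Longrightarrow> c * a = a * c"
    using pos_sqrt[OF assms(1)] by blast
  have ya: "y * a = a * y" using a(3)[of y] assms(3) by simp
  obtain b where b: "pos b" "b * b = y" "\<And>c. c * y = y * c \<Longrightarrow> c * b = b * c"
    using pos_sqrt[OF assms(2)] by blast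
  have ab: "a * b = b * a" using b(3)[of a] ya by simp
  have "x * y = (a * b) * (a * b)" unfolding a(2)[symmetric] b(2)[symmetric]
    by (metis ab mult.assoc)
  moreover have "star (a * b) = a * b" using ab by (simp add: star_mult pos_star[OF a(1)] pos_star[OF b(1)])
  ultimately show ?thesis using pos_square by simp
qed

lemma pos_power: "pos x \<Longrightarrow> pos (x ^ n :: 'a::cstar_algebra)"
  by (induction n) (auto intro: pos_mult_commute simp: power_commutes)

text \<open>After scaling to \<open>r = 1\<close>, \<open>x = z\<^sup>2\<close> and \<open>1 - x = y\<^sup>2\<close> with \<open>z + i y\<close> unitary.\<close>

lemma norm_le_if_le_of_real:
  fixes x :: "'a::cstar_algebra"
  assumes "pos x" "x \<preceq> of_real r" "0 \<le> r"
  shows "norm x \<le> r"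
proof -
  have main: "norm x \<le> 1" if px: "pos x" and p1: "x \<preceq> 1" for x :: 'a
  proof -
    obtain z where z: "pos z" "z * z = x" "\<And>c. c * x = x * c \<Longrightarrow> c * z = z * c"
      using pos_sqrt[OF px] by blast
    obtain y where y: "pos y" "y * y = 1 - x" "\<And>c. c * (1 - x) = (1 - x) * c \<Longrightarrow> c * y = y * c"
      using pos_sqrt[OF p1] by blast
    have zy: "z * y = y * z"
    proof (rule y(3))
      have "z * x = x * z" using z(2) by (metis mult.assoc)
      then show "z * (1 - x) = (1 - x) * z" by (simp add: algebra_simps)
    qed
    define u where "u = z + \<i> *\<^sub>C y"
    have su: "star u = z - \<i> *\<^sub>C y"
      by (simp add: u_def star_add star_scaleC pos_star[OF z(1)] pos_star[OF y(1)] scaleC_minus_left)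
    have "star u * u = z * z + y * y"
      unfolding su unfolding u_def
      by (simp add: algebra_simps mult_scaleC_left mult_scaleC_right scaleC_scaleC
          scaleC_minus_left scaleC_one scaleC_diff_right scaleC_add_right zy)
    then have "star u * u = 1" by (simp add: z(2) y(2))
    then have nu: "norm u = 1" by (rule norm_unitary)
    have "u + star u = 2 *\<^sub>R z" unfolding su unfolding u_def by (simp add: scaleR_2)
    then have "2 * norm z = norm (u + star u)" by simp
    also have "\<dots> \<le> 2" using norm_triangle_ineq[of u "star u"] nu by simp
    finally have "norm z \<le> 1" by simp
    then have "(norm z)\<^sup>2 \<le> 1" by (simp add: power_le_one)
    then show ?thesis
      by (simp only: norm_square_selfadjoint[OF pos_star[OF z(1)]] z(2)[symmetric])
  qed
  have pos_r: "norm x \<le> s" if s: "s > 0" "x \<preceq> of_real s" for s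
  proof -
    have "norm ((1/s) *\<^sub>R x) \<le> 1"
    proof (rule main)
      show "pos ((1/s) *\<^sub>R x)" using s assms by (intro pos_scaleR) auto
      have "pos ((1/s) *\<^sub>R (of_real s - x))" using s by (intro pos_scaleR) auto
      then show "(1/s) *\<^sub>R x \<preceq> 1" using s by (simp add: scaleR_diff_right of_real_def)
    qed
    then show ?thesis using s by (simp add: field_simps)
  qed
  have "norm x \<le> r + e" if "e > 0" for e
  proof (rule pos_r)
    show "x \<preceq> of_real (r + e)"
      using pos_add[OF assms(2) pos_of_real[of e]] that by (simp add: algebra_simps)
  qed (use assms that in auto)
  then show ?thesis by (rule field_le_epsilon)
qed

lemma norm_le_if_between:
  fixes x :: "'a::cstar_algebra"
  assumes "x \<preceq> of_real r" "pos (x + of_real r)" "0 \<le> r"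
  shows "norm x \<le> r"
proof -
  have sx: "star x = x" using pos_star[OF assms(1)] by (simp add: star_diff)
  have comm: "x * of_real r = of_real r * x" by (simp add: of_real_def)
  have "pos ((of_real r - x) * (x + of_real r))"
    using assms comm by (intro pos_mult_commute) (auto simp: algebra_simps)
  also have "(of_real r - x) * (x + of_real r) = of_real (r * r) - x * x"
    using comm by (simp add: algebra_simps)
  finally have "norm (x * x) \<le> r * r"
    using pos_square[OF sx] by (intro norm_le_if_le_of_real) auto
  then have "(norm x)\<^sup>2 \<le> r\<^sup>2" using norm_square_selfadjoint[OF sx] by (simp add: power2_eq_square)
  then show ?thesis using assms(3) by (rule power2_le_imp_le)
qed

lemma norm_mono_pos:
  fixes x y :: "'a::cstar_algebra"
  assumes "pos x" "x \<preceq> y"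
  shows "norm x \<le> norm y"
proof (rule norm_le_if_le_of_real[OF assms(1)])
  have "star y = y" using pos_star[OF pos_add[OF assms]] by simp
  then show "x \<preceq> of_real (norm y)" using le_pos_trans[OF assms(2) le_norm] by blast
qed simp

lemma pos_antisym:
  fixes x :: "'a::cstar_algebra"
  assumes "pos x" "pos (- x)"
  shows "x = 0"
  using norm_mono_pos[of x 0] assms by simp

lemma norm_of_real_minus_pos:
  fixes x :: "'a::cstar_algebra"
  assumes "pos x" "norm x \<le> r"
  shows "norm (of_real r - x) \<le> r"
  using assms(1) le_norm[OF pos_star[OF assms(1)] assms(2)] order_trans[OF norm_ge_zero assms(2)]
  by (intro norm_le_if_le_of_real) auto

lemma norm_one_minus_le_1: "pos x \<Longrightarrow> x \<preceq> 1 \<Longrightarrow> norm (1 - x :: 'a::cstar_algebra) \<le> 1"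
  using norm_le_if_le_of_real[of "1 - x" 1] by simp

lemma pos_closed:
  fixes f :: "nat \<Rightarrow> 'a::cstar_algebra"
  assumes lim: "f \<longlonglongrightarrow> x" and p: "\<And>n. pos (f n)"
  shows "pos x"
proof -
  have "Bseq f" using lim convergent_def convergent_imp_Bseq by blast
  then obtain r where r: "0 < r" "\<And>n. norm (f n) \<le> r" by (auto simp: Bseq_def)
  have "star x = x"
    using LIMSEQ_unique[OF tendsto_star[OF lim]] lim p by (simp add: pos_star)
  moreover have "norm (of_real r - x) \<le> r"
    using norm_of_real_minus_pos[OF p r(2)]
    by (intro LIMSEQ_le_const2[OF tendsto_norm[OF tendsto_diff[OF tendsto_const lim]]]) auto
  ultimately show ?thesis using r by (auto simp: pos_def intro!: exI[of _ r])
qed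


section \<open>Continuous functional calculus on the unit interval\<close>

text \<open>
  The \<open>n\<close>-th Bernstein operator, written by de Casteljau's recursion so that no binomial
  coefficients are needed: \<open>g k\<close> is the control value at the node \<open>k / n\<close>. It is a
  positive operator as a function of \<open>g\<close> as soon as \<open>0 \<preceq> h \<preceq> 1\<close>.
\<close>

primrec casteljau :: "'a::cstar_algebra \<Rightarrow> nat \<Rightarrow> (nat \<Rightarrow> real) \<Rightarrow> 'a" where
  "casteljau h 0 g = of_real (g 0)"
| "casteljau h (Suc n) g = (1 - h) * casteljau h n g + h * casteljau h n (\<lambda>k. g (Suc k))"

lemma casteljau_add: "casteljau h n (\<lambda>k. f k + g k) = casteljau h n f + casteljau h n g"
  by (induction n arbitrary: f g) (simp_all add: algebra_simps)

lemma casteljau_scaleR: "casteljau h n (\<lambda>k. r * g k) = r *\<^sub>R casteljau h n g"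
  by (induction n arbitrary: g) (simp_all add: algebra_simps of_real_def)

lemma casteljau_diff: "casteljau h n (\<lambda>k. f k - g k) = casteljau h n f - casteljau h n g"
  using casteljau_add[of h n f "\<lambda>k. (-1) * g k"] unfolding casteljau_scaleR by simp

lemma casteljau_const: "casteljau h n (\<lambda>_. r) = of_real r"
  by (induction n) (simp_all add: algebra_simps)

lemma commute_mult: "c * a = a * c \<Longrightarrow> c * x = x * c \<Longrightarrow> c * (a * x) = (a * x) * (c::'a::cstar_algebra)"
  by (metis mult.assoc)

lemma casteljau_commute: "c * h = h * c \<Longrightarrow> c * casteljau h n g = casteljau h n g * c"
proof (induction n arbitrary: g)
  case (Suc n)
  have "c * (1 - h) = (1 - h) * c" using Suc.prems by (simp add: algebra_simps)
  from commute_mult[OF this Suc.IH[OF Suc.prems]] commute_mult[OF Suc.prems Suc.IH[OF Suc.prems]]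
  show ?case by (simp add: distrib_left distrib_right)
qed (simp add: of_real_def)

lemma casteljau_pos:
  assumes h: "pos h" "h \<preceq> 1" and g: "\<And>k. k \<le> n \<Longrightarrow> 0 \<le> g k"
  shows "pos (casteljau h n g)"
  using g
proof (induction n arbitrary: g)
  case (Suc n)
  have c: "h * casteljau h n f = casteljau h n f * h" for f
    by (rule casteljau_commute) simp
  have c': "(1 - h) * casteljau h n f = casteljau h n f * (1 - h)" for f
    by (rule casteljau_commute) (simp add: algebra_simps)
  have "pos (casteljau h n g)" "pos (casteljau h n (\<lambda>k. g (Suc k)))"
    by (rule Suc.IH; simp add: Suc.prems)+
  then show ?case
    using h c c' by (auto intro!: pos_add pos_mult_commute)
qed (simp add: pos_of_real)

lemma norm_casteljau_le:
  assumes h: "pos h" "h \<preceq> 1" and g: "\<And>k. k \<le> n \<Longrightarrow> \<bar>g k\<bar> \<le> M"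
  shows "norm (casteljau h n g) \<le> M"
proof (rule norm_le_if_between)
  have "pos (casteljau h n (\<lambda>k. M - g k))"
    by (rule casteljau_pos[OF h]) (use g in \<open>force simp: abs_le_iff\<close>)
  then show "casteljau h n g \<preceq> of_real M" by (simp add: casteljau_diff casteljau_const)
  have "pos (casteljau h n (\<lambda>k. g k + M))"
    by (rule casteljau_pos[OF h]) (use g in \<open>force simp: abs_le_iff\<close>)
  then show "pos (casteljau h n g + of_real M)" by (simp add: casteljau_add casteljau_const)
  show "0 \<le> M" using order_trans[OF abs_ge_zero g[of 0]] by simp
qed

text \<open>The Bernstein basis identity \<open>k * (n choose k) = n * ((n - 1) choose (k - 1))\<close>.\<close>

lemma casteljau_times_index:
  "casteljau h (Suc n) (\<lambda>k. real k * g k)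
     = real (Suc n) *\<^sub>R (h * casteljau h n (\<lambda>k. g (Suc k)))"
proof (induction n arbitrary: g)
  case (Suc n)
  have c: "(1 - h) * (h * x) = h * ((1 - h) * x)" for x by (simp add: algebra_simps)
  have shift: "casteljau h (Suc n) (\<lambda>k. real (Suc k) * g (Suc k))
    = real (Suc n) *\<^sub>R (h * casteljau h n (\<lambda>k. g (Suc (Suc k)))) + casteljau h (Suc n) (\<lambda>k. g (Suc k))"
    unfolding Suc.IH[of "\<lambda>k. g (Suc k)", symmetric] casteljau_add[symmetric]
    by (simp add: algebra_simps)
  have "casteljau h (Suc (Suc n)) (\<lambda>k. real k * g k)
    = (1 - h) * casteljau h (Suc n) (\<lambda>k. real k * g k)
      + h * casteljau h (Suc n) (\<lambda>k. real (Suc k) * g (Suc k))"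
    by (rule casteljau.simps(2))
  also have "\<dots> = real (Suc n) *\<^sub>R (h * ((1 - h) * casteljau h n (\<lambda>k. g (Suc k))
      + h * casteljau h n (\<lambda>k. g (Suc (Suc k))))) + h * casteljau h (Suc n) (\<lambda>k. g (Suc k))"
    unfolding shift Suc.IH[of g]
    by (simp only: mult_scaleR_right c distrib_left scaleR_add_right add.assoc)
  also have "\<dots> = real (Suc n) *\<^sub>R (h * casteljau h (Suc n) (\<lambda>k. g (Suc k)))
      + h * casteljau h (Suc n) (\<lambda>k. g (Suc k))"
    by (simp only: casteljau.simps(2))
  also have "\<dots> = real (Suc (Suc n)) *\<^sub>R (h * casteljau h (Suc n) (\<lambda>k. g (Suc k)))"
    by (simp only: of_nat_Suc[of "Suc n"] scaleR_add_left scaleR_one add.commute)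
  finally show ?case .
qed (simp add: of_real_def)

definition bernstein :: "'a::cstar_algebra \<Rightarrow> nat \<Rightarrow> (real \<Rightarrow> real) \<Rightarrow> 'a" where
  "bernstein h n f = casteljau h n (\<lambda>k. f (real k / real n))"

text \<open>The limit exists for continuous \<open>f\<close> if \<open>0 \<preceq> h \<preceq> 1\<close>; see \<open>fcalc_tendsto\<close>.\<close>

definition fcalc :: "'a::cstar_algebra \<Rightarrow> (real \<Rightarrow> real) \<Rightarrow> 'a" where
  "fcalc h f = lim (\<lambda>n. bernstein h n f)"

context
  fixes h :: "'a::cstar_algebra"
  assumes h: "pos h" "h \<preceq> 1"
begin

lemma node_in_unit: "k \<le> n \<Longrightarrow> real k / real n \<in> {0..1}"
  by (cases "n = 0") auto

lemma bernstein_diff_le: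
  assumes "\<And>s. s \<in> {0..1} \<Longrightarrow> \<bar>f s - g s\<bar> \<le> M"
  shows "norm (bernstein h n f - bernstein h n g) \<le> M"
  unfolding bernstein_def casteljau_diff[symmetric]
  by (rule norm_casteljau_le[OF h]) (use assms node_in_unit in blast)

lemma bernstein_times_id:
  assumes f: "continuous_on {0..1} f"
  shows "(\<lambda>n. bernstein h (Suc n) (\<lambda>s. s * f s) - h * bernstein h n f) \<longlonglongrightarrow> 0"
proof (rule metric_LIMSEQ_I)
  fix e :: real assume e: "e > 0"
  have "uniformly_continuous_on {0..1} f"
    using f by (intro compact_uniformly_continuous) auto
  then obtain d where d: "d > 0"
      "\<And>s t. s \<in> {0..1} \<Longrightarrow> t \<in> {0..1} \<Longrightarrow> dist t s < d \<Longrightarrow> dist (f t) (f s) < e/2"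
    using half_gt_zero[OF e] unfolding uniformly_continuous_on_def by metis
  obtain N where N: "1 / real (Suc N) < d" using d nat_approx_posE by blast
  have "dist (bernstein h (Suc n) (\<lambda>s. s * f s) - h * bernstein h n f) 0 < e" if n: "n \<ge> Suc N" for n
  proof -
    have "bernstein h (Suc n) (\<lambda>s. s * f s)
        = casteljau h (Suc n) (\<lambda>k. real k * (f (real k / real (Suc n)) * (1 / real (Suc n))))"
      unfolding bernstein_def by (rule arg_cong) (simp add: field_simps)
    also have "\<dots> = h * casteljau h n (\<lambda>k. f (real (Suc k) / real (Suc n)))"
      unfolding casteljau_times_index
      by (simp only: casteljau_scaleR mult.commute[of _ "1 / real (Suc n)"]) simp
    finally have eq: "bernstein h (Suc n) (\<lambda>s. s * f s) - h * bernstein h n f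
        = h * casteljau h n (\<lambda>k. f (real (Suc k) / real (Suc n)) - f (real k / real n))"
      by (simp add: bernstein_def casteljau_diff right_diff_distrib)
    have "norm (casteljau h n (\<lambda>k. f (real (Suc k) / real (Suc n)) - f (real k / real n))) \<le> e/2"
    proof (rule norm_casteljau_le[OF h])
      fix k assume k: "k \<le> n"
      have n0: "real n > 0" using n by simp
      have "real (Suc k) / real (Suc n) - real k / real n = (real n - real k) / (real n * real (Suc n))"
        using n0 by (simp add: field_simps)
      moreover have "(real n - real k) / (real n * real (Suc n)) \<le> real n / (real n * real (Suc n))"
        by (intro divide_right_mono) auto
      moreover have "real n / (real n * real (Suc n)) = 1 / real (Suc n)"
        using n0 by simp
      moreover have "1 / real (Suc n) \<le> 1 / real (Suc N)"
        using n by (intro divide_left_mono) auto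
      moreover have "0 \<le> (real n - real k) / (real n * real (Suc n))" using k by simp
      ultimately have "dist (real (Suc k) / real (Suc n)) (real k / real n) < d"
        using N by (simp add: dist_real_def)
      from d(2)[OF node_in_unit[OF k] node_in_unit this]
      show "\<bar>f (real (Suc k) / real (Suc n)) - f (real k / real n)\<bar> \<le> e/2"
        using k by (simp add: dist_real_def)
    qed
    moreover have "norm h \<le> 1" using norm_le_if_le_of_real[of h 1] h by simp
    ultimately have "norm (bernstein h (Suc n) (\<lambda>s. s * f s) - h * bernstein h n f) \<le> 1 * (e/2)"
      unfolding eq by (intro order_trans[OF norm_mult_ineq] mult_mono) auto
    then show ?thesis using e by simp
  qed
  then show "\<exists>no. \<forall>n\<ge>no. dist (bernstein h (Suc n) (\<lambda>s. s * f s) - h * bernstein h n f) 0 < e"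
    by blast
qed

lemma bernstein_times_id_tendsto:
  assumes "continuous_on {0..1} f" "(\<lambda>n. bernstein h n f) \<longlonglongrightarrow> y"
  shows "(\<lambda>n. bernstein h n (\<lambda>s. s * f s)) \<longlonglongrightarrow> h * y"
proof -
  have "(\<lambda>n. bernstein h (Suc n) (\<lambda>s. s * f s)) \<longlonglongrightarrow> 0 + h * y"
    using tendsto_add[OF bernstein_times_id[OF assms(1)] tendsto_mult_left[OF assms(2), of h]]
    by simp
  then have "(\<lambda>n. bernstein h (Suc n) (\<lambda>s. s * f s)) \<longlonglongrightarrow> h * y" by simp
  then show ?thesis by (rule LIMSEQ_imp_Suc)
qed

lemma bernstein_power: "(\<lambda>n. bernstein h n (\<lambda>s. s ^ i)) \<longlonglongrightarrow> h ^ i"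
proof (induction i)
  case 0
  then show ?case by (simp add: bernstein_def casteljau_const)
next
  case (Suc i)
  then show ?case
    using bernstein_times_id_tendsto[OF _ Suc] by (simp add: continuous_intros)
qed

lemma bernstein_poly:
  "(\<lambda>n. bernstein h n (\<lambda>s. \<Sum>i\<le>m. c i * s ^ i)) \<longlonglongrightarrow> (\<Sum>i\<le>m. c i *\<^sub>R h ^ i)"
proof (induction m)
  case 0
  then show ?case by (simp add: bernstein_def casteljau_const of_real_def)
next
  case (Suc m)
  have "bernstein h n (\<lambda>s. \<Sum>i\<le>Suc m. c i * s ^ i)
     = bernstein h n (\<lambda>s. \<Sum>i\<le>m. c i * s ^ i) + c (Suc m) *\<^sub>R bernstein h n (\<lambda>s. s ^ Suc m)" for n
    unfolding bernstein_def casteljau_scaleR[symmetric] casteljau_add[symmetric] by simp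
  then show ?case
    using tendsto_add[OF Suc tendsto_scaleR[OF tendsto_const bernstein_power]]
    by (simp del: power_Suc)
qed

lemma poly_approx_unit:
  assumes "continuous_on {0..1} f" "0 < e"
  obtains m :: nat and c where "\<And>s::real. s \<in> {0..1} \<Longrightarrow> \<bar>f s - (\<Sum>i\<le>m. c i * s ^ i)\<bar> < e"
proof -
  obtain g where g: "real_polynomial_function g" "\<And>s. s \<in> {0..1} \<Longrightarrow> \<bar>f s - g s\<bar> < e"
    using Stone_Weierstrass_real_polynomial_function[OF _ assms] by auto
  then obtain c m where "g = (\<lambda>s. \<Sum>i\<le>m. c i * s ^ i)"
    by (auto simp: real_polynomial_function_iff_sum)
  with g(2) have "\<And>s. s \<in> {0..1} \<Longrightarrow> \<bar>f s - (\<Sum>i\<le>m. c i * s ^ i)\<bar> < e" by simp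
  then show ?thesis by (rule that)
qed

lemma fcalc_tendsto:
  assumes f: "continuous_on {0..1} f"
  shows "(\<lambda>n. bernstein h n f) \<longlonglongrightarrow> fcalc h f"
proof -
  have "Cauchy (\<lambda>n. bernstein h n f)"
  proof (rule metric_CauchyI)
    fix e :: real assume e: "e > 0"
    obtain m c where p: "\<And>s. s \<in> {0..1} \<Longrightarrow> \<bar>f s - (\<Sum>i\<le>m. c i * s ^ i)\<bar> < e/4"
      by (rule poly_approx_unit[OF f, of "e/4"]) (use e in auto)
    let ?p = "\<lambda>s. \<Sum>i\<le>m. c i * s ^ i"
    have near: "norm (bernstein h n f - bernstein h n ?p) \<le> e/4" for n
      using p by (intro bernstein_diff_le less_imp_le)
    have "Cauchy (\<lambda>n. bernstein h n ?p)" using bernstein_poly LIMSEQ_imp_Cauchy by blast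
    from metric_CauchyD[OF this, of "e/4"] e
    have "\<exists>N. \<forall>i\<ge>N. \<forall>j\<ge>N. dist (bernstein h i ?p) (bernstein h j ?p) < e/4" by simp
    then obtain N where N: "\<And>i j. i \<ge> N \<Longrightarrow> j \<ge> N \<Longrightarrow> dist (bernstein h i ?p) (bernstein h j ?p) < e/4"
      by blast
    have "dist (bernstein h i f) (bernstein h j f) < e" if "i \<ge> N" "j \<ge> N" for i j
    proof -
      have "dist (bernstein h i f) (bernstein h j f) \<le> dist (bernstein h i f) (bernstein h i ?p)
          + dist (bernstein h i ?p) (bernstein h j ?p) + dist (bernstein h j ?p) (bernstein h j f)"
        using dist_triangle[of "bernstein h i f" "bernstein h j f" "bernstein h i ?p"]
          dist_triangle[of "bernstein h i ?p" "bernstein h j f" "bernstein h j ?p"] by linarith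
      also have "\<dots> < e/4 + e/4 + e/2"
        using near[of i] near[of j, unfolded norm_minus_commute[of "bernstein h j f"]] N[OF that] e
        unfolding dist_norm[symmetric] by linarith
      also have "\<dots> = e" by simp
      finally show ?thesis .
    qed
    then show "\<exists>M. \<forall>m\<ge>M. \<forall>n\<ge>M. dist (bernstein h m f) (bernstein h n f) < e" by blast
  qed
  then show ?thesis by (simp add: Cauchy_convergent fcalc_def convergent_LIMSEQ_iff[symmetric])
qed

lemma fcalc_eqI: "(\<lambda>n. bernstein h n f) \<longlonglongrightarrow> y \<Longrightarrow> fcalc h f = y"
  by (simp add: fcalc_def limI)

lemma fcalc_const: "fcalc h (\<lambda>_. r) = of_real r"
  by (rule fcalc_eqI) (simp add: bernstein_def casteljau_const)

lemma fcalc_id: "fcalc h (\<lambda>s. s) = h"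
  by (rule fcalc_eqI) (use bernstein_power[of 1] in simp)

lemma fcalc_add:
  assumes "continuous_on {0..1} f" "continuous_on {0..1} g"
  shows "fcalc h (\<lambda>s. f s + g s) = fcalc h f + fcalc h g"
  using tendsto_add[OF fcalc_tendsto[OF assms(1)] fcalc_tendsto[OF assms(2)]]
  by (intro fcalc_eqI) (simp add: bernstein_def casteljau_add)

lemma fcalc_scaleR:
  assumes "continuous_on {0..1} f"
  shows "fcalc h (\<lambda>s. r * f s) = r *\<^sub>R fcalc h f"
  using tendsto_scaleR[OF tendsto_const fcalc_tendsto[OF assms]]
  by (intro fcalc_eqI) (simp add: bernstein_def casteljau_scaleR)

lemma fcalc_diff:
  assumes "continuous_on {0..1} f" "continuous_on {0..1} g"
  shows "fcalc h (\<lambda>s. f s - g s) = fcalc h f - fcalc h g"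
  using tendsto_diff[OF fcalc_tendsto[OF assms(1)] fcalc_tendsto[OF assms(2)]]
  by (intro fcalc_eqI) (simp add: bernstein_def casteljau_diff)

lemma fcalc_pos:
  assumes "continuous_on {0..1} f" "\<And>s. s \<in> {0..1} \<Longrightarrow> 0 \<le> f s"
  shows "pos (fcalc h f)"
  by (rule pos_closed[OF fcalc_tendsto[OF assms(1)]])
    (use assms(2) node_in_unit in \<open>unfold bernstein_def, blast intro: casteljau_pos[OF h]\<close>)

lemma fcalc_cong:
  assumes "\<And>s. s \<in> {0..1} \<Longrightarrow> f s = g s"
  shows "fcalc h f = fcalc h g"
proof -
  have "bernstein h n f = bernstein h n g" for n
    using bernstein_diff_le[of f g 0 n] assms by simp
  then show ?thesis by (simp add: fcalc_def)
qed

lemma norm_fcalc_diff_le: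
  assumes "continuous_on {0..1} f" "continuous_on {0..1} g"
    and "\<And>s. s \<in> {0..1} \<Longrightarrow> \<bar>f s - g s\<bar> \<le> M"
  shows "norm (fcalc h f - fcalc h g) \<le> M"
  by (rule LIMSEQ_le_const2[OF tendsto_norm[OF tendsto_diff[OF fcalc_tendsto[OF assms(1)]
          fcalc_tendsto[OF assms(2)]]]])
    (intro exI[of _ 0] allI impI bernstein_diff_le assms(3))

text \<open>
  Multiplicativity holds when one factor is the identity, hence when it is a polynomial,
  hence always.
\<close>

lemma fcalc_mult_poly:
  assumes g: "continuous_on {0..1} g"
  shows "fcalc h (\<lambda>s. (\<Sum>i\<le>m. c i * s ^ i) * g s) = (\<Sum>i\<le>m. c i *\<^sub>R h ^ i) * fcalc h g"
proof -
  have pw: "fcalc h (\<lambda>s. s ^ i * g s) = h ^ i * fcalc h g" for i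
  proof (induction i)
    case (Suc i)
    have c: "continuous_on {0..1} (\<lambda>s. s ^ i * g s)" by (intro continuous_intros g)
    have "fcalc h (\<lambda>s. s * (s ^ i * g s)) = h * fcalc h (\<lambda>s. s ^ i * g s)"
      by (rule fcalc_eqI[OF bernstein_times_id_tendsto[OF c fcalc_tendsto[OF c]]])
    then show ?case by (simp add: Suc mult.assoc)
  qed simp
  show ?thesis
  proof (induction m)
    case 0
    then show ?case using fcalc_scaleR[OF g] by simp
  next
    case (Suc m)
    have "fcalc h (\<lambda>s. (\<Sum>i\<le>Suc m. c i * s ^ i) * g s)
      = fcalc h (\<lambda>s. (\<Sum>i\<le>m. c i * s ^ i) * g s + c (Suc m) * (s ^ Suc m * g s))"
      by (simp add: algebra_simps)
    also have "\<dots> = fcalc h (\<lambda>s. (\<Sum>i\<le>m. c i * s ^ i) * g s)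
        + fcalc h (\<lambda>s. c (Suc m) * (s ^ Suc m * g s))"
      by (rule fcalc_add) (intro continuous_intros g)+
    also have "fcalc h (\<lambda>s. c (Suc m) * (s ^ Suc m * g s)) = c (Suc m) *\<^sub>R (h ^ Suc m * fcalc h g)"
      unfolding pw[symmetric] by (rule fcalc_scaleR) (intro continuous_intros g)
    finally show ?case unfolding Suc by (simp add: distrib_right)
  qed
qed

lemma fcalc_mult:
  assumes f: "continuous_on {0..1} f" and g: "continuous_on {0..1} g"
  shows "fcalc h (\<lambda>s. f s * g s) = fcalc h f * fcalc h g"
proof -
  obtain G where G: "0 < G" "\<And>s. s \<in> {0..1} \<Longrightarrow> \<bar>g s\<bar> \<le> G"
    using compact_imp_bounded[OF compact_continuous_image[OF g compact_Icc]]
    by (auto simp: bounded_pos)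
  define C where "C = G + norm (fcalc h g)"
  have C: "0 < C" using G(1) by (simp add: C_def add_pos_nonneg)
  have "norm (fcalc h (\<lambda>s. f s * g s) - fcalc h f * fcalc h g) \<le> 0 + e" if e: "e > 0" for e
  proof -
    obtain m c where p: "\<And>s. s \<in> {0..1} \<Longrightarrow> \<bar>f s - (\<Sum>i\<le>m. c i * s ^ i)\<bar> < e / C"
      by (rule poly_approx_unit[OF f, of "e / C"]) (use e C in auto)
    let ?p = "\<lambda>s. \<Sum>i\<le>m. c i * s ^ i"
    have cp: "continuous_on {0..1} ?p" by (intro continuous_intros)
    have 1: "norm (fcalc h (\<lambda>s. f s * g s) - fcalc h (\<lambda>s. ?p s * g s)) \<le> e / C * G"
    proof (rule norm_fcalc_diff_le)
      fix s :: real assume s: "s \<in> {0..1}"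
      have "\<bar>f s * g s - ?p s * g s\<bar> = \<bar>f s - ?p s\<bar> * \<bar>g s\<bar>"
        by (simp add: abs_mult[symmetric] left_diff_distrib)
      also have "\<dots> \<le> e / C * G" using p[OF s] G(2)[OF s] by (intro mult_mono) auto
      finally show "\<bar>f s * g s - ?p s * g s\<bar> \<le> e / C * G" .
    qed (intro continuous_intros f g)+
    have fp: "fcalc h ?p = (\<Sum>i\<le>m. c i *\<^sub>R h ^ i)" by (rule fcalc_eqI[OF bernstein_poly])
    have "norm (fcalc h f - fcalc h ?p) \<le> e / C"
      using p by (intro norm_fcalc_diff_le f cp less_imp_le)
    then have 2: "norm ((fcalc h ?p - fcalc h f) * fcalc h g) \<le> e / C * norm (fcalc h g)"
      by (intro order_trans[OF norm_mult_ineq] mult_right_mono)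
        (simp_all add: norm_minus_commute)
    have "fcalc h (\<lambda>s. f s * g s) - fcalc h f * fcalc h g
      = (fcalc h (\<lambda>s. f s * g s) - fcalc h (\<lambda>s. ?p s * g s)) + (fcalc h ?p - fcalc h f) * fcalc h g"
      unfolding fcalc_mult_poly[OF g] fp by (simp add: left_diff_distrib)
    then have "norm (fcalc h (\<lambda>s. f s * g s) - fcalc h f * fcalc h g)
        \<le> e / C * G + e / C * norm (fcalc h g)"
      using norm_triangle_mono[OF 1 2] by (simp only:)
    also have "\<dots> = e" unfolding distrib_left[symmetric] C_def[symmetric] using C by simp
    finally show ?thesis by simp
  qed
  then have "norm (fcalc h (\<lambda>s. f s * g s) - fcalc h f * fcalc h g) \<le> 0"
    by (rule field_le_epsilon)
  then show ?thesis by simp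
qed

end


section \<open>Positivity of \<open>star a * a\<close>\<close>

lemma pos_neg_parts:
  fixes x :: "'a::cstar_algebra"
  assumes sa: "star x = x"
  obtains p n where "pos p" "pos n" "x = p - n" "n * p = 0"
proof -
  define r where "r = norm x + 1"
  have r: "r > 0" "norm x \<le> r" by (auto simp: r_def add_nonneg_pos)
  define h where "h = (1/2) *\<^sub>R (1 + (1/r) *\<^sub>R x)"
  have "pos (x + of_real r)" "x \<preceq> of_real r"
    using sa r by (auto intro: minus_norm_le le_norm)
  then have "pos ((1/(2*r)) *\<^sub>R (x + of_real r))" "pos ((1/(2*r)) *\<^sub>R (of_real r - x))"
    using r by (auto intro!: pos_scaleR)
  moreover have "(1/(2*r)) *\<^sub>R (x + of_real r) = h"
    using r by (simp add: h_def scaleR_add_right of_real_def)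
  moreover have "(1/(2*r)) *\<^sub>R (of_real r - x) = 1 - h"
  proof -
    have "(1::'a) = (1/2) *\<^sub>R 1 + (1/2) *\<^sub>R 1" by (simp flip: scaleR_add_left)
    then show ?thesis using r by (simp add: h_def algebra_simps of_real_def)
  qed
  ultimately have h: "pos h" "h \<preceq> 1" by simp_all
  define f where "f s = max (r * (2 * s - 1)) 0" for s
  define g where "g s = max (- (r * (2 * s - 1))) 0" for s
  have cont: "continuous_on {0..1} f" "continuous_on {0..1} g"
    unfolding f_def g_def by (intro continuous_intros)+
  show ?thesis
  proof (rule that)
    show "pos (fcalc h f)" "pos (fcalc h g)"
      by (rule fcalc_pos[OF h]; simp add: cont; simp add: f_def g_def)+
    have "fcalc h f - fcalc h g = fcalc h (\<lambda>s. f s - g s)"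
      using fcalc_diff[OF h cont] by simp
    also have "(\<lambda>s. f s - g s) = (\<lambda>s. (2 * r) * s - r)"
      by (auto simp: f_def g_def max_def algebra_simps)
    also have "fcalc h (\<lambda>s. (2 * r) * s - r) = (2 * r) *\<^sub>R h - of_real r"
      by (subst fcalc_diff[OF h])
        (auto intro!: continuous_intros simp: fcalc_scaleR[OF h] fcalc_id[OF h] fcalc_const[OF h])
    also have "\<dots> = x" using r by (simp add: h_def scaleR_add_right of_real_def)
    finally show "x = fcalc h f - fcalc h g" by simp
    have "(\<lambda>s. g s * f s) = (\<lambda>_. 0)" by (auto simp: f_def g_def max_def)
    then show "fcalc h g * fcalc h f = 0"
      using fcalc_mult[OF h cont(2,1)] fcalc_const[OF h, of 0] by simp
  qed
qed

text \<open>
  Classically: \<open>star b * b\<close> and \<open>b * star b\<close> have the same nonzero spectrum, so they cannot have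
  opposite signs. Here the intertwining \<open>b * (1 + s * star b * b) = (1 + s * b * star b) * b\<close> is
  used directly: after multiplication by \<open>star b\<close> from the right, and with \<open>s = 1 / \<parallel>b\<parallel>\<^sup>2\<close>, the
  left side has norm at most \<open>\<parallel>b\<parallel>\<^sup>2\<close> and the right side has norm \<open>2 \<parallel>b\<parallel>\<^sup>2\<close>.
\<close>

lemma eq_0_if_neg_square:
  fixes b :: "'a::cstar_algebra"
  assumes q: "pos (- (star b * b))"
  shows "b = 0"
proof (rule ccontr)
  assume b0: "b \<noteq> 0"
  define N where "N = (norm b)\<^sup>2"
  have N: "N > 0" using b0 by (simp add: N_def)
  define c where "c = re_part b"
  define d where "d = im_part b"
  have sc: "star c = c" "star d = d" by (simp_all add: c_def d_def)
  have bcd: "b = c + \<i> *\<^sub>C d" using re_im_decomp by (simp add: c_def d_def)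
  have sb: "star b = c - \<i> *\<^sub>C d"
    by (simp add: bcd star_add star_scaleC sc scaleC_minus_left)
  have "b * star b = (c * c + d * d) + (c * c + d * d) + (- (star b * b))"
    unfolding sb unfolding bcd
    by (simp add: algebra_simps mult_scaleC_left mult_scaleC_right scaleC_scaleC
        scaleC_minus_left scaleC_one scaleC_diff_right scaleC_add_right)
  then have pbb: "pos (b * star b)"
    using q pos_square[OF sc(1)] pos_square[OF sc(2)] by (metis pos_add)
  have nbb: "norm (b * star b) = N" using cstar_identity[of "star b"] by (simp add: star_star N_def)
  have nq: "norm (star b * b) = N" by (simp add: cstar_identity N_def)
  define e where "e = (1/N) *\<^sub>R (b * star b)"
  have pe: "pos e" unfolding e_def using pbb N by (intro pos_scaleR) auto
  have ne: "norm e = 1" using N by (simp add: e_def nbb)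
  have e1: "e \<preceq> 1" using le_norm[of e 1] pe ne by (simp add: pos_star)
  define q' where "q' = (1/N) *\<^sub>R (- (star b * b))"
  have pq': "pos q'" unfolding q'_def using q N by (intro pos_scaleR) auto
  have nq': "norm q' = 1" using N by (simp add: q'_def nq)
  have "q' \<preceq> 1" using le_norm[of q' 1] pq' nq' by (simp add: pos_star)
  then have "norm (1 - q') \<le> 1" using pq' norm_one_minus_le_1 by blast
  then have "norm (b * (1 - q') * star b) \<le> norm b * 1 * norm b"
    by (intro order_trans[OF norm_mult_ineq] mult_mono order_trans[OF norm_mult_ineq]) auto
  also have "b * (1 - q') * star b = N *\<^sub>R (e + e * e)"
    using N by (simp add: q'_def e_def algebra_simps mult.assoc)
  finally have "N * norm (e + e * e) \<le> N" using N by (simp add: N_def power2_eq_square)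
  then have small: "norm (e + e * e) \<le> 1" using N by simp
  have "pos (e * (1 - e))" using pe e1 by (intro pos_mult_commute) (auto simp: algebra_simps)
  then have "2 *\<^sub>R (e * e) \<preceq> e + e * e" by (simp add: algebra_simps scaleR_2)
  moreover have "pos (2 *\<^sub>R (e * e))" using pos_square[OF pos_star[OF pe]] by (intro pos_scaleR) auto
  ultimately have "norm (2 *\<^sub>R (e * e)) \<le> 1" using norm_mono_pos small order_trans by blast
  then show False using norm_square_selfadjoint[OF pos_star[OF pe]] ne by simp
qed

theorem pos_star_mult: "pos (star a * (a::'a::cstar_algebra))"
proof -
  have "star (star a * a) = star a * a" by (simp add: star_mult star_star)
  then obtain p n where pn: "pos p" "pos n" "star a * a = p - n" "n * p = 0"
    by (rule pos_neg_parts)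
  note sn = pos_star[OF pn(2)]
  have "star (a * n) * (a * n) = n * (star a * a) * n"
    by (simp add: star_mult sn mult.assoc)
  also have "\<dots> = - (n * n * n)"
    by (simp add: pn(3) right_diff_distrib pn(4) mult.assoc)
  finally have eq: "star (a * n) * (a * n) = - (n * n * n)" .
  have "pos (n * n * n)"
    by (intro pos_mult_commute pn pos_square sn) (simp add: mult.assoc)
  then have "a * n = 0" using eq by (intro eq_0_if_neg_square) simp
  then have "n * n * n = 0" using eq by simp
  then have "(n * n) * (n * n) = 0" by (simp add: mult.assoc[symmetric])
  then have "norm (n * n) = 0"
    using norm_square_selfadjoint[of "n * n"] by (simp add: star_mult sn)
  then have "n = 0" using norm_square_selfadjoint[OF sn] by simp
  then show ?thesis using pn by simp
qed

lemma pos_conj: "pos x \<Longrightarrow> pos (star c * x * (c::'a::cstar_algebra))"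
proof -
  assume "pos x"
  then obtain y where y: "pos y" "y * y = x" by (rule pos_sqrt)
  have "star (y * c) * (y * c) = star c * x * c"
    by (simp add: star_mult pos_star[OF y(1)] y(2)[symmetric] mult.assoc)
  then show ?thesis using pos_star_mult[of "y * c"] by simp
qed

lemma conj_mono: "x \<preceq> y \<Longrightarrow> star c * x * c \<preceq> star c * y * (c::'a::cstar_algebra)"
  using pos_conj[of "y - x" c] by (simp add: algebra_simps)

lemma star_mult_le_norm: "star a * a \<preceq> of_real ((norm (a::'a::cstar_algebra))\<^sup>2)"
  by (rule le_norm) (simp_all add: star_mult star_star cstar_identity)

lemma norm_le_if_star_mult_le:
  fixes a :: "'a::cstar_algebra"
  assumes "star a * a \<preceq> of_real (r\<^sup>2)" "0 \<le> r"
  shows "norm a \<le> r"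
proof -
  have "(norm a)\<^sup>2 \<le> r\<^sup>2"
    using norm_le_if_le_of_real[OF pos_star_mult assms(1)] by (simp add: cstar_identity)
  then show ?thesis using assms(2) by (rule power2_le_imp_le)
qed


section \<open>Functionals\<close>

lemma dual_bounded: "f \<in> dual_space \<Longrightarrow> bounded_linear f"
  by (simp add: dual_space_def)

lemma dual_add: "f \<in> dual_space \<Longrightarrow> f (x + y) = f x + f y"
  by (simp add: dual_space_def bounded_linear.axioms linear_add linear_iff bounded_linear_def)

lemma dual_scaleC: "f \<in> dual_space \<Longrightarrow> f (c *\<^sub>C x) = c * f x"
  by (simp add: dual_space_def)

lemma dual_scaleR: "f \<in> dual_space \<Longrightarrow> f (r *\<^sub>R x) = of_real r * f x"
  by (simp add: dual_scaleC scaleR_scaleC)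

lemma dual_zero: "f \<in> dual_space \<Longrightarrow> f 0 = 0"
  using dual_scaleC[of f 0 0] by simp

lemma dual_minus: "f \<in> dual_space \<Longrightarrow> f (- x) = - f x"
  using dual_scaleR[of f "-1" x] by simp

lemma dual_diff: "f \<in> dual_space \<Longrightarrow> f (x - y) = f x - f y"
  using dual_add[of f x "- y"] by (simp add: dual_minus)

lemma dual_of_real: "f \<in> dual_space \<Longrightarrow> f (of_real r) = of_real r * f 1"
  by (simp add: of_real_def dual_scaleR)

lemma dual_sum: "f \<in> dual_space \<Longrightarrow> f (sum g I) = (\<Sum>i\<in>I. f (g i))"
  by (induction I rule: infinite_finite_induct) (simp_all add: dual_add dual_zero)

lemmas dual_simps = dual_add dual_diff dual_scaleC dual_scaleR dual_zero dual_minus dual_of_real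

lemma dual_spaceI:
  fixes f :: "'a::cstar_algebra \<Rightarrow> complex"
  assumes "\<And>x y. f (x + y) = f x + f y" "\<And>c x. f (c *\<^sub>C x) = c * f x"
    and "\<And>x. cmod (f x) \<le> K * norm x"
  shows "f \<in> dual_space"
proof -
  have "bounded_linear f"
    by (rule bounded_linear_intro[where K = K])
      (use assms in \<open>auto simp: scaleR_scaleC mult.commute scaleR_conv_of_real\<close>)
  then show ?thesis using assms by (simp add: dual_space_def)
qed

lemma hermitian_selfadjoint_real:
  assumes "hermitian_functional f" "star x = x"
  shows "f x = of_real (Re (f x))"
  using assms by (metis Reals_cnj_iff hermitian_functional_def of_real_Re)

lemma hermitian_re_part:
  assumes f: "hermitian_functional f"
  shows "Re (f x) = Re (f (re_part x))"
proof -
  have fd: "f \<in> dual_space" and fs: "f (star x) = cnj (f x)"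
    using f by (auto simp: hermitian_functional_def)
  show ?thesis by (simp add: re_part_def dual_simps[OF fd] fs)
qed

context
  fixes \<phi> :: "'a::cstar_algebra \<Rightarrow> complex"
  assumes \<phi>: "positive_functional \<phi>"
begin

lemma pf_dual: "\<phi> \<in> dual_space"
  using \<phi> by (simp add: positive_functional_def)

lemma pf_nonneg: "pos x \<Longrightarrow> 0 \<le> Re (\<phi> x)" and pf_real: "pos x \<Longrightarrow> Im (\<phi> x) = 0"
proof -
  assume "pos x"
  then obtain y where "pos y" "y * y = x" by (rule pos_sqrt)
  then have "x = star y * y" by (simp add: pos_star)
  then have "\<phi> x \<in> \<real>\<^sub>\<ge>\<^sub>0" using \<phi> by (simp add: positive_functional_def)
  then show "0 \<le> Re (\<phi> x)" "Im (\<phi> x) = 0" by (auto simp: complex_nonneg_Reals_iff)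
qed

lemma pf_mono: "x \<preceq> y \<Longrightarrow> Re (\<phi> x) \<le> Re (\<phi> y)"
  using pf_nonneg[of "y - x"] by (simp add: dual_diff[OF pf_dual])

lemma pf_one_nonneg: "0 \<le> Re (\<phi> 1)"
  by (rule pf_nonneg) simp

lemma pf_selfadjoint_real: "star x = x \<Longrightarrow> Im (\<phi> x) = 0"
proof -
  assume "star x = x"
  then obtain p n where "pos p" "pos n" "x = p - n" by (rule pos_neg_parts)
  then show ?thesis by (simp add: dual_diff[OF pf_dual] pf_real)
qed

lemma pf_star: "\<phi> (star x) = cnj (\<phi> x)"
proof -
  have sx: "star x = re_part x - \<i> *\<^sub>C im_part x"
    by (subst re_im_decomp[of x]) (simp add: star_add star_scaleC scaleC_minus_left)
  have "\<phi> x = \<phi> (re_part x) + \<i> * \<phi> (im_part x)"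
    by (subst re_im_decomp[of x]) (simp add: dual_simps[OF pf_dual])
  moreover have "\<phi> (star x) = \<phi> (re_part x) - \<i> * \<phi> (im_part x)"
    unfolding sx by (simp add: dual_simps[OF pf_dual])
  ultimately show ?thesis
    using pf_selfadjoint_real[of "re_part x"] pf_selfadjoint_real[of "im_part x"]
    by (simp add: complex_eq_iff)
qed

text \<open>
  Positivity at \<open>x - t B y\<close>, where \<open>B = \<phi> (star y * x)\<close>, is a quadratic inequality in the
  real number \<open>t\<close>.
\<close>

lemma cauchy_schwarz:
  "(cmod (\<phi> (star y * x)))\<^sup>2 \<le> Re (\<phi> (star x * x)) * Re (\<phi> (star y * y))"
proof -
  define B where "B = \<phi> (star y * x)"
  define b where "b = (cmod B)\<^sup>2"
  define A where "A = Re (\<phi> (star x * x))"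
  define D where "D = Re (\<phi> (star y * y))"
  have A0: "0 \<le> A" and D0: "0 \<le> D" unfolding A_def D_def by (intro pf_nonneg pos_star_mult)+
  have cB: "\<phi> (star x * y) = cnj B"
    unfolding B_def pf_star[symmetric] by (simp add: star_mult star_star)
  have q: "0 \<le> A - 2 * t * b + t\<^sup>2 * b * D" for t :: real
  proof -
    define c where "c = of_real t * B"
    have "star (x - c *\<^sub>C y) * (x - c *\<^sub>C y)
        = star x * x - c *\<^sub>C (star x * y) - cnj c *\<^sub>C (star y * x) + (cnj c * c) *\<^sub>C (star y * y)"
      by (simp add: star_diff star_scaleC algebra_simps mult_scaleC_left mult_scaleC_right
          scaleC_scaleC scaleC_diff_right)
    then have "\<phi> (star (x - c *\<^sub>C y) * (x - c *\<^sub>C y))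
        = \<phi> (star x * x) - c * cnj B - cnj c * B + (cnj c * c) * \<phi> (star y * y)"
      by (simp add: dual_simps[OF pf_dual] cB B_def)
    moreover have "c * cnj B = of_real (t * b)" "cnj c * B = of_real (t * b)"
        "cnj c * c = of_real (t\<^sup>2 * b)"
      by (simp_all add: c_def b_def complex_norm_square power2_eq_square mult.commute)
        (simp_all add: complex_norm_square[symmetric] power2_eq_square[symmetric] ac_simps)
    ultimately have "Re (\<phi> (star (x - c *\<^sub>C y) * (x - c *\<^sub>C y))) = A - 2 * t * b + t\<^sup>2 * b * D"
      by (simp add: A_def D_def)
    then show ?thesis using pf_nonneg[OF pos_star_mult] by metis
  qed
  have b0: "0 \<le> b" by (simp add: b_def)
  have "b \<le> A * D"
  proof (cases "D = 0")
    case True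
    have "b = 0"
    proof (rule ccontr)
      assume "b \<noteq> 0"
      then show False using q[of "(A + 1) / (2 * b)"] True by simp
    qed
    then show ?thesis using A0 D0 by simp
  next
    case False
    then have "D > 0" using D0 by simp
    then have "0 \<le> A - b / D" using q[of "1 / D"] by (simp add: power2_eq_square field_simps)
    then show ?thesis using \<open>D > 0\<close> by (simp add: field_simps)
  qed
  then show ?thesis by (simp add: b_def B_def A_def D_def)
qed

lemma pf_star_mult_le: "Re (\<phi> (star x * x)) \<le> Re (\<phi> 1) * (norm x)\<^sup>2"
proof -
  have "Re (\<phi> (of_real r)) = Re (\<phi> 1) * r" for r by (simp add: dual_of_real[OF pf_dual])
  then show ?thesis using pf_mono[OF star_mult_le_norm[of x]] by metis
qed

lemma pf_bound: "cmod (\<phi> x) \<le> Re (\<phi> 1) * norm x"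
proof -
  have "(cmod (\<phi> x))\<^sup>2 \<le> Re (\<phi> (star x * x)) * Re (\<phi> 1)"
    using cauchy_schwarz[of 1 x] by simp
  also have "\<dots> \<le> (Re (\<phi> 1) * (norm x)\<^sup>2) * Re (\<phi> 1)"
    by (intro mult_right_mono pf_star_mult_le pf_one_nonneg)
  also have "\<dots> = (Re (\<phi> 1) * norm x)\<^sup>2" by (simp add: power2_eq_square)
  finally show ?thesis
    by (rule power2_le_imp_le) (intro mult_nonneg_nonneg pf_one_nonneg norm_ge_zero)
qed

end

lemma positive_functionalI:
  assumes "f \<in> dual_space" "\<And>x. pos x \<Longrightarrow> 0 \<le> Re (f x)" "\<And>x. pos x \<Longrightarrow> Im (f x) = 0"
  shows "positive_functional f"
  using assms pos_star_mult by (auto simp: positive_functional_def complex_nonneg_Reals_iff)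

text \<open>If \<open>0 \<preceq> x \<preceq> 1\<close>, then \<open>1 - x\<close> is a contraction, so that \<open>\<rho> (1 - x) \<le> \<rho> 1\<close>.\<close>

lemma positive_if_norm_le_one:
  assumes h: "hermitian_functional \<rho>" and b: "\<And>x. cmod (\<rho> x) \<le> Re (\<rho> 1) * norm x"
  shows "positive_functional \<rho>"
proof (rule positive_functionalI)
  show d: "\<rho> \<in> dual_space" using h by (simp add: hermitian_functional_def)
  fix x :: 'a assume x: "pos x"
  show "Im (\<rho> x) = 0"
    using hermitian_selfadjoint_real[OF h pos_star[OF x]] by (metis Im_complex_of_real)
  have le: "norm (of_real (norm x) - x) \<le> norm x" by (rule norm_of_real_minus_pos[OF x]) simp
  have "norm x * Re (\<rho> 1) - Re (\<rho> x) = Re (\<rho> (of_real (norm x) - x))"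
    by (simp add: dual_simps[OF d])
  also have "\<dots> \<le> Re (\<rho> 1) * norm (of_real (norm x) - x)"
    using b complex_Re_le_cmod order_trans by blast
  also have "\<dots> \<le> Re (\<rho> 1) * norm x"
    using order_trans[OF norm_ge_zero b[of 1]] le by (intro mult_left_mono) auto
  finally show "0 \<le> Re (\<rho> x)" by (simp add: mult.commute)
qed

lemma restr_norm_bdd: "f \<in> dual_space \<Longrightarrow> bdd_above ((\<lambda>x. cmod (f x) / norm x) ` J)"
  using bounded_linear.bounded[OF dual_bounded]
  by (metis (no_types, lifting) bdd_aboveI2 le_onorm dual_bounded)

lemma restr_norm_bound:
  assumes "f \<in> dual_space" "x \<in> J"
  shows "cmod (f x) \<le> restr_norm f J * norm x"
proof (cases "x = 0")
  case False
  have "cmod (f x) / norm x \<le> restr_norm f J"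
    unfolding restr_norm_def by (rule cSUP_upper[OF assms(2) restr_norm_bdd[OF assms(1)]])
  then show ?thesis using False by (simp add: field_simps)
qed (simp add: dual_zero assms)

lemma restr_norm_leI:
  assumes "0 \<in> J" "0 \<le> c" "\<And>x. x \<in> J \<Longrightarrow> cmod (f x) \<le> c * norm x"
  shows "restr_norm f J \<le> c"
  unfolding restr_norm_def
proof (rule cSUP_least)
  fix x assume "x \<in> J"
  then show "cmod (f x) / norm x \<le> c"
    using assms by (cases "x = 0") (auto simp: divide_le_eq)
qed (use assms in auto)

lemma restr_norm_nonneg: "f \<in> dual_space \<Longrightarrow> 0 \<in> J \<Longrightarrow> 0 \<le> restr_norm f J"
  using cSUP_upper[OF _ restr_norm_bdd, of 0 J f] by (simp add: restr_norm_def)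

lemma restr_norm_approx:
  fixes f :: "'a::cstar_algebra \<Rightarrow> complex"
  assumes f: "f \<in> dual_space" and J: "0 \<in> J" "\<And>r x. x \<in> J \<Longrightarrow> r *\<^sub>R x \<in> J" and e: "0 < e"
  obtains z where "z \<in> J" "norm z \<le> 1" "restr_norm f J - e \<le> cmod (f z)"
proof -
  have "restr_norm f J - e < (SUP x\<in>J. cmod (f x) / norm x)"
    using e by (simp add: restr_norm_def)
  then obtain x where x: "x \<in> J" "restr_norm f J - e < cmod (f x) / norm x"
    using less_cSUP_iff[OF _ restr_norm_bdd[OF f]] J by blast
  show ?thesis
  proof (rule that)
    show "(1 / norm x) *\<^sub>R x \<in> J" by (intro J x)
    show "norm ((1 / norm x) *\<^sub>R x) \<le> 1" by simp
    show "restr_norm f J - e \<le> cmod (f ((1 / norm x) *\<^sub>R x))"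
      using x(2) by (simp add: dual_scaleR[OF f] norm_mult norm_divide)
  qed
qed

lemma onorm_eq_restr_norm: "onorm f = restr_norm f UNIV"
  by (simp add: onorm_def restr_norm_def)

lemma pf_restr_norm_UNIV:
  assumes "positive_functional \<phi>"
  shows "restr_norm \<phi> UNIV = Re (\<phi> 1)"
proof (rule antisym)
  show "restr_norm \<phi> UNIV \<le> Re (\<phi> 1)"
    using pf_bound[OF assms] pf_one_nonneg[OF assms] by (intro restr_norm_leI) auto
  show "Re (\<phi> 1) \<le> restr_norm \<phi> UNIV"
    using restr_norm_bound[OF pf_dual[OF assms], of 1 UNIV] complex_Re_le_cmod[of "\<phi> 1"] by simp
qed

lemma closed_ideal_UNIV: "closed_ideal UNIV"
  by (simp add: closed_ideal_def)

lemma closed_idealD: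
  assumes "closed_ideal J"
  shows "0 \<in> J" "x \<in> J \<Longrightarrow> y \<in> J \<Longrightarrow> x + y \<in> J" "x \<in> J \<Longrightarrow> c *\<^sub>C x \<in> J" "x \<in> J \<Longrightarrow> r *\<^sub>R x \<in> J"
    "x \<in> J \<Longrightarrow> a * x \<in> J" "x \<in> J \<Longrightarrow> x * a \<in> J"
  using assms by (auto simp: closed_ideal_def scaleR_scaleC)

lemma closed_ideal_diff: "closed_ideal J \<Longrightarrow> x \<in> J \<Longrightarrow> y \<in> J \<Longrightarrow> x - y \<in> J"
  using closed_idealD(2)[of J x "- y"] closed_idealD(4)[of J y "-1"] by simp


section \<open>The maps in \<open>E(A)\<close>\<close>

definition kraus :: "'a::cstar_algebra list \<Rightarrow> 'a \<Rightarrow> 'a" where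
  "kraus as x = (\<Sum>a\<leftarrow>as. star a * x * a)"

lemma kraus_Nil [simp]: "kraus [] x = 0" and
  kraus_Cons: "kraus (a # as) x = star a * x * a + kraus as x" and
  kraus_append: "kraus (as @ bs) x = kraus as x + kraus bs x"
  by (simp_all add: kraus_def)

lemma kraus_add: "kraus as (x + y) = kraus as x + kraus as y"
  by (induction as) (simp_all add: kraus_Cons algebra_simps)

lemma kraus_scaleR: "kraus as (r *\<^sub>R x) = r *\<^sub>R kraus as x"
  by (induction as) (simp_all add: kraus_Cons algebra_simps)

lemma kraus_scaleC: "kraus as (c *\<^sub>C x) = c *\<^sub>C kraus as x"
  using scaleC_add_right[of c 0 0]
  by (induction as) (simp_all add: kraus_Cons mult_scaleC_left mult_scaleC_right scaleC_add_right)

lemma kraus_diff: "kraus as (x - y) = kraus as x - kraus as y"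
  using kraus_add[of as "x" "(-1) *\<^sub>R y"] unfolding kraus_scaleR by simp

lemma kraus_map_mult: "kraus (map (\<lambda>a. a * s) as) x = star s * kraus as x * s"
  by (induction as) (simp_all add: kraus_Cons star_mult algebra_simps mult.assoc)

lemma kraus_map_scaleR: "kraus (map (\<lambda>a. r *\<^sub>R a) as) x = r\<^sup>2 *\<^sub>R kraus as x"
  by (induction as) (simp_all add: kraus_Cons algebra_simps power2_eq_square)

lemma kraus_pos: "pos x \<Longrightarrow> pos (kraus as x)"
  by (induction as) (auto simp: kraus_Cons intro!: pos_add pos_conj)

lemma star_kraus: "star (kraus as x) = kraus as (star x)"
  by (induction as) (simp_all add: kraus_Cons star_add star_mult star_star mult.assoc)

lemma kraus_in_ideal: "closed_ideal J \<Longrightarrow> x \<in> J \<Longrightarrow> kraus as x \<in> J"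
  by (induction as) (simp_all add: kraus_Cons closed_idealD)

lemma E_maps_eq: "E_maps = {kraus as | as. kraus as (1::'a::cstar_algebra) = 1}"
proof (intro equalityI subsetI)
  fix \<psi> :: "'a \<Rightarrow> 'a" assume "\<psi> \<in> E_maps"
  then obtain n :: nat and a where a: "(\<Sum>i=1..n. star (a i) * a i) = 1"
      "\<psi> = (\<lambda>x. \<Sum>i=1..n. star (a i) * x * a i)"
    by (auto simp: E_maps_def)
  have "kraus (map a [1..<Suc n]) x = (\<Sum>i=1..n. star (a i) * x * a i)" for x
    by (simp add: kraus_def o_def interv_sum_list_conv_sum_set_nat atLeastLessThanSuc_atLeastAtMost
        del: upt_Suc)
  then show "\<psi> \<in> {kraus as | as. kraus as 1 = 1}"
    using a by (intro CollectI exI[of _ "map a [1..<Suc n]"]) auto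
next
  fix \<psi> :: "'a \<Rightarrow> 'a" assume "\<psi> \<in> {kraus as | as. kraus as 1 = 1}"
  then obtain as where as: "kraus as 1 = 1" "\<psi> = kraus as" by auto
  define a where "a i = as ! (i - 1)" for i
  have eq: "kraus as x = (\<Sum>i=1..length as. star (a i) * x * a i)" for x
  proof -
    have "kraus as x = (\<Sum>i<length as. star (as ! i) * x * (as ! i))"
      by (simp add: kraus_def sum_list_sum_nth atLeast0LessThan)
    also have "\<dots> = (\<Sum>i=1..length as. star (a i) * x * a i)"
      by (simp add: a_def sum.atLeast1_atMost_eq)
    finally show ?thesis .
  qed
  show "\<psi> \<in> E_maps"
    unfolding E_maps_def using eq eq[of 1] as
    by (intro CollectI exI[of _ "length as"] exI[of _ a]) auto
qed

text \<open>
  The Kadison inequality \<open>star y * y \<preceq> kraus as (star x * x)\<close> for \<open>y = kraus as x\<close> comes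
  from summing \<open>star v * v\<close> over \<open>v = x * a - a * y\<close>.
\<close>

lemma norm_kraus_le:
  assumes unital: "kraus as 1 = 1"
  shows "norm (kraus as x) \<le> norm x"
proof -
  define y where "y = kraus as x"
  have expand: "(\<Sum>a\<leftarrow>as. star (x * a - a * y) * (x * a - a * y))
      = kraus as (star x * x) - kraus as (star x) * y - star y * kraus as x + star y * kraus as 1 * y"
    for as
    by (induction as) (simp_all add: kraus_Cons star_diff star_mult algebra_simps mult.assoc)
  have "pos (\<Sum>a\<leftarrow>as. star (x * a - a * y) * (x * a - a * y))" for as
    by (induction as) (auto intro: pos_add pos_star_mult)
  then have "pos (kraus as (star x * x) - kraus as (star x) * y - star y * kraus as x
      + star y * kraus as 1 * y)"
    unfolding expand[symmetric] .
  moreover have "kraus as (star x) = star y" by (simp add: y_def star_kraus)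
  ultimately have "star y * y \<preceq> kraus as (star x * x)"
    by (simp add: unital y_def[symmetric])
  moreover have "kraus as (star x * x) \<preceq> of_real ((norm x)\<^sup>2)"
    using kraus_pos[OF star_mult_le_norm[of x], of as] unital
    by (simp add: kraus_diff of_real_def kraus_scaleR del: of_real_power)
  ultimately have "star y * y \<preceq> of_real ((norm x)\<^sup>2)" by (rule le_pos_trans)
  then show ?thesis unfolding y_def[symmetric] by (rule norm_le_if_star_mult_le) simp
qed


section \<open>The closed ideal of an element and its approximate units\<close>

text \<open>
  The elements dominated by sums of \<open>star (x * c) * (x * c)\<close>. They form an ideal containing \<open>x\<close>,
  and the dominating sums are exactly what approximate units are built from below.
\<close>

definition dominated_by :: "'a::cstar_algebra \<Rightarrow> 'a set" where
  "dominated_by x = {z. \<exists>cs. star z * z \<preceq> kraus (map ((*) x) cs) 1}"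

definition ideal_gen :: "'a::cstar_algebra \<Rightarrow> 'a set" where
  "ideal_gen x = closure (dominated_by x)"

lemma dominated_self: "x \<in> dominated_by x"
  by (auto simp: dominated_by_def kraus_Cons intro!: exI[of _ "[1]"])

lemma dominated_add:
  assumes "z \<in> dominated_by x" "w \<in> dominated_by x"
  shows "z + w \<in> dominated_by x"
proof -
  obtain cs ds where cs: "star z * z \<preceq> kraus (map ((*) x) cs) 1"
      and ds: "star w * w \<preceq> kraus (map ((*) x) ds) 1"
    using assms by (auto simp: dominated_by_def)
  define es where "es = map (\<lambda>c. sqrt 2 *\<^sub>R c) (cs @ ds)"
  have "map ((*) x) es = map (\<lambda>c. sqrt 2 *\<^sub>R c) (map ((*) x) cs @ map ((*) x) ds)"
    by (simp add: es_def)
  then have es: "kraus (map ((*) x) es) 1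
      = 2 *\<^sub>R (kraus (map ((*) x) cs) 1 + kraus (map ((*) x) ds) 1)"
    by (simp only: kraus_map_scaleR kraus_append) simp
  have "2 *\<^sub>R (star z * z + star w * w) - star (z + w) * (z + w) = star (z - w) * (z - w)"
    by (simp add: star_add star_diff algebra_simps scaleR_2)
  then have "star (z + w) * (z + w) \<preceq> 2 *\<^sub>R (star z * z + star w * w)"
    using pos_star_mult[of "z - w"] by simp
  moreover have "2 *\<^sub>R (star z * z + star w * w) \<preceq> kraus (map ((*) x) es) 1"
    using pos_scaleR[OF _ pos_add[OF cs ds], of 2] unfolding es
    by (simp add: algebra_simps)
  ultimately show ?thesis unfolding dominated_by_def using le_pos_trans by blast
qed

lemma dominated_mult_left:
  assumes "z \<in> dominated_by x"
  shows "a * z \<in> dominated_by x"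
proof -
  obtain cs where cs: "star z * z \<preceq> kraus (map ((*) x) cs) 1"
    using assms by (auto simp: dominated_by_def)
  define es where "es = map (\<lambda>c. norm a *\<^sub>R c) cs"
  have "map ((*) x) es = map (\<lambda>c. norm a *\<^sub>R c) (map ((*) x) cs)" by (simp add: es_def)
  then have es: "kraus (map ((*) x) es) 1 = (norm a)\<^sup>2 *\<^sub>R kraus (map ((*) x) cs) 1"
    by (simp only: kraus_map_scaleR)
  have "star z * (star a * a) * z \<preceq> star z * of_real ((norm a)\<^sup>2) * z"
    by (rule conj_mono[OF star_mult_le_norm])
  then have "star (a * z) * (a * z) \<preceq> (norm a)\<^sup>2 *\<^sub>R (star z * z)"
    by (simp add: star_mult mult.assoc of_real_def del: of_real_power)
  moreover have "(norm a)\<^sup>2 *\<^sub>R (star z * z) \<preceq> kraus (map ((*) x) es) 1"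
    using pos_scaleR[OF _ cs, of "(norm a)\<^sup>2"] unfolding es by (simp add: scaleR_diff_right)
  ultimately show ?thesis unfolding dominated_by_def using le_pos_trans by blast
qed

lemma dominated_mult_right:
  assumes "z \<in> dominated_by x"
  shows "z * a \<in> dominated_by x"
proof -
  obtain cs where cs: "star z * z \<preceq> kraus (map ((*) x) cs) 1"
    using assms by (auto simp: dominated_by_def)
  have "map ((*) x) (map (\<lambda>c. c * a) cs) = map (\<lambda>b. b * a) (map ((*) x) cs)"
    by (simp add: mult.assoc)
  then have "kraus (map ((*) x) (map (\<lambda>c. c * a) cs)) 1 = star a * kraus (map ((*) x) cs) 1 * a"
    by (simp only: kraus_map_mult)
  then have "star (z * a) * (z * a) \<preceq> kraus (map ((*) x) (map (\<lambda>c. c * a) cs)) 1"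
    using conj_mono[OF cs, of a] by (simp add: star_mult mult.assoc)
  then show ?thesis unfolding dominated_by_def by blast
qed

lemma closed_ideal_ideal_gen: "closed_ideal (ideal_gen x)"
proof -
  have lift1: "f z \<in> ideal_gen x"
    if z: "z \<in> ideal_gen x" and f: "\<And>u. u \<in> dominated_by x \<Longrightarrow> f u \<in> dominated_by x"
      and lin: "bounded_linear f" for f z
  proof -
    obtain u where u: "\<And>n. u n \<in> dominated_by x" "u \<longlonglongrightarrow> z"
      using z unfolding ideal_gen_def closure_sequential by blast
    have "(\<lambda>n. f (u n)) \<longlonglongrightarrow> f z" by (rule bounded_linear.tendsto[OF lin u(2)])
    then show ?thesis
      using u(1) f unfolding ideal_gen_def closure_sequential
      by (intro exI[of _ "\<lambda>n. f (u n)"]) simp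
  qed
  have add: "z + w \<in> ideal_gen x" if "z \<in> ideal_gen x" "w \<in> ideal_gen x" for z w
  proof -
    obtain u where u: "\<And>n. u n \<in> dominated_by x" "u \<longlonglongrightarrow> z"
      using \<open>z \<in> _\<close> unfolding ideal_gen_def closure_sequential by blast
    obtain v where v: "\<And>n. v n \<in> dominated_by x" "v \<longlonglongrightarrow> w"
      using \<open>w \<in> _\<close> unfolding ideal_gen_def closure_sequential by blast
    show ?thesis
      unfolding ideal_gen_def closure_sequential
      using u(1) v(1) tendsto_add[OF u(2) v(2)]
      by (intro exI[of _ "\<lambda>n. u n + v n"]) (simp add: dominated_add)
  qed
  have scale: "c *\<^sub>C u \<in> dominated_by x" if "u \<in> dominated_by x" for c u
    using dominated_mult_left[OF that, of "c *\<^sub>C 1"] by (simp add: mult_scaleC_left)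
  have "0 * x \<in> dominated_by x" by (rule dominated_mult_left[OF dominated_self])
  then have zero: "0 \<in> ideal_gen x" using closure_subset by (auto simp: ideal_gen_def)
  show ?thesis
    unfolding closed_ideal_def
    using zero add lift1[OF _ scale bounded_linear_scaleC]
      lift1[OF _ dominated_mult_left bounded_linear_mult_right]
      lift1[OF _ dominated_mult_right bounded_linear_mult_left]
    by (auto simp: ideal_gen_def)
qed

lemma ideal_gen_self: "x \<in> ideal_gen x"
  using dominated_self closure_subset by (auto simp: ideal_gen_def)

lemma ideal_gen_mult_subset: "ideal_gen (x * y) \<subseteq> ideal_gen x"
  unfolding ideal_gen_def
proof (rule closure_mono, rule subsetI)
  fix z assume "z \<in> dominated_by (x * y)"
  then obtain cs where "star z * z \<preceq> kraus (map ((*) (x * y)) cs) 1"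
    by (auto simp: dominated_by_def)
  moreover have "map ((*) (x * y)) cs = map ((*) x) (map ((*) y) cs)" by (simp add: mult.assoc)
  ultimately show "z \<in> dominated_by x" by (auto simp: dominated_by_def simp del: map_map)
qed

lemma kraus_in_ideal_gen: "kraus (map ((*) x) cs) 1 \<in> ideal_gen x"
proof (induction cs)
  case Nil
  then show ?case by (simp add: closed_idealD[OF closed_ideal_ideal_gen])
next
  case (Cons c cs)
  have "star (x * c) * (x * c) \<in> ideal_gen x"
    by (intro closed_idealD[OF closed_ideal_ideal_gen] ideal_gen_self)
  then show ?case
    using Cons closed_idealD(2)[OF closed_ideal_ideal_gen] by (simp add: kraus_Cons)
qed

context
  fixes y :: "'a::cstar_algebra"
  assumes y: "pos y" "y \<preceq> 1"
begin

lemma commute_power_one_minus: "y * (1 - y) ^ m = (1 - y) ^ m * y"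
  by (rule power_commuting_commutes[symmetric]) (simp add: algebra_simps)

lemma pos_times_power_one_minus: "pos (y * (1 - y) ^ m)"
  using y commute_power_one_minus by (intro pos_mult_commute pos_power) auto

lemma power_one_minus_le_1: "(1 - y) ^ m \<preceq> 1"
proof (induction m)
  case (Suc m)
  have "(1 - y) ^ m - (1 - y) ^ Suc m = y * (1 - y) ^ m" by (simp add: algebra_simps)
  then have "(1 - y) ^ Suc m \<preceq> (1 - y) ^ m" using pos_times_power_one_minus[of m] by simp
  then show ?case using Suc le_pos_trans by blast
qed simp

text \<open>
  Powers of \<open>1 - y\<close> are small where \<open>y\<close> is not: the right side is the sum of the
  \<open>y (1 - y)\<^sup>j\<close> over \<open>j \<le> m\<close>, and these decrease in \<open>j\<close>.
\<close>

lemma times_power_one_minus_le: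
  "real (Suc m) *\<^sub>R (y * (1 - y) ^ m) \<preceq> 1 - (1 - y) ^ Suc m"
proof (induction m)
  case (Suc m)
  have cyy: "(y * (1 - y) ^ m) * y = y * (y * (1 - y) ^ m)"
    by (simp only: mult.assoc commute_power_one_minus[symmetric])
  then have "pos ((y * (1 - y) ^ m) * y)"
    by (intro pos_mult_commute pos_times_power_one_minus y)
  also have "(y * (1 - y) ^ m) * y = y * (1 - y) ^ m - y * (1 - y) ^ Suc m"
  proof -
    have "(1 - y) ^ Suc m = (1 - y) ^ m - (1 - y) ^ m * y"
      by (simp only: power_Suc2 right_diff_distrib mult_1_right)
    then show ?thesis by (simp only: right_diff_distrib mult.assoc) simp
  qed
  finally have "pos (real (Suc m) *\<^sub>R (y * (1 - y) ^ m - y * (1 - y) ^ Suc m))"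
    by (intro pos_scaleR) auto
  from pos_add[OF this Suc] have
    "pos ((1 - (1 - y) ^ Suc m) - real (Suc m) *\<^sub>R (y * (1 - y) ^ Suc m))"
    by (simp only: scaleR_diff_right) (simp add: algebra_simps)
  moreover have "1 - (1 - y) ^ Suc (Suc m) = (1 - (1 - y) ^ Suc m) + y * (1 - y) ^ Suc m"
    by (simp only: power_Suc[of _ "Suc m"] left_diff_distrib) simp
  moreover have "real (Suc (Suc m)) *\<^sub>R (y * (1 - y) ^ Suc m)
      = real (Suc m) *\<^sub>R (y * (1 - y) ^ Suc m) + y * (1 - y) ^ Suc m"
    by (simp only: of_nat_Suc[of "Suc m"] scaleR_add_left scaleR_one add.commute)
  ultimately show ?case by (simp only:) simp
qed simp

lemma norm_times_power_one_minus: "norm (y * (1 - y) ^ m) \<le> 1 / real (Suc m)"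
proof -
  have "pos ((1 - y) ^ Suc m)" using y by (intro pos_power)
  then have "real (Suc m) *\<^sub>R (y * (1 - y) ^ m) \<preceq> of_real 1"
    using pos_add[OF times_power_one_minus_le[of m]] by fastforce
  then have "norm (real (Suc m) *\<^sub>R (y * (1 - y) ^ m)) \<le> 1"
    by (intro norm_le_if_le_of_real pos_scaleR pos_times_power_one_minus) auto
  then have "norm (y * (1 - y) ^ m) * real (Suc m) \<le> 1"
    by (simp only: norm_scaleR abs_of_nat mult.commute)
  then show ?thesis by (simp only: pos_le_divide_eq of_nat_0_less_iff zero_less_Suc)
qed

lemma one_minus_power_factor:
  obtains q where "pos q" "y * q = q * y" "1 - (1 - y) ^ m = y * q"
proof -
  define q where "q = (\<Sum>j<m. (1 - y) ^ j)"
  have "1 - (1 - y) ^ m = y * q" unfolding q_def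
  proof (induction m)
    case (Suc m)
    have "1 - (1 - y) ^ Suc m = (1 - (1 - y) ^ m) + y * (1 - y) ^ m"
      by (simp add: left_diff_distrib)
    then show ?case by (simp add: Suc distrib_left)
  qed simp
  moreover have "pos q" unfolding q_def using y by (intro pos_sum pos_power)
  moreover have "y * q = q * y"
    by (simp add: q_def sum_distrib_left sum_distrib_right commute_power_one_minus)
  ultimately show ?thesis using that by blast
qed

end

text \<open>
  Up to a small error, the two given elements are dominated by a multiple of a contraction
  \<open>y\<close> that is one of the defining sums; \<open>v\<close> is a high power of \<open>1 - y\<close>. What matters later is that
  \<open>1 - v * v\<close> is again such a sum exactly, and not only approximately.
\<close>

lemma approximate_unit:
  fixes x :: "'a::cstar_algebra"
  assumes z: "z1 \<in> ideal_gen x" "z2 \<in> ideal_gen x" and e: "0 < e"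
  obtains v cs where "pos v" "v \<preceq> 1" "1 - v \<in> ideal_gen x" "v * v + kraus (map ((*) x) cs) 1 = 1"
    "norm (z1 * v) \<le> e" "norm (z2 * v) \<le> e"
proof -
  obtain w1 w2 where w: "w1 \<in> dominated_by x" "dist w1 z1 < e/2" "w2 \<in> dominated_by x" "dist w2 z2 < e/2"
    using z half_gt_zero[OF e] unfolding ideal_gen_def closure_approachable by metis
  then obtain as bs where as: "star w1 * w1 \<preceq> kraus (map ((*) x) as) 1"
      and bs: "star w2 * w2 \<preceq> kraus (map ((*) x) bs) 1"
    by (auto simp: dominated_by_def)
  define y0 where "y0 = kraus (map ((*) x) (as @ bs)) 1"
  have y0: "y0 = kraus (map ((*) x) as) 1 + kraus (map ((*) x) bs) 1"
    by (simp add: y0_def kraus_append)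
  have pk: "pos (kraus (map ((*) x) cs) 1)" for cs by (rule kraus_pos) simp
  have py0: "pos y0" unfolding y0_def by (rule pk)
  have w1y: "star w1 * w1 \<preceq> y0" and w2y: "star w2 * w2 \<preceq> y0"
    using pos_add[OF as pk[of bs]] pos_add[OF bs pk[of as]] by (simp_all add: y0 algebra_simps)
  define R where "R = norm y0 + 1"
  have R: "R > 0" "norm y0 \<le> R" by (auto simp: R_def add_nonneg_pos)
  define cs where "cs = map (\<lambda>c. (1 / sqrt R) *\<^sub>R c) (as @ bs)"
  define y where "y = (1/R) *\<^sub>R y0"
  have "map ((*) x) cs = map (\<lambda>c. (1 / sqrt R) *\<^sub>R c) (map ((*) x) (as @ bs))" by (simp add: cs_def)
  then have ycs: "y = kraus (map ((*) x) cs) 1"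
    using R by (simp only: kraus_map_scaleR y_def y0_def) (simp add: power_divide)
  have py: "pos y" unfolding y_def using py0 R by (intro pos_scaleR) auto
  have "norm y \<le> 1" using R by (simp add: y_def)
  then have y1: "y \<preceq> 1" using le_norm[OF pos_star[OF py], of 1] by simp
  have y0y: "y0 = R *\<^sub>R y" using R by (simp add: y_def)
  define n where "n = nat \<lceil>R / (e/2)\<^sup>2\<rceil>"
  define v where "v = (1 - y) ^ n"
  have pv: "pos v" unfolding v_def using y1 by (intro pos_power)
  have v1: "v \<preceq> 1" unfolding v_def by (rule power_one_minus_le_1[OF py y1])
  have nv: "norm v \<le> 1" using norm_le_if_le_of_real[OF pv, of 1] v1 by simp
  have small: "norm (u * v) \<le> e" if u: "w \<in> dominated_by x" "star w * w \<preceq> y0" "dist w u < e/2" for u w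
  proof -
    have "star (w * v) * (w * v) \<preceq> v * y0 * v"
      using conj_mono[OF u(2), of v] by (simp add: star_mult pos_star[OF pv] mult.assoc)
    then have "norm (star (w * v) * (w * v)) \<le> norm (v * y0 * v)"
      by (intro norm_mono_pos pos_star_mult)
    also have "v * y0 * v = R *\<^sub>R (y * (1 - y) ^ (n + n))"
      by (simp add: y0y v_def power_add mult.assoc[symmetric] commute_power_one_minus[OF py y1])
    also have "norm \<dots> \<le> R * (1 / real (Suc (n + n)))"
      using norm_times_power_one_minus[OF py y1, of "n + n"] R by (simp add: divide_simps)
    also have "\<dots> \<le> (e/2)\<^sup>2"
    proof -
      have "R / (e/2)\<^sup>2 \<le> real n" unfolding n_def by linarith
      then have "R \<le> real n * (e/2)\<^sup>2" using e by (simp add: field_simps)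
      also have "\<dots> \<le> real (Suc (n + n)) * (e/2)\<^sup>2" by (intro mult_right_mono) auto
      finally show ?thesis by (simp add: field_simps)
    qed
    finally have "(norm (w * v))\<^sup>2 \<le> (e/2)\<^sup>2" by (simp add: cstar_identity)
    then have 1: "norm (w * v) \<le> e/2" by (rule power2_le_imp_le) (use e in simp)
    have "norm ((u - w) * v) \<le> norm (u - w) * 1"
      using nv by (intro order_trans[OF norm_mult_ineq] mult_left_mono) auto
    then have 2: "norm ((u - w) * v) \<le> e/2"
      using u(3) by (simp add: dist_norm norm_minus_commute)
    have "u * v = w * v + (u - w) * v" by (simp add: algebra_simps)
    then show ?thesis using norm_triangle_mono[OF 1 2] by simp
  qed
  obtain q where q: "1 - (1 - y) ^ n = y * q"
    by (rule one_minus_power_factor[OF py y1])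
  have "y \<in> ideal_gen x" unfolding ycs by (rule kraus_in_ideal_gen)
  then have J: "1 - v \<in> ideal_gen x"
    unfolding v_def q by (rule closed_idealD(6)[OF closed_ideal_ideal_gen])
  obtain r where r: "pos r" "y * r = r * y" "1 - (1 - y) ^ (n + n) = y * r"
    by (rule one_minus_power_factor[OF py y1])
  obtain s where s: "pos s" "s * s = r" "\<And>c. c * r = r * c \<Longrightarrow> c * s = s * c"
    using pos_sqrt[OF r(1)] by blast
  have "y * r = s * y * s"
    using s(3)[OF r(2)] by (simp add: s(2)[symmetric] mult.assoc[symmetric])
  also have "\<dots> = kraus (map (\<lambda>b. b * s) (map ((*) x) cs)) 1"
    by (simp only: kraus_map_mult ycs pos_star[OF s(1)])
  also have "map (\<lambda>b. b * s) (map ((*) x) cs) = map ((*) x) (map (\<lambda>c. c * s) cs)"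
    by (simp add: mult.assoc)
  finally have "1 - v * v = kraus (map ((*) x) (map (\<lambda>c. c * s) cs)) 1"
    using r(3) by (simp only: v_def power_add)
  then have "v * v + kraus (map ((*) x) (map (\<lambda>c. c * s) cs)) 1 = 1"
    by (simp only: algebra_simps)
  then show ?thesis
    using that[OF pv v1 J] small[OF w(1) w1y w(2)] small[OF w(3) w2y w(4)] by blast
qed

lemma one_minus_square_le:
  assumes "pos v" "v \<preceq> (1::'a::cstar_algebra)"
  shows "(1 - v) * (1 - v) \<preceq> 1 - v * v"
proof -
  have "pos (v * (1 - v))" using assms by (intro pos_mult_commute) (auto simp: algebra_simps)
  then have "pos (2 *\<^sub>R (v * (1 - v)))" by (intro pos_scaleR) auto
  then show ?thesis by (simp add: algebra_simps scaleR_2)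
qed

text \<open>
  A positive functional almost attains its norm on an ideal at an approximate unit: if \<open>z v\<close> is
  small, then by the Cauchy-Schwarz inequality \<open>\<bar>\<phi> z\<bar>\<^sup>2\<close> is almost
  bounded by \<open>\<phi> (z * star z) * \<phi> ((1 - v)\<^sup>2)\<close>, where \<open>z * star z\<close> lies in the ideal too and
  \<open>(1 - v)\<^sup>2 \<preceq> 1 - v\<^sup>2\<close>.
\<close>

lemma functional_approximate_unit_le:
  fixes \<phi> :: "'a::cstar_algebra \<Rightarrow> complex"
  assumes \<phi>: "positive_functional \<phi>" and J: "closed_ideal J"
    and z: "z \<in> J" "norm z \<le> 1" "restr_norm \<phi> J - e \<le> cmod (\<phi> z)"
    and v: "pos v" "v \<preceq> 1" "Re (\<phi> 1) * norm (z * v) \<le> e" and e: "0 < e"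
  shows "Re (\<phi> (v * v)) \<le> Re (\<phi> 1) - restr_norm \<phi> J + 4 * e"
proof -
  note d = pf_dual[OF \<phi>]
  define M where "M = restr_norm \<phi> J"
  define W where "W = Re (\<phi> (1 - v * v))"
  have M0: "0 \<le> M" unfolding M_def by (rule restr_norm_nonneg[OF d closed_idealD(1)[OF J]])
  have "pos ((1 - v) * (1 - v))" using v by (intro pos_square) (simp add: star_diff pos_star)
  then have "0 \<le> Re (\<phi> ((1 - v) * (1 - v)))" by (rule pf_nonneg[OF \<phi>])
  then have W: "Re (\<phi> ((1 - v) * (1 - v))) \<le> W" "0 \<le> W"
    using pf_mono[OF \<phi> one_minus_square_le[OF v(1,2)]] by (auto simp: W_def)
  have zz: "cmod (\<phi> (z * star z)) \<le> M"
  proof -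
    have "cmod (\<phi> (z * star z)) \<le> M * norm (z * star z)"
      unfolding M_def using closed_idealD(6)[OF J z(1)] by (intro restr_norm_bound d)
    also have "norm (z * star z) = (norm z)\<^sup>2"
      using cstar_identity[of "star z"] by (simp add: star_star)
    also have "M * (norm z)\<^sup>2 \<le> M * 1" using M0 z(2) by (intro mult_left_mono power_le_one) auto
    finally show ?thesis by simp
  qed
  have "(cmod (\<phi> (z * (1 - v))))\<^sup>2 \<le> Re (\<phi> ((1 - v) * (1 - v))) * Re (\<phi> (z * star z))"
    using cauchy_schwarz[OF \<phi>, of "star z" "1 - v"] v by (simp add: star_star star_diff pos_star)
  also have "\<dots> \<le> W * M"
    using W zz complex_Re_le_cmod[of "\<phi> (z * star z)"] pf_nonneg[OF \<phi> pos_star_mult[of "star z"]]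
    by (intro mult_mono) (auto simp: star_star)
  finally have cs: "(cmod (\<phi> (z * (1 - v))))\<^sup>2 \<le> W * M" .
  have "\<phi> z = \<phi> (z * v) + \<phi> (z * (1 - v))"
    by (simp add: dual_add[OF d, symmetric] algebra_simps)
  then have "cmod (\<phi> z) \<le> cmod (\<phi> (z * v)) + cmod (\<phi> (z * (1 - v)))"
    using norm_triangle_ineq by metis
  then have "M - 2 * e \<le> cmod (\<phi> (z * (1 - v)))"
    using pf_bound[OF \<phi>, of "z * v"] v(3) z(3) by (simp add: M_def)
  have "M - 4 * e \<le> W"
  proof (cases "M - 2 * e \<le> 0 \<or> M = 0")
    case True
    then show ?thesis using W(2) e by auto
  next
    case False
    then have "(M - 2 * e)\<^sup>2 \<le> (cmod (\<phi> (z * (1 - v))))\<^sup>2"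
      using \<open>M - 2 * e \<le> _\<close> by (intro power_mono) auto
    then have "(M - 2 * e)\<^sup>2 \<le> W * M" using cs by linarith
    moreover have "M * (M - 4 * e) \<le> (M - 2 * e)\<^sup>2" by (simp add: power2_eq_square algebra_simps)
    ultimately have "M * (M - 4 * e) \<le> M * W" by (simp add: mult.commute)
    then show ?thesis using False M0 by (simp add: mult_le_cancel_left)
  qed
  then show ?thesis by (simp add: W_def M_def dual_diff[OF d])
qed

text \<open>
  The unit \<open>v\<close> is chosen for two elements at once: one at which \<open>\<phi>\<close> almost attains its norm, and
  \<open>1 - star s\<close>, so that \<open>v * s\<close> is close to \<open>v\<close>. Multiplying by \<open>s\<close> thus costs almost nothing, which
  is why the estimate involves the norm of \<open>\<phi>\<close> itself and not of a compression of it.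
\<close>

lemma approximate_unit_functional:
  fixes \<phi> :: "'a::cstar_algebra \<Rightarrow> complex"
  assumes \<phi>: "positive_functional \<phi>" and s: "1 - star s \<in> ideal_gen x" and eps: "0 < \<epsilon>"
  obtains v cs where "pos v" "1 - v \<in> ideal_gen x" "v * v + kraus (map ((*) x) cs) 1 = 1"
    "Re (\<phi> (star (v * s) * (v * s))) \<le> Re (\<phi> 1) - restr_norm \<phi> (ideal_gen x) + \<epsilon>"
proof -
  note d = pf_dual[OF \<phi>] and J = closed_ideal_ideal_gen[of x]
  define p where "p = Re (\<phi> 1)"
  have p: "0 \<le> p" unfolding p_def by (rule pf_one_nonneg[OF \<phi>])
  \<comment> \<open>The error will be \<open>4 e\<close> from the choice of \<open>v\<close> and \<open>3 p e\<close> from replacing \<open>v * s\<close> by \<open>v\<close>.\<close>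
  define e where "e = min 1 (\<epsilon> / (4 + 3 * p))"
  define f where "f = e / (1 + p)"
  have e: "0 < e" "e \<le> 1" "e * (4 + 3 * p) \<le> \<epsilon>"
  proof -
    show "0 < e" "e \<le> 1" using eps p by (auto simp: e_def)
    have "e * (4 + 3 * p) \<le> \<epsilon> / (4 + 3 * p) * (4 + 3 * p)"
      using p by (intro mult_right_mono) (auto simp: e_def)
    then show "e * (4 + 3 * p) \<le> \<epsilon>" using p by simp
  qed
  have f: "0 < f" "f \<le> e" "p * f \<le> e"
    using e p by (auto simp: f_def field_simps)
  obtain z where z: "z \<in> ideal_gen x" "norm z \<le> 1" "restr_norm \<phi> (ideal_gen x) - e \<le> cmod (\<phi> z)"
    using restr_norm_approx[OF d closed_idealD(1)[OF J] closed_idealD(4)[OF J] e(1)] by blast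
  obtain v cs where v: "pos v" "v \<preceq> 1" "1 - v \<in> ideal_gen x" "v * v + kraus (map ((*) x) cs) 1 = 1"
      "norm (z * v) \<le> f" "norm ((1 - star s) * v) \<le> f"
    by (rule approximate_unit[OF z(1) s f(1)])
  have "Re (\<phi> 1) * norm (z * v) \<le> e"
    using v(5) f p mult_left_mono[OF v(5) p] by (simp add: p_def)
  then have vv: "Re (\<phi> (v * v)) \<le> p - restr_norm \<phi> (ideal_gen x) + 4 * e"
    unfolding p_def by (rule functional_approximate_unit_le[OF \<phi> J z v(1,2) _ e(1)])
  define j where "j = (1 - star s) * v"
  have nj: "norm j \<le> f" using v(6) by (simp add: j_def)
  have sj: "star j = v * (1 - s)" by (simp add: j_def star_mult star_diff star_star pos_star[OF v(1)])
  have nv: "norm v \<le> 1" using norm_le_if_le_of_real[OF v(1), of 1] v(2) by simp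
  have "v * s = v - star j" unfolding sj by (simp add: algebra_simps)
  then have "star (v * s) * (v * s) = (v - j) * (v - star j)"
    by (simp only: star_diff star_star pos_star[OF v(1)])
  then have eq: "star (v * s) * (v * s) - v * v = - (j * v) - v * star j + j * star j"
    by (simp add: algebra_simps)
  have n1: "norm (j * v) \<le> f" "norm (v * star j) \<le> f" "norm (j * star j) \<le> f"
  proof -
    show "norm (j * v) \<le> f"
      using mult_mono[OF nj nv] f by (intro order_trans[OF norm_mult_ineq]) auto
    show "norm (v * star j) \<le> f"
      using mult_mono[OF nv nj] f by (intro order_trans[OF norm_mult_ineq]) auto
    have "norm j \<le> 1" using nj f e by simp
    then show "norm (j * star j) \<le> f"
      using mult_mono[OF nj \<open>norm j \<le> 1\<close>] f by (intro order_trans[OF norm_mult_ineq]) auto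
  qed
  have "norm (- (j * v) - v * star j + j * star j) \<le> 3 * f"
    using norm_triangle_ineq[of "- (j * v) - v * star j" "j * star j"]
      norm_triangle_ineq4[of "- (j * v)" "v * star j"] n1 by simp
  then have "p * norm (star (v * s) * (v * s) - v * v) \<le> p * (3 * e)"
    unfolding eq using f p by (intro mult_left_mono) auto
  moreover have "Re (\<phi> (star (v * s) * (v * s))) - Re (\<phi> (v * v))
      \<le> p * norm (star (v * s) * (v * s) - v * v)"
    using pf_bound[OF \<phi>, of "star (v * s) * (v * s) - v * v"]
      complex_Re_le_cmod[of "\<phi> (star (v * s) * (v * s) - v * v)"]
    by (simp add: dual_diff[OF d] p_def)
  ultimately have "Re (\<phi> (star (v * s) * (v * s)))
      \<le> p - restr_norm \<phi> (ideal_gen x) + e * (4 + 3 * p)"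
    using vv by (simp add: algebra_simps)
  then show ?thesis using that[OF v(1,3,4)] e(3) by (simp add: p_def)
qed


section \<open>Maximizing a positive functional over \<open>E(A)\<close>\<close>

text \<open>
  Descending induction along a decreasing chain of ideals \<open>J\<^sub>n\<close>, generated by \<open>x n\<close>, on which
  \<open>h\<close> is at least \<open>(n + 1) d\<close>. The part \<open>star s * s\<close> of the unit not yet used up is
  compressed by the approximate unit of the next ideal. The term \<open>n d \<phi> (kraus as 1)\<close> keeps
  track of the mass already placed above level \<open>n d\<close>; this is summation by parts.
\<close>

lemma layered_kraus:
  fixes \<phi> :: "'a::cstar_algebra \<Rightarrow> complex"
  assumes \<phi>: "positive_functional \<phi>" and eps: "0 < \<epsilon>" and d: "0 \<le> d" and n: "n \<le> N"
    and chain: "\<And>k. ideal_gen (x (Suc k)) \<subseteq> ideal_gen (x k)"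
    and level: "\<And>k. pos (star (x k) * (h - of_real (real (Suc k) * d)) * x k)"
  shows "\<exists>as s. kraus as 1 + star s * s = 1 \<and> 1 - star s \<in> ideal_gen (x n) \<and>
    d * (\<Sum>k=n..<N. restr_norm \<phi> (ideal_gen (x k)) - \<epsilon>) + real n * d * Re (\<phi> (kraus as 1))
      \<le> Re (\<phi> (kraus as h))"
  using n
proof (induction n rule: inc_induct)
  case base
  show ?case
    by (intro exI[of _ "[]"] exI[of _ 1])
      (simp add: dual_zero[OF pf_dual[OF \<phi>]] closed_idealD(1)[OF closed_ideal_ideal_gen])
next
  case (step n)
  note dl = pf_dual[OF \<phi>]
  from step.IH obtain as s where as: "kraus as 1 + star s * s = 1" "1 - star s \<in> ideal_gen (x (Suc n))"
    "d * (\<Sum>k=Suc n..<N. restr_norm \<phi> (ideal_gen (x k)) - \<epsilon>) + real (Suc n) * d * Re (\<phi> (kraus as 1))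
      \<le> Re (\<phi> (kraus as h))" by blast
  have sJ: "1 - star s \<in> ideal_gen (x n)" using as(2) chain by blast
  obtain v cs where v: "pos v" "1 - v \<in> ideal_gen (x n)" "v * v + kraus (map ((*) (x n)) cs) 1 = 1"
    "Re (\<phi> (star (v * s) * (v * s))) \<le> Re (\<phi> 1) - restr_norm \<phi> (ideal_gen (x n)) + \<epsilon>"
    by (rule approximate_unit_functional[OF \<phi> sJ eps])
  define new where "new = map (\<lambda>b. b * s) (map ((*) (x n)) cs)"
  have new: "kraus new y = star s * kraus (map ((*) (x n)) cs) y * s" for y
    unfolding new_def by (rule kraus_map_mult)
  have k1: "kraus (map ((*) (x n)) cs) 1 = 1 - v * v" using v(3) by (simp add: eq_diff_eq add.commute)
  have "kraus as 1 = 1 - star s * s" using as(1) by (simp add: eq_diff_eq)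
  then have unit: "kraus (as @ new) 1 = 1 - star (v * s) * (v * s)"
    unfolding kraus_append new k1 by (simp add: star_mult pos_star[OF v(1)] algebra_simps)
  have vJ: "1 - star (v * s) \<in> ideal_gen (x n)"
  proof -
    have "1 - star (v * s) = (1 - star s) + star s * (1 - v)"
      by (simp add: star_mult pos_star[OF v(1)] algebra_simps)
    then show ?thesis using sJ v(2) closed_idealD[OF closed_ideal_ideal_gen] by metis
  qed
  have lev: "pos (kraus (map ((*) (x n)) cs) (h - of_real (real (Suc n) * d)))"
  proof (induction cs)
    case (Cons c cs)
    have "pos (star c * (star (x n) * (h - of_real (real (Suc n) * d)) * x n) * c)"
      by (rule pos_conj[OF level])
    then show ?case using Cons by (auto simp: kraus_Cons star_mult mult.assoc intro: pos_add)
  qed simp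
  have "pos (kraus new (h - of_real (real (Suc n) * d)))"
    unfolding new by (rule pos_conj[OF lev])
  then have "0 \<le> Re (\<phi> (kraus new (h - (real (Suc n) * d) *\<^sub>R 1)))"
    using pf_nonneg[OF \<phi>] by (simp add: of_real_def)
  then have newh: "real (Suc n) * d * Re (\<phi> (kraus new 1)) \<le> Re (\<phi> (kraus new h))"
    by (simp only: kraus_diff kraus_scaleR dual_diff[OF dl] dual_scaleR[OF dl]) simp
  have "Re (\<phi> (kraus (as @ new) 1)) = Re (\<phi> 1) - Re (\<phi> (star (v * s) * (v * s)))"
    unfolding unit by (simp add: dual_diff[OF dl])
  then have "restr_norm \<phi> (ideal_gen (x n)) - \<epsilon> \<le> Re (\<phi> (kraus (as @ new) 1))"
    using v(4) by simp
  then have top: "d * (restr_norm \<phi> (ideal_gen (x n)) - \<epsilon>) \<le> d * Re (\<phi> (kraus (as @ new) 1))"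
    using d by (rule mult_left_mono)
  have "{n..<N} = insert n {Suc n..<N}" using step.hyps by auto
  then have "d * (\<Sum>k=n..<N. restr_norm \<phi> (ideal_gen (x k)) - \<epsilon>)
      + real n * d * Re (\<phi> (kraus (as @ new) 1)) \<le> Re (\<phi> (kraus (as @ new) h))"
    using as(3) newh top
    by (simp add: kraus_append dual_add[OF dl] algebra_simps)
  moreover have "kraus (as @ new) 1 + star (v * s) * (v * s) = 1" using unit by simp
  ultimately show ?case using vJ by blast
qed

text \<open>
  Layer-cake decomposition of \<open>h\<close>. The chain consists of the ideals generated by \<open>(h - (k+1)/N)\<^sub>+\<close>. On the other side, \<open>h\<close> is
  the sum of \<open>N\<close> slices of norm at most \<open>1/N\<close>, all but the lowest of which lie in these ideals.
\<close>

lemma kraus_dominates_unit_interval: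
  fixes \<phi> \<rho> :: "'a::cstar_algebra \<Rightarrow> complex"
  assumes \<phi>: "positive_functional \<phi>" and \<rho>: "positive_functional \<rho>"
    and le: "\<And>J. closed_ideal J \<Longrightarrow> restr_norm \<rho> J \<le> restr_norm \<phi> J"
    and h: "pos h" "h \<preceq> 1" and eps: "0 < \<epsilon>"
  shows "\<exists>as. kraus as 1 = 1 \<and> Re (\<rho> h) - \<epsilon> \<le> Re (\<phi> (kraus as h))"
proof -
  note dl = pf_dual[OF \<phi>] and dr = pf_dual[OF \<rho>]
  define r where "r = Re (\<rho> 1)"
  have r: "0 \<le> r" unfolding r_def by (rule pf_one_nonneg[OF \<rho>])
  obtain m where m: "r / (\<epsilon>/2) \<le> real m" using real_arch_simple by blast
  define N where "N = Suc m"
  define d where "d = 1 / real N"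
  have d: "0 < d" by (simp add: d_def N_def)
  have "r \<le> real m * (\<epsilon>/2)" using m eps by (simp add: field_simps)
  also have "\<dots> \<le> real N * (\<epsilon>/2)" using eps by (intro mult_right_mono) (auto simp: N_def)
  finally have dr2: "d * r \<le> \<epsilon>/2" by (simp add: d_def field_simps N_def)
  define g where "g k s = max (s - real k * d) 0" for k and s :: real
  have cont: "continuous_on {0..1} (g k)" for k
    unfolding g_def by (intro continuous_intros)
  define x where "x k = fcalc h (g (Suc k))" for k
  have px: "pos (x k)" for k
    unfolding x_def by (rule fcalc_pos[OF h cont]) (simp add: g_def)
  have chain: "ideal_gen (x (Suc k)) \<subseteq> ideal_gen (x k)" for k
  proof -
    define q where "q s = g (Suc (Suc k)) s / max d (g (Suc k) s)" for s
    have contq: "continuous_on {0..1} q"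
      unfolding q_def using d by (intro continuous_intros cont) (auto simp: max_def)
    have "g (Suc (Suc k)) s = g (Suc k) s * q s" for s
      using d by (auto simp: q_def g_def max_def field_simps)
    then have "x (Suc k) = fcalc h (\<lambda>s. g (Suc k) s * q s)" unfolding x_def by presburger
    also have "\<dots> = x k * fcalc h q" unfolding x_def by (rule fcalc_mult[OF h cont contq])
    finally show ?thesis using ideal_gen_mult_subset by metis
  qed
  have level: "pos (star (x k) * (h - of_real (real (Suc k) * d)) * x k)" for k
  proof -
    let ?l = "\<lambda>s. s - real (Suc k) * d"
    have cl: "continuous_on {0..1} ?l" by (intro continuous_intros)
    have l: "fcalc h ?l = h - of_real (real (Suc k) * d)"
      by (subst fcalc_diff[OF h]) (auto intro: continuous_intros simp only: fcalc_id[OF h] fcalc_const[OF h])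
    have cgl: "continuous_on {0..1} (\<lambda>s. g (Suc k) s * ?l s)" by (intro continuous_intros cont)
    have "fcalc h (\<lambda>s. (g (Suc k) s * ?l s) * g (Suc k) s)
        = (x k * (h - of_real (real (Suc k) * d))) * x k"
      unfolding fcalc_mult[OF h cgl cont] fcalc_mult[OF h cont cl] l x_def ..
    moreover have "pos (fcalc h (\<lambda>s. (g (Suc k) s * ?l s) * g (Suc k) s))"
      by (rule fcalc_pos[OF h], intro continuous_intros cont cl) (simp add: g_def max_def)
    ultimately show ?thesis by (simp add: pos_star[OF px])
  qed
  obtain as s where as: "kraus as 1 + star s * s = 1"
    "d * (\<Sum>k=0..<N. restr_norm \<phi> (ideal_gen (x k)) - \<epsilon>/2) \<le> Re (\<phi> (kraus as h))"
    using layered_kraus[OF \<phi>, of "\<epsilon>/2" d 0 N x h, OF _ _ _ chain level] eps d by auto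

  define slice where "slice k = fcalc h (g k) - fcalc h (g (Suc k))" for k
  have nslice: "norm (slice k) \<le> d" for k
    unfolding slice_def by (rule norm_fcalc_diff_le[OF h cont cont])
      (use d in \<open>auto simp: g_def max_def algebra_simps\<close>)
  have "fcalc h (g 0) = fcalc h (\<lambda>s. s)" by (rule fcalc_cong[OF h]) (simp add: g_def)
  moreover have "fcalc h (g N) = fcalc h (\<lambda>s. 0)"
    by (rule fcalc_cong[OF h]) (simp add: g_def d_def N_def)
  ultimately have h_sum: "h = (\<Sum>k<N. slice k)"
    using sum_lessThan_telescope'[of "\<lambda>k. fcalc h (g k)" N]
    by (simp add: slice_def fcalc_id[OF h] fcalc_const[OF h])
  have M0: "0 \<le> restr_norm \<phi> (ideal_gen (x k))" for k
    by (rule restr_norm_nonneg[OF dl closed_idealD(1)[OF closed_ideal_ideal_gen]])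
  have slice0: "Re (\<rho> (slice 0)) \<le> d * r"
  proof -
    have "Re (\<rho> (slice 0)) \<le> r * norm (slice 0)"
      unfolding r_def using complex_Re_le_cmod pf_bound[OF \<rho>] by (rule order_trans)
    also have "\<dots> \<le> r * d" by (rule mult_left_mono[OF nslice r])
    finally show ?thesis by (simp add: mult.commute)
  qed
  have sliceS: "Re (\<rho> (slice (Suc k))) \<le> d * restr_norm \<phi> (ideal_gen (x k))" for k
  proof -
    have "slice (Suc k) \<in> ideal_gen (x k)"
      unfolding slice_def x_def[symmetric] using ideal_gen_self chain
      by (intro closed_ideal_diff[OF closed_ideal_ideal_gen]) blast+
    then have "Re (\<rho> (slice (Suc k))) \<le> restr_norm \<rho> (ideal_gen (x k)) * norm (slice (Suc k))"
      using order_trans[OF complex_Re_le_cmod restr_norm_bound[OF dr]] by blast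
    also have "\<dots> \<le> restr_norm \<phi> (ideal_gen (x k)) * d"
      by (rule mult_mono[OF le[OF closed_ideal_ideal_gen] nslice M0 norm_ge_zero])
    finally show ?thesis by (simp add: mult.commute)
  qed
  have "Re (\<rho> h) = (\<Sum>k<N. Re (\<rho> (slice k)))"
    by (subst h_sum) (simp add: dual_sum[OF dr])
  also have "\<dots> = Re (\<rho> (slice 0)) + (\<Sum>k<m. Re (\<rho> (slice (Suc k))))"
    unfolding N_def by (rule sum.lessThan_Suc_shift)
  also have "\<dots> \<le> d * r + (\<Sum>k<m. d * restr_norm \<phi> (ideal_gen (x k)))"
    by (intro add_mono slice0 sum_mono sliceS)
  also have "\<dots> \<le> d * r + (\<Sum>k<N. d * restr_norm \<phi> (ideal_gen (x k)))"
    unfolding N_def using M0 d by simp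
  also have "(\<Sum>k<N. d * restr_norm \<phi> (ideal_gen (x k)))
      = d * (\<Sum>k=0..<N. restr_norm \<phi> (ideal_gen (x k)) - \<epsilon>/2) + \<epsilon>/2"
  proof -
    have "d * (real N * (\<epsilon>/2)) = \<epsilon>/2" by (simp add: d_def N_def)
    then show ?thesis
      by (simp add: sum_subtractf atLeast0LessThan right_diff_distrib sum_distrib_left[symmetric])
  qed
  also have "d * r + \<dots> \<le> Re (\<phi> (kraus as h)) + \<epsilon>" using as(2) dr2 by linarith
  finally have "Re (\<rho> h) - \<epsilon> \<le> Re (\<phi> (kraus as h))" by simp
  moreover have "0 \<le> Re (\<phi> (star s * h * s))" by (rule pf_nonneg[OF \<phi> pos_conj[OF h(1)]])
  ultimately have "Re (\<rho> h) - \<epsilon> \<le> Re (\<phi> (kraus (as @ [s]) h))"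
    by (simp add: kraus_append kraus_Cons dual_add[OF dl])
  moreover have "kraus (as @ [s]) 1 = 1" using as(1) by (simp add: kraus_append kraus_Cons)
  ultimately show ?thesis by blast
qed

lemma kraus_dominates:
  fixes \<phi> \<rho> :: "'a::cstar_algebra \<Rightarrow> complex"
  assumes \<phi>: "positive_functional \<phi>" and \<rho>: "positive_functional \<rho>" and one: "\<rho> 1 = \<phi> 1"
    and le: "\<And>J. closed_ideal J \<Longrightarrow> restr_norm \<rho> J \<le> restr_norm \<phi> J"
    and sa: "star h = h" and eps: "0 < \<epsilon>"
  shows "\<exists>as. kraus as 1 = 1 \<and> Re (\<rho> h) - \<epsilon> \<le> Re (\<phi> (kraus as h))"
proof -
  note dl = pf_dual[OF \<phi>] and dr = pf_dual[OF \<rho>]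
  define r where "r = norm h + 1"
  have r: "r > 0" "norm h \<le> r" by (auto simp: r_def add_nonneg_pos)
  define k where "k = (1/(2*r)) *\<^sub>R (h + of_real r)"
  have k: "pos k" unfolding k_def using r minus_norm_le[OF sa] by (intro pos_scaleR) auto
  have "h + of_real r = (2*r) *\<^sub>R k" using r by (simp add: k_def)
  then have h: "h = (2*r) *\<^sub>R k - r *\<^sub>R 1" by (simp add: of_real_def eq_diff_eq)
  have "pos ((1/(2*r)) *\<^sub>R (of_real r - h))" using r le_norm[OF sa] by (intro pos_scaleR) auto
  moreover have "(1/(2*r)) *\<^sub>R (of_real r - h) = 1 - k"
    using r unfolding h of_real_def by (simp add: algebra_simps) (simp flip: scaleR_add_left)
  ultimately have k1: "k \<preceq> 1" by simp
  have "0 < \<epsilon> / (2*r)" using eps r by simp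
  from kraus_dominates_unit_interval[OF \<phi> \<rho> le k k1 this] obtain as
    where as: "kraus as 1 = 1" "Re (\<rho> k) - \<epsilon> / (2*r) \<le> Re (\<phi> (kraus as k))" by blast
  have "(2*r) * (Re (\<rho> k) - \<epsilon> / (2*r)) \<le> (2*r) * Re (\<phi> (kraus as k))"
    using as(2) r by (intro mult_left_mono) auto
  then have "(2*r) * Re (\<rho> k) - \<epsilon> \<le> (2*r) * Re (\<phi> (kraus as k))"
    using r by (simp add: right_diff_distrib)
  then have "Re (\<rho> h) - \<epsilon> \<le> Re (\<phi> (kraus as h))"
    unfolding h kraus_diff kraus_scaleR as(1) dual_diff[OF dl] dual_diff[OF dr] dual_scaleR[OF dl]
      dual_scaleR[OF dr] one by simp
  then show ?thesis using as(1) by blast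
qed


section \<open>From functional inequalities to approximation\<close>

text \<open>
  Separation of a point from a convex set in finitely many real coordinates. If \<open>S\<close> comes close
  to the half space beyond \<open>r\<close> in every direction \<open>c\<close>, then it comes close to \<open>r\<close>: otherwise
  moving from an almost nearest point of \<open>S\<close> towards a point that is good in the direction of the
  difference would reduce the distance.
\<close>

lemma convex_approximation:
  fixes S :: "('i \<Rightarrow> real) set" and r :: "'i \<Rightarrow> real"
  assumes fin: "finite F" and ne: "S \<noteq> {}"
    and conv: "\<And>u v t. u \<in> S \<Longrightarrow> v \<in> S \<Longrightarrow> 0 \<le> t \<Longrightarrow> t \<le> 1 \<Longrightarrow> (\<lambda>i. (1 - t) * u i + t * v i) \<in> S"
    and bdd: "\<And>u i. u \<in> S \<Longrightarrow> i \<in> F \<Longrightarrow> \<bar>u i\<bar> \<le> B i"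
    and dir: "\<And>c \<eta>. 0 < \<eta> \<Longrightarrow> \<exists>u\<in>S. (\<Sum>i\<in>F. c i * r i) - \<eta> \<le> (\<Sum>i\<in>F. c i * u i)"
    and eps: "0 < \<epsilon>"
  shows "\<exists>u\<in>S. \<forall>i\<in>F. \<bar>r i - u i\<bar> < \<epsilon>"
proof -
  define D where "D u = (\<Sum>i\<in>F. (r i - u i)\<^sup>2)" for u
  have D0: "0 \<le> D u" for u unfolding D_def by (intro sum_nonneg) auto
  define m where "m = (INF u\<in>S. D u)"
  have bb: "bdd_below (D ` S)" using D0 by (intro bdd_belowI[of _ 0]) auto
  have m_le: "m \<le> D u" if "u \<in> S" for u unfolding m_def by (rule cINF_lower[OF bb that])
  define C where "C = (\<Sum>i\<in>F. (\<bar>r i\<bar> + B i)\<^sup>2) + 1"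
  have C: "D u \<le> C" if "u \<in> S" for u
  proof -
    have "D u \<le> (\<Sum>i\<in>F. (\<bar>r i\<bar> + B i)\<^sup>2)"
      unfolding D_def
    proof (rule sum_mono)
      fix i assume "i \<in> F"
      then have "\<bar>r i - u i\<bar> \<le> \<bar>r i\<bar> + B i" using bdd[OF that, of i] by linarith
      then have "\<bar>r i - u i\<bar>\<^sup>2 \<le> (\<bar>r i\<bar> + B i)\<^sup>2" by (intro power_mono) auto
      then show "(r i - u i)\<^sup>2 \<le> (\<bar>r i\<bar> + B i)\<^sup>2" by simp
    qed
    then show ?thesis by (simp add: C_def)
  qed
  have C1: "1 \<le> C" unfolding C_def by (simp add: sum_nonneg)
  have m0: "m \<le> 0"
  proof (rule ccontr)
    assume "\<not> m \<le> 0"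
    then have mpos: "0 < m" by simp
    \<comment> \<open>A step of length \<open>t\<close> gains about \<open>2 t m\<close> and costs at most \<open>t\<^sup>2 C\<close>.\<close>
    define t where "t = min 1 (m / (4 * C))"
    have t: "0 < t" "t \<le> 1" "t * C \<le> m / 4"
      using mpos C1 by (auto simp: t_def min_def field_simps)
    have "(INF u\<in>S. D u) < m + t * m / 4" using mpos t by (simp add: m_def)
    then obtain u where u: "u \<in> S" "D u < m + t * m / 4"
      using cINF_less_iff[OF ne bb] by blast
    have "0 < m / 4" using mpos by simp
    from dir[OF this, of "\<lambda>i. r i - u i"] obtain v where v: "v \<in> S"
      "(\<Sum>i\<in>F. (r i - u i) * r i) - m / 4 \<le> (\<Sum>i\<in>F. (r i - u i) * v i)" by blast
    define P where "P = (\<Sum>i\<in>F. (r i - u i) * (r i - v i))"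
    have P: "P \<le> m / 4"
      using v(2) by (simp add: P_def right_diff_distrib sum_subtractf)
    define w where "w i = (1 - t) * u i + t * v i" for i
    have "w \<in> S" unfolding w_def using conv[OF u(1) v(1)] t by simp
    then have "m \<le> D w" by (rule m_le)
    also have "D w = (1 - t)\<^sup>2 * D u + 2 * t * (1 - t) * P + t\<^sup>2 * D v"
    proof -
      have "(r i - w i)\<^sup>2 = (1 - t)\<^sup>2 * (r i - u i)\<^sup>2 + 2 * t * (1 - t) * ((r i - u i) * (r i - v i))
          + t\<^sup>2 * (r i - v i)\<^sup>2" for i
        unfolding w_def by (simp add: power2_eq_square algebra_simps)
      then show ?thesis unfolding D_def P_def by (simp add: sum.distrib sum_distrib_left)
    qed
    also have "\<dots> \<le> (1 - t) * D u + 2 * t * (m / 4) + t * (t * C)"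
    proof (intro add_mono)
      show "(1 - t)\<^sup>2 * D u \<le> (1 - t) * D u"
        using t D0 by (intro mult_right_mono) (auto simp: power2_eq_square mult_left_le_one_le)
      have "2 * t * (1 - t) * P \<le> 2 * t * (1 - t) * (m / 4)" using P t by (intro mult_left_mono) auto
      also have "\<dots> \<le> 2 * t * 1 * (m / 4)" using t mpos by (intro mult_right_mono mult_left_mono) auto
      finally show "2 * t * (1 - t) * P \<le> 2 * t * (m / 4)" by simp
      show "t\<^sup>2 * D v \<le> t * (t * C)"
        using C[OF v(1)] t by (simp add: power2_eq_square mult.assoc mult_left_mono)
    qed
    also have "\<dots> \<le> (1 - t) * D u + 2 * t * (m / 4) + t * (m / 4)"
      using t by (intro add_left_mono mult_left_mono) auto
    also have "\<dots> < (1 - t) * m + t * m / 4 + 2 * t * (m / 4) + t * (m / 4)"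
    proof -
      have "(1 - t) * D u \<le> (1 - t) * (m + t * m / 4)" using u(2) t by (intro mult_left_mono) auto
      also have "\<dots> < (1 - t) * m + t * m / 4"
        using t mpos by (simp add: algebra_simps)
      finally show ?thesis by (intro add_strict_right_mono)
    qed
    also have "\<dots> = m" by (simp add: field_simps)
    finally show False by simp
  qed
  have "(INF u\<in>S. D u) < \<epsilon>\<^sup>2" using m0 eps unfolding m_def[symmetric]
    by (meson le_less_trans zero_less_power)
  then obtain u where u: "u \<in> S" "D u < \<epsilon>\<^sup>2" using cINF_less_iff[OF ne bb] by blast
  have "\<bar>r i - u i\<bar> < \<epsilon>" if "i \<in> F" for i
  proof -
    have "(r i - u i)\<^sup>2 \<le> D u" unfolding D_def using fin that by (intro member_le_sum) auto
    then have "\<bar>r i - u i\<bar>\<^sup>2 < \<epsilon>\<^sup>2" using u(2) by simp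
    then show ?thesis using eps by (intro power2_less_imp_less[of _ \<epsilon>]) auto
  qed
  then show ?thesis using u(1) by blast
qed

text \<open>
  The set of functionals \<open>\<phi> \<circ> \<psi>\<close> is convex, so by the previous two results it comes close to
  \<open>\<rho>\<close> at finitely many selfadjoint elements, hence at finitely many elements.
\<close>

lemma positive_kraus_approximation:
  fixes \<phi> \<rho> :: "'a::cstar_algebra \<Rightarrow> complex"
  assumes \<phi>: "positive_functional \<phi>" and \<rho>: "positive_functional \<rho>" and one: "\<rho> 1 = \<phi> 1"
    and le: "\<And>J. closed_ideal J \<Longrightarrow> restr_norm \<rho> J \<le> restr_norm \<phi> J"
    and F: "finite F" and eps: "0 < \<epsilon>"
  shows "\<exists>as. kraus as 1 = 1 \<and> (\<forall>x\<in>F. cmod (\<rho> x - \<phi> (kraus as x)) < \<epsilon>)"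
proof -
  note dl = pf_dual[OF \<phi>] and dr = pf_dual[OF \<rho>]
  define G where "G = re_part ` F \<union> im_part ` F"
  have G: "finite G" "\<And>x. x \<in> G \<Longrightarrow> star x = x" using F by (auto simp: G_def)
  define S where "S = {(\<lambda>x. Re (\<phi> (kraus as x))) | as. kraus as (1::'a) = 1}"
  have "\<exists>u\<in>S. \<forall>x\<in>G. \<bar>Re (\<rho> x) - u x\<bar> < \<epsilon>/2"
  proof (rule convex_approximation[OF G(1)])
    have "kraus [1] (1::'a) = 1" by (simp add: kraus_Cons)
    then show "S \<noteq> {}" unfolding S_def by blast
    show "\<bar>u x\<bar> \<le> Re (\<phi> 1) * norm x" if "u \<in> S" for u x
    proof -
      obtain as where as: "kraus as (1::'a) = 1" "u = (\<lambda>x. Re (\<phi> (kraus as x)))"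
        using \<open>u \<in> S\<close> unfolding S_def by blast
      have "\<bar>u x\<bar> \<le> Re (\<phi> 1) * norm (kraus as x)"
        unfolding as(2) using abs_Re_le_cmod pf_bound[OF \<phi>] by (rule order_trans)
      also have "\<dots> \<le> Re (\<phi> 1) * norm x"
        by (intro mult_left_mono norm_kraus_le as pf_one_nonneg[OF \<phi>])
      finally show ?thesis .
    qed
    show "(\<lambda>x. (1 - t) * u x + t * v x) \<in> S"
      if uv: "u \<in> S" "v \<in> S" and t: "0 \<le> t" "t \<le> 1" for u v t
    proof -
      obtain as bs where as: "kraus as (1::'a) = 1" "u = (\<lambda>x. Re (\<phi> (kraus as x)))"
        and bs: "kraus bs (1::'a) = 1" "v = (\<lambda>x. Re (\<phi> (kraus bs x)))"
        using uv unfolding S_def by blast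
      define cs where "cs = map (\<lambda>a. sqrt (1 - t) *\<^sub>R a) as @ map (\<lambda>a. sqrt t *\<^sub>R a) bs"
      have cs: "kraus cs x = (1 - t) *\<^sub>R kraus as x + t *\<^sub>R kraus bs x" for x
        using t by (simp add: cs_def kraus_append kraus_map_scaleR)
      have "kraus cs 1 = 1" unfolding cs as(1) bs(1) by (simp flip: scaleR_add_left)
      moreover have "(\<lambda>x. (1 - t) * u x + t * v x) = (\<lambda>x. Re (\<phi> (kraus cs x)))"
        unfolding cs as(2) bs(2) dual_add[OF dl] dual_scaleR[OF dl] by simp
      ultimately show ?thesis unfolding S_def by blast
    qed
    show "\<exists>u\<in>S. (\<Sum>x\<in>G. c x * Re (\<rho> x)) - \<eta> \<le> (\<Sum>x\<in>G. c x * u x)" if eta: "0 < \<eta>" for c \<eta>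
    proof -
      define h where "h = (\<Sum>x\<in>G. c x *\<^sub>R x)"
      have "star h = h" unfolding h_def star_sum using G(2) by simp
      then obtain as where as: "kraus as 1 = 1" "Re (\<rho> h) - \<eta> \<le> Re (\<phi> (kraus as h))"
        using kraus_dominates[OF \<phi> \<rho> one le _ eta] by blast
      have "kraus as h = (\<Sum>x\<in>G. c x *\<^sub>R kraus as x)"
        unfolding h_def using G(1)
        by (induction G rule: finite_induct)
          (simp_all add: kraus_add kraus_scaleR, use kraus_scaleR[of as 0 0] in simp)
      then have "Re (\<phi> (kraus as h)) = (\<Sum>x\<in>G. c x * Re (\<phi> (kraus as x)))"
        by (simp add: dual_sum[OF dl] dual_scaleR[OF dl])
      moreover have "Re (\<rho> h) = (\<Sum>x\<in>G. c x * Re (\<rho> x))"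
        by (simp add: h_def dual_sum[OF dr] dual_scaleR[OF dr])
      ultimately show ?thesis using as unfolding S_def by auto
    qed
    show "0 < \<epsilon>/2" using eps by simp
  qed
  then obtain as where as: "kraus as (1::'a) = 1"
    and close: "\<And>x. x \<in> G \<Longrightarrow> \<bar>Re (\<rho> x) - Re (\<phi> (kraus as x))\<bar> < \<epsilon>/2"
    unfolding S_def by blast
  have sa: "cmod (\<rho> x - \<phi> (kraus as x)) < \<epsilon>/2" if "x \<in> G" for x
  proof -
    have "star (kraus as x) = kraus as x" using G(2)[OF that] by (simp add: star_kraus)
    then have "Im (\<rho> x - \<phi> (kraus as x)) = 0"
      using pf_selfadjoint_real[OF \<rho>] pf_selfadjoint_real[OF \<phi>] G(2)[OF that] by simp
    then have "cmod (\<rho> x - \<phi> (kraus as x)) = \<bar>Re (\<rho> x - \<phi> (kraus as x))\<bar>"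
      by (simp add: cmod_eq_Re)
    then show ?thesis using close[OF that] by simp
  qed
  have "cmod (\<rho> x - \<phi> (kraus as x)) < \<epsilon>" if "x \<in> F" for x
  proof -
    define a where "a = re_part x"
    define b where "b = im_part x"
    have ab: "a \<in> G" "b \<in> G" using that by (auto simp: G_def a_def b_def)
    have x: "x = a + \<i> *\<^sub>C b" unfolding a_def b_def by (rule re_im_decomp)
    have "\<rho> x - \<phi> (kraus as x) = (\<rho> a - \<phi> (kraus as a)) + \<i> * (\<rho> b - \<phi> (kraus as b))"
      unfolding x kraus_add kraus_scaleC
      by (simp add: dual_add[OF dl] dual_add[OF dr] dual_scaleC[OF dl] dual_scaleC[OF dr] algebra_simps)
    then have "cmod (\<rho> x - \<phi> (kraus as x))
        \<le> cmod (\<rho> a - \<phi> (kraus as a)) + cmod (\<rho> b - \<phi> (kraus as b))"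
      using norm_triangle_ineq[of "\<rho> a - \<phi> (kraus as a)" "\<i> * (\<rho> b - \<phi> (kraus as b))"]
      by (simp add: norm_mult)
    then show ?thesis using sa[OF ab(1)] sa[OF ab(2)] by linarith
  qed
  then show ?thesis using as by blast
qed


section \<open>The Hahn-Banach theorem for sublinear functionals\<close>

definition sublinear :: "('v::real_vector \<Rightarrow> real) \<Rightarrow> bool" where
  "sublinear p \<longleftrightarrow> p 0 = 0 \<and> (\<forall>x y. p (x + y) \<le> p x + p y) \<and> (\<forall>c>0. \<forall>x. p (c *\<^sub>R x) \<le> c * p x)"

lemma sublinear_scaleR:
  assumes "sublinear p" "0 < c"
  shows "p (c *\<^sub>R x) = c * p x"
proof (rule antisym)
  show "p (c *\<^sub>R x) \<le> c * p x" using assms by (simp add: sublinear_def)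
  have "p ((1/c) *\<^sub>R (c *\<^sub>R x)) \<le> (1/c) * p (c *\<^sub>R x)"
    using assms unfolding sublinear_def by (meson zero_less_divide_1_iff)
  then show "c * p x \<le> p (c *\<^sub>R x)" using assms(2) by (simp add: field_simps)
qed

lemma sublinear_neg: "sublinear p \<Longrightarrow> - p (- x) \<le> p x"
proof -
  assume p: "sublinear p"
  then have "p (x + (- x)) \<le> p x + p (- x)" unfolding sublinear_def by blast
  then show ?thesis using p by (simp add: sublinear_def)
qed

text \<open>
  Subtracting \<open>t m y\<close> from \<open>m (x + t y)\<close> and minimizing over \<open>t \<ge> 0\<close> gives a sublinear functional
  below \<open>m\<close>. If \<open>m\<close> is minimal, this is \<open>m\<close> again, and \<open>t = 1\<close> shows that \<open>m\<close> is superadditive.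
\<close>

lemma minimal_sublinear_linear:
  assumes m: "sublinear m" and min: "\<And>p. sublinear p \<Longrightarrow> p \<le> m \<Longrightarrow> p = m"
  shows "linear m"
proof -
  have super: "m x + m y \<le> m (x + y)" for x y
  proof -
    define g where "g x t = m (x + t *\<^sub>R y) - t * m y" for x t
    define p where "p x = (INF t\<in>{0..}. g x t)" for x
    have lower: "- m (- x) \<le> g x t" if "0 \<le> t" for x t
    proof -
      have "t * m y = m (t *\<^sub>R y)"
        using sublinear_scaleR[OF m, of t y] that m by (cases "t = 0") (auto simp: sublinear_def)
      also have "t *\<^sub>R y = (x + t *\<^sub>R y) + (- x)" by simp
      also have "m \<dots> \<le> m (x + t *\<^sub>R y) + m (- x)" using m unfolding sublinear_def by blast
      finally show ?thesis by (simp add: g_def)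
    qed
    then have bdd: "bdd_below (g x ` {0..})" for x by (intro bdd_belowI2[of _ "- m (- x)"]) auto
    have p_le: "p x \<le> g x t" if "0 \<le> t" for x t
      unfolding p_def using that by (intro cINF_lower[OF bdd]) auto
    have p_ge: "c \<le> p x" if "\<And>t. 0 \<le> t \<Longrightarrow> c \<le> g x t" for c x
      unfolding p_def using that by (intro cINF_greatest) auto
    have p_m: "p x \<le> m x" for x using p_le[of 0 x] by (simp add: g_def)
    have "sublinear p"
      unfolding sublinear_def
    proof (intro conjI allI impI)
      show "p 0 = 0"
        using p_m[of 0] p_ge[of 0 0] lower[of _ 0] m by (force simp: sublinear_def)
      show "p (x + x') \<le> p x + p x'" for x x'
      proof -
        have "p (x + x') \<le> g x s + g x' t" if "0 \<le> s" "0 \<le> t" for s t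
        proof -
          have "p (x + x') \<le> g (x + x') (s + t)" using that by (intro p_le) simp
          moreover have e: "x + x' + (s + t) *\<^sub>R y = (x + s *\<^sub>R y) + (x' + t *\<^sub>R y)"
            by (simp add: algebra_simps)
          have "m ((x + s *\<^sub>R y) + (x' + t *\<^sub>R y)) \<le> m (x + s *\<^sub>R y) + m (x' + t *\<^sub>R y)"
            using m unfolding sublinear_def by blast
          then have "g (x + x') (s + t) \<le> g x s + g x' t"
            unfolding g_def e by (simp add: distrib_right)
          ultimately show ?thesis by simp
        qed
        then have "p (x + x') - g x' t \<le> p x" if "0 \<le> t" for t
          using that by (intro p_ge) (simp add: diff_le_eq)
        then have "p (x + x') - p x \<le> p x'"
          by (intro p_ge) (simp add: diff_le_eq add.commute)
        then show ?thesis by simp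
      qed
      show "p (c *\<^sub>R x) \<le> c * p x" if c: "0 < c" for c x
      proof -
        have "p (c *\<^sub>R x) / c \<le> g x t" if t: "0 \<le> t" for t
        proof -
          have "p (c *\<^sub>R x) \<le> g (c *\<^sub>R x) (c * t)" using c t by (intro p_le) simp
          also have "\<dots> = c * g x t"
            using sublinear_scaleR[OF m c, of "x + t *\<^sub>R y"] by (simp add: g_def algebra_simps)
          finally show ?thesis using c by (simp add: field_simps)
        qed
        then have "p (c *\<^sub>R x) / c \<le> p x" by (rule p_ge)
        then show ?thesis using c by (simp add: field_simps)
      qed
    qed
    then have "p = m" using p_m by (intro min) (auto simp: le_fun_def)
    then show ?thesis using p_le[of 1 x] by (simp add: g_def)
  qed
  have add: "m (x + y) = m x + m y" for x y
    using super[of x y] m by (intro antisym) (auto simp: sublinear_def)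
  have neg: "m (- x) = - m x" for x
    using add[of x "- x"] m by (simp add: sublinear_def)
  have "m (r *\<^sub>R x) = r * m x" for r x
  proof (cases r "0::real" rule: linorder_cases)
    case less
    then have "m ((- r) *\<^sub>R x) = (- r) * m x" by (intro sublinear_scaleR[OF m]) simp
    then show ?thesis using neg[of "r *\<^sub>R x"] by simp
  qed (use m sublinear_scaleR[OF m] in \<open>auto simp: sublinear_def\<close>)
  with add show ?thesis by (intro linearI) auto
qed

text \<open>Zorn's lemma provides a minimal sublinear functional below \<open>q\<close>.\<close>

lemma sublinear_dominates_linear:
  fixes q :: "'v::real_vector \<Rightarrow> real"
  assumes q: "sublinear q"
  obtains f where "linear f" "\<And>x. f x \<le> q x"
proof -
  define A where "A = {p. sublinear p \<and> p \<le> q}"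
  have "\<exists>m\<in>A. \<forall>a\<in>A. a \<le> m \<longrightarrow> a = m"
  proof (rule predicate_Zorn)
    show "partial_order_on A (relation_of (\<lambda>a b. b \<le> a) A)"
      by (rule partial_order_on_relation_ofI) auto
    fix C assume "C \<in> Chains (relation_of (\<lambda>a b. b \<le> a) A)"
    then have CA: "C \<subseteq> A" and tot: "\<And>a b. a \<in> C \<Longrightarrow> b \<in> C \<Longrightarrow> a \<le> b \<or> b \<le> a"
      by (auto simp: Chains_def relation_of_def)
    show "\<exists>u\<in>A. \<forall>a\<in>C. u \<le> a"
    proof (cases "C = {}")
      case True
      then show ?thesis using q by (auto simp: A_def)
    next
      case False
      then obtain a0 where a0: "a0 \<in> C" by blast
      have sub: "sublinear a" "a x \<le> q x" if "a \<in> C" for a x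
        using CA that by (auto simp: A_def le_fun_def)
      define u where "u x = (INF a\<in>C. a x)" for x
      have bdd: "bdd_below ((\<lambda>a. a x) ` C)" for x
      proof (rule bdd_belowI2)
        fix a assume a: "a \<in> C"
        show "- q (- x) \<le> a x"
          using sublinear_neg[OF sub(1)[OF a], of x] sub(2)[OF a, of "- x"] by simp
      qed
      have u_le: "u x \<le> a x" if "a \<in> C" for a x
        unfolding u_def by (rule cINF_lower[OF bdd that])
      have u_ge: "c \<le> u x" if "\<And>a. a \<in> C \<Longrightarrow> c \<le> a x" for c x
        unfolding u_def using False that by (intro cINF_greatest) auto
      have "sublinear u"
        unfolding sublinear_def
      proof (intro conjI allI impI)
        have z: "a 0 = 0" if "a \<in> C" for a using sub(1)[OF that] by (simp add: sublinear_def)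
        show "u 0 = 0" using u_le[OF a0, of 0] u_ge[of 0 0] by (simp add: z a0)
        show "u (x + y) \<le> u x + u y" for x y
        proof -
          have "u (x + y) \<le> a x + b y" if ab: "a \<in> C" "b \<in> C" for a b
          proof -
            obtain c where c: "c \<in> C" "c \<le> a" "c \<le> b" using tot[OF ab] ab by blast
            have "u (x + y) \<le> c (x + y)" by (rule u_le[OF c(1)])
            also have "\<dots> \<le> c x + c y" using sub(1)[OF c(1)] by (simp add: sublinear_def)
            also have "\<dots> \<le> a x + b y" using c by (intro add_mono) (auto simp: le_fun_def)
            finally show ?thesis .
          qed
          then have "u (x + y) - b y \<le> u x" if "b \<in> C" for b
            using that by (intro u_ge) (simp add: diff_le_eq)
          then have "u (x + y) - u x \<le> u y" by (intro u_ge) (simp add: diff_le_eq add.commute)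
          then show ?thesis by simp
        qed
        show "u (c *\<^sub>R x) \<le> c * u x" if c: "0 < c" for c x
        proof -
          have "u (c *\<^sub>R x) / c \<le> a x" if "a \<in> C" for a
            using u_le[OF that, of "c *\<^sub>R x"] sublinear_scaleR[OF sub(1)[OF that] c, of x] c
            by (simp add: field_simps)
          then have "u (c *\<^sub>R x) / c \<le> u x" by (rule u_ge)
          then show ?thesis using c by (simp add: field_simps)
        qed
      qed
      moreover have "u \<le> q" using order_trans[OF u_le[OF a0] sub(2)[OF a0]] by (simp add: le_fun_def)
      ultimately show ?thesis using u_le by (auto simp: A_def le_fun_def)
    qed
  qed
  then obtain m where m: "m \<in> A" "\<And>a. a \<in> A \<Longrightarrow> a \<le> m \<Longrightarrow> a = m" by blast
  have "linear m"
    using m by (intro minimal_sublinear_linear) (auto simp: A_def intro: order_trans)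
  then show ?thesis using m(1) by (intro that) (auto simp: A_def le_fun_def)
qed


section \<open>The Jordan decomposition\<close>

lemma pos_of_realD: "pos (of_real r :: 'a::cstar_algebra) \<Longrightarrow> 0 \<le> r"
proof (rule ccontr)
  assume "pos (of_real r :: 'a)" "\<not> 0 \<le> r"
  moreover from this have "pos (- of_real r :: 'a)" using pos_of_real[of "- r"] by simp
  ultimately show False using pos_antisym[of "of_real r :: 'a"] by simp
qed

text \<open>
  A linear functional \<open>f\<close> on the selfadjoint part is the positive part of a Jordan decomposition
  of \<open>\<omega>\<close> iff \<open>f \<ge> 0\<close>, \<open>f \<ge> \<omega>\<close> and \<open>f 1 = \<kappa>\<close> for \<open>\<kappa> = (\<parallel>\<omega>\<parallel> + \<omega> 1) / 2\<close>. These conditions say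
  that \<open>f x \<le> t \<kappa> - \<omega> b\<close> whenever \<open>x \<preceq> t - b\<close> with \<open>b \<succeq> 0\<close>, so \<open>f\<close> is provided by the
  Hahn-Banach theorem for the infimum \<open>q x\<close> of these bounds. That \<open>q 0 = 0\<close> expresses the
  estimate \<open>\<omega> b \<le> t \<kappa>\<close> for \<open>0 \<preceq> b \<preceq> t\<close>, which is \<open>\<omega> (2 b - t) \<le> t \<parallel>\<omega>\<parallel>\<close>.
\<close>

lemma jordan_decomposition_exists:
  fixes \<omega> :: "'a::cstar_algebra \<Rightarrow> complex"
  assumes \<omega>: "hermitian_functional \<omega>"
  shows "\<exists>p n. jordan_decomposition \<omega> p n"
proof -
  have d: "\<omega> \<in> dual_space" using \<omega> by (simp add: hermitian_functional_def)
  define W where "W = onorm \<omega>"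
  have W: "cmod (\<omega> x) \<le> W * norm x" for x
    unfolding W_def onorm_eq_restr_norm by (rule restr_norm_bound[OF d UNIV_I])
  \<comment> \<open>the value at \<open>1\<close> forced by \<open>p 1 - n 1 = \<omega> 1\<close> and \<open>p 1 + n 1 = \<parallel>\<omega>\<parallel>\<close>\<close>
  define \<kappa> where "\<kappa> = (W + Re (\<omega> 1)) / 2"
  have \<kappa>: "0 \<le> \<kappa>" using W[of 1] abs_Re_le_cmod[of "\<omega> 1"] by (simp add: \<kappa>_def)
  have key: "Re (\<omega> b) \<le> T * \<kappa>" if b: "pos b" "b \<preceq> of_real T" for b T
  proof -
    have T: "0 \<le> T" using pos_of_realD pos_add[OF b] by simp
    define u where "u = 2 *\<^sub>R b - of_real T"
    have "of_real T - u = 2 *\<^sub>R (of_real T - b)" by (simp add: u_def scaleR_2 algebra_simps)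
    then have "u \<preceq> of_real T" using b pos_scaleR[of 2] by simp
    moreover have "pos (u + of_real T)" using b pos_scaleR[of 2 b] by (simp add: u_def)
    ultimately have "norm u \<le> T" using T by (intro norm_le_if_between) auto
    moreover have "0 \<le> W" using order_trans[OF norm_ge_zero W[of 1]] by simp
    ultimately have "Re (\<omega> u) \<le> W * T"
      using complex_Re_le_cmod[of "\<omega> u"] W[of u] mult_left_mono[of "norm u" T W] by linarith
    moreover have "Re (\<omega> u) = 2 * Re (\<omega> b) - T * Re (\<omega> 1)"
      by (simp add: u_def dual_simps[OF d])
    ultimately show ?thesis by (simp add: \<kappa>_def field_simps)
  qed
  define S where "S x = {(b, t). pos b \<and> pos (of_real t - b - re_part x)}" for x :: 'a
  define v where "v = (\<lambda>(b, t). t * \<kappa> - Re (\<omega> b))"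
  define q where "q x = (INF z\<in>S x. v z)" for x
  have lower: "- (norm x * \<kappa>) \<le> v z" if z: "z \<in> S x" for x z
  proof -
    obtain b t where bt: "z = (b, t)" "pos b" "pos (of_real t - b - re_part x)"
      using z by (auto simp: S_def)
    have "pos (re_part x + of_real (norm x))"
      by (rule minus_norm_le[OF star_re_part norm_re_part])
    from pos_add[OF bt(3) this] have "b \<preceq> of_real (t + norm x)" by (simp add: algebra_simps)
    then have "Re (\<omega> b) \<le> (t + norm x) * \<kappa>" by (rule key[OF bt(2)])
    then show ?thesis by (simp add: v_def bt(1) algebra_simps)
  qed
  have bdd: "bdd_below (v ` S x)" for x using lower by (intro bdd_belowI2[of _ "- (norm x * \<kappa>)"]) auto
  have q_le: "q x \<le> t * \<kappa> - Re (\<omega> b)" if "pos b" "pos (of_real t - b - re_part x)" for x b t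
    using cINF_lower[OF bdd, of "(b, t)" x] that by (simp add: q_def S_def v_def)
  have top: "(0, norm x) \<in> S x" for x
    using le_norm[OF star_re_part norm_re_part] by (simp add: S_def)
  have q_ge: "c \<le> q x" if "\<And>b t. pos b \<Longrightarrow> pos (of_real t - b - re_part x) \<Longrightarrow> c \<le> t * \<kappa> - Re (\<omega> b)" for c x
  proof -
    have "S x \<noteq> {}" using top[of x] by blast
    then show ?thesis unfolding q_def using that by (intro cINF_greatest) (auto simp: S_def v_def)
  qed
  have "sublinear q"
    unfolding sublinear_def
  proof (intro conjI allI impI)
    have "q 0 \<le> 0" using q_le[of 0 0 0] by (simp add: re_part_def dual_zero[OF d])
    moreover have "0 \<le> q 0"
      using lower[of _ 0] by (intro q_ge) (force simp: S_def v_def)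
    ultimately show "q 0 = 0" by simp
    show "q (x + y) \<le> q x + q y" for x y
    proof -
      have *: "q (x + y) \<le> (t * \<kappa> - Re (\<omega> b)) + (s * \<kappa> - Re (\<omega> c))"
        if "pos b" "pos (of_real t - b - re_part x)" "pos c" "pos (of_real s - c - re_part y)" for b t c s
      proof -
        have "pos (of_real (t + s) - (b + c) - re_part (x + y))"
          using pos_add[OF that(2,4)] by (simp add: re_part_add algebra_simps)
        then have "q (x + y) \<le> (t + s) * \<kappa> - Re (\<omega> (b + c))"
          using that by (intro q_le pos_add) auto
        then show ?thesis by (simp add: dual_add[OF d] algebra_simps)
      qed
      have "q (x + y) - (s * \<kappa> - Re (\<omega> c)) \<le> q x" if "pos c" "pos (of_real s - c - re_part y)" for c s
        using * that by (intro q_ge) (simp add: diff_le_eq)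
      then have "q (x + y) - q x \<le> s * \<kappa> - Re (\<omega> c)" if "pos c" "pos (of_real s - c - re_part y)" for c s
        using that by (simp only: diff_le_eq add.commute)
      then have "q (x + y) - q x \<le> q y" by (rule q_ge)
      then show ?thesis by simp
    qed
    show "q (r *\<^sub>R x) \<le> r * q x" if r: "0 < r" for r x
    proof -
      have "q (r *\<^sub>R x) / r \<le> q x"
      proof (rule q_ge)
        fix b t assume bt: "pos b" "pos (of_real t - b - re_part x)"
        have "pos (r *\<^sub>R (of_real t - b - re_part x))" using bt r by (intro pos_scaleR) auto
        then have "pos (of_real (r * t) - r *\<^sub>R b - re_part (r *\<^sub>R x))"
          by (simp add: re_part_scaleR of_real_def scaleR_diff_right)
        moreover have "pos (r *\<^sub>R b)" using bt r by (intro pos_scaleR) auto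
        ultimately have "q (r *\<^sub>R x) \<le> (r * t) * \<kappa> - Re (\<omega> (r *\<^sub>R b))" by (intro q_le)
        then show "q (r *\<^sub>R x) / r \<le> t * \<kappa> - Re (\<omega> b)"
          using r by (simp add: dual_scaleR[OF d] field_simps)
      qed
      then show ?thesis using r by (simp add: field_simps)
    qed
  qed
  from sublinear_dominates_linear[OF this] obtain f where f: "linear f" "\<And>x. f x \<le> q x" by metis
  have f_neg: "f (- x) = - f x" for x using linear_neg[OF f(1)] by simp
  have f0: "f 0 = 0" using linear_0[OF f(1)] .
  have f_re0: "f x = 0" if "re_part x = 0" for x
  proof -
    have 0: "f y \<le> 0" if "re_part y = 0" for y
      using order_trans[OF f(2) q_le[of 0 0 y]] that by (simp add: dual_zero[OF d])
    have "re_part (- x) = 0" using re_part_scaleR[of "-1" x] that by simp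
    then show ?thesis using 0[OF that] 0[of "- x"] by (simp add: f_neg)
  qed
  have f_abs: "\<bar>f x\<bar> \<le> \<kappa> * norm x" for x
  proof -
    have "f y \<le> \<kappa> * norm y" for y
      using order_trans[OF f(2) q_le[of 0 "norm y" y]] top[of y]
      by (simp add: S_def dual_zero[OF d] mult.commute)
    from this[of x] this[of "- x"] show ?thesis by (simp add: f_neg)
  qed
  define \<phi> where "\<phi> x = Complex (f x) (- f (\<i> *\<^sub>C x))" for x
  have \<phi>d: "\<phi> \<in> dual_space"
  proof (rule dual_spaceI)
    show "\<phi> (x + y) = \<phi> x + \<phi> y" for x y
      by (simp add: \<phi>_def scaleC_add_right linear_add[OF f(1)] complex_eq_iff)
    show "\<phi> (c *\<^sub>C x) = c * \<phi> x" for c x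
    proof -
      have "c *\<^sub>C x = Re c *\<^sub>R x + Im c *\<^sub>R (\<i> *\<^sub>C x)"
        by (simp add: scaleR_scaleC scaleC_scaleC scaleC_add_left[symmetric] complex_eq mult.commute)
          (metis complex_eq mult.commute)
      moreover have "\<i> *\<^sub>C (c *\<^sub>C x) = Re c *\<^sub>R (\<i> *\<^sub>C x) - Im c *\<^sub>R x"
        unfolding calculation by (simp add: scaleC_add_right scaleC_scaleR_commute scaleC_scaleC
            scaleC_minus_left scaleC_one)
      ultimately show ?thesis
        by (simp add: \<phi>_def complex_eq_iff linear_add[OF f(1)] linear_diff[OF f(1)] linear_scale[OF f(1)])
    qed
    show "cmod (\<phi> x) \<le> (2 * \<kappa>) * norm x" for x
      using cmod_le[of "\<phi> x"] f_abs[of x] f_abs[of "\<i> *\<^sub>C x"] by (simp add: \<phi>_def norm_scaleC)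
  qed
  have Im\<phi>: "Im (\<phi> x) = 0" if "star x = x" for x
    using f_re0[of "\<i> *\<^sub>C x"] that by (simp add: \<phi>_def re_part_def star_scaleC scaleC_minus_left)
  have \<phi>_ge: "Re (\<omega> x) \<le> f x" "0 \<le> f x" if x: "pos x" for x
  proof -
    have "re_part (- x) = - x" using x by (intro re_part_selfadjoint) (simp add: pos_star)
    then have "f (- x) \<le> - Re (\<omega> x)" "f (- x) \<le> 0"
      using order_trans[OF f(2) q_le[of x 0 "- x"]] order_trans[OF f(2) q_le[of 0 0 "- x"]] x
      by (simp_all add: dual_zero[OF d])
    then show "Re (\<omega> x) \<le> f x" "0 \<le> f x" by (simp_all add: f_neg)
  qed
  have p1: "positive_functional \<phi>"
    by (rule positive_functionalI[OF \<phi>d]) (simp_all add: \<phi>_ge Im\<phi> pos_star, simp add: \<phi>_def \<phi>_ge)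
  define \<nu> where "\<nu> x = \<phi> x - \<omega> x" for x
  have \<nu>d: "\<nu> \<in> dual_space"
  proof (rule dual_spaceI)
    show "cmod (\<nu> x) \<le> (Re (\<phi> 1) + W) * norm x" for x
      using norm_triangle_ineq4[of "\<phi> x" "\<omega> x"] pf_bound[OF p1, of x] W[of x]
      by (simp add: \<nu>_def distrib_right)
  qed (simp_all add: \<nu>_def dual_simps[OF \<phi>d] dual_simps[OF d] algebra_simps)
  have p2: "positive_functional \<nu>"
  proof (rule positive_functionalI[OF \<nu>d])
    fix x :: 'a assume x: "pos x"
    show "0 \<le> Re (\<nu> x)" using \<phi>_ge[OF x] by (simp add: \<nu>_def \<phi>_def)
    have "Im (\<omega> x) = 0"
      using hermitian_selfadjoint_real[OF \<omega> pos_star[OF x]] by (metis Im_complex_of_real)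
    then show "Im (\<nu> x) = 0" using Im\<phi>[OF pos_star[OF x]] by (simp add: \<nu>_def)
  qed
  have "re_part 1 = (1::'a)" "re_part (- 1) = (- 1::'a)" by (simp_all add: re_part_selfadjoint)
  then have "f 1 \<le> \<kappa>" "f (- 1) \<le> - \<kappa>"
    using order_trans[OF f(2) q_le[of 0 1 1]] order_trans[OF f(2) q_le[of 0 "-1" "-1"]]
    by (simp_all add: dual_zero[OF d])
  then have "Re (\<phi> 1) = \<kappa>" by (simp add: \<phi>_def f_neg)
  then have "onorm \<omega> = onorm \<phi> + onorm \<nu>"
    using pf_restr_norm_UNIV[OF p1] pf_restr_norm_UNIV[OF p2]
    by (simp add: onorm_eq_restr_norm[of \<phi>] onorm_eq_restr_norm[of \<nu>] \<nu>_def[of 1] \<kappa>_def W_def[symmetric] field_simps)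
  then have "jordan_decomposition \<omega> \<phi> \<nu>"
    unfolding jordan_decomposition_def using p1 p2 by (auto simp: \<nu>_def)
  then show ?thesis by blast
qed

lemma jordan_decomposition_parts:
  assumes "hermitian_functional \<omega>"
  shows "jordan_decomposition \<omega> (pos_part \<omega>) (neg_part \<omega>)"
proof -
  have "\<exists>z. (\<lambda>(p, n). jordan_decomposition \<omega> p n) z"
    using jordan_decomposition_exists[OF assms] by auto
  then have "(\<lambda>(p, n). jordan_decomposition \<omega> p n) (jordan_parts \<omega>)"
    unfolding jordan_parts_def by (rule someI_ex)
  then show ?thesis by (simp add: pos_part_def neg_part_def case_prod_beta)
qed


section \<open>Realizing both parts simultaneously\<close>

text \<open>
  The parts \<open>p\<close> and \<open>n\<close> are almost supported on complementary elements \<open>s\<^sup>2\<close> and \<open>t\<^sup>2\<close>: if \<open>u\<close> is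
  a selfadjoint contraction at which \<open>\<omega>\<close> almost attains its norm, then \<open>p (1 - u) + n (1 + u)\<close> is
  small, with both terms nonnegative.
\<close>

lemma jordan_almost_orthogonal:
  fixes \<omega> :: "'a::cstar_algebra \<Rightarrow> complex"
  assumes \<omega>: "hermitian_functional \<omega>" and j: "jordan_decomposition \<omega> p n" and e: "0 < e"
  obtains s t where "pos s" "pos t" "norm s \<le> 1" "norm t \<le> 1" "s * s + t * t = 1"
    "Re (p (t * t)) \<le> e" "Re (n (s * s)) \<le> e"
proof -
  have p: "positive_functional p" and n: "positive_functional n"
    and om: "\<omega> = (\<lambda>x. p x - n x)" and on: "onorm \<omega> = onorm p + onorm n"
    using j by (auto simp: jordan_decomposition_def)
  note dp = pf_dual[OF p] and dn = pf_dual[OF n]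
  have d: "\<omega> \<in> dual_space" using \<omega> by (simp add: hermitian_functional_def)
  have W: "restr_norm \<omega> UNIV = Re (p 1) + Re (n 1)"
    using on by (simp add: onorm_eq_restr_norm pf_restr_norm_UNIV[OF p] pf_restr_norm_UNIV[OF n])
  have "0 < 2 * e" using e by simp
  then obtain z where z: "norm z \<le> 1" "restr_norm \<omega> UNIV - 2 * e \<le> cmod (\<omega> z)"
    using restr_norm_approx[OF d UNIV_I UNIV_I] by blast
  define c where "c = (if \<omega> z = 0 then 1 else cnj (\<omega> z) / cmod (\<omega> z))"
  have c: "cmod c = 1" "Re (c * \<omega> z) = cmod (\<omega> z)"
  proof -
    show "cmod c = 1" by (simp add: c_def norm_divide)
    have "cnj (\<omega> z) * \<omega> z = of_real ((cmod (\<omega> z))\<^sup>2)"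
      unfolding complex_norm_square by (rule mult.commute)
    then have "c * \<omega> z = of_real (cmod (\<omega> z))"
      by (auto simp: c_def power2_eq_square)
    then show "Re (c * \<omega> z) = cmod (\<omega> z)" by simp
  qed
  define u where "u = re_part (c *\<^sub>C z)"
  have su: "star u = u" by (simp add: u_def)
  have nu: "norm u \<le> 1" using norm_re_part[of "c *\<^sub>C z"] z(1) c(1) by (simp add: u_def norm_scaleC)
  have "Re (\<omega> u) = cmod (\<omega> z)"
    unfolding u_def hermitian_re_part[OF \<omega>, symmetric] dual_scaleC[OF d] by (rule c(2))
  then have big: "Re (p 1) + Re (n 1) - 2 * e \<le> Re (p u) - Re (n u)"
    using z(2) W by (simp add: om)
  have plus: "pos (1 + u)" using minus_norm_le[OF su nu] by (simp add: add.commute)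
  have minus: "pos (1 - u)" using le_norm[OF su nu] by simp
  have half: "pos ((1/2) *\<^sub>R (1 + u))" "pos ((1/2) *\<^sub>R (1 - u))"
    using plus minus by (auto intro: pos_scaleR)
  obtain s where s: "pos s" "s * s = (1/2) *\<^sub>R (1 + u)" using pos_sqrt[OF half(1)] by metis
  obtain t where t: "pos t" "t * t = (1/2) *\<^sub>R (1 - u)" using pos_sqrt[OF half(2)] by metis
  have contr: "norm w \<le> 1" if "pos w" "w * w = (1/2) *\<^sub>R y" "norm y \<le> 2" for w y :: 'a
  proof -
    have "(norm w)\<^sup>2 \<le> 1\<^sup>2"
      using norm_square_selfadjoint[OF pos_star[OF that(1)]] that(2,3) by simp
    then show ?thesis by (rule power2_le_imp_le) simp
  qed
  have ns: "norm s \<le> 1"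
    using norm_triangle_ineq[of 1 u] nu by (intro contr[OF s]) simp
  have nt: "norm t \<le> 1"
    using norm_triangle_ineq4[of 1 u] nu by (intro contr[OF t]) simp
  have st: "s * s + t * t = 1"
    unfolding s(2) t(2) by (simp add: scaleR_add_right[symmetric] scaleR_2[symmetric] del: scaleR_add_right)
  have "0 \<le> Re (p (1 - u))" "0 \<le> Re (n (1 + u))"
    using pf_nonneg[OF p minus] pf_nonneg[OF n plus] by auto
  then have "Re (p (t * t)) \<le> e" "Re (n (s * s)) \<le> e"
    using big by (simp_all add: s(2) t(2) dual_simps[OF dp] dual_simps[OF dn])
  then show ?thesis using that s(1) t(1) ns nt st by blast
qed

text \<open>Compression by a positive contraction changes \<open>\<phi>\<close> little if \<open>\<phi>\<close> almost lives on it.\<close>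

lemma compress_close:
  fixes \<phi> :: "'a::cstar_algebra \<Rightarrow> complex"
  assumes \<phi>: "positive_functional \<phi>" and s: "pos s" "norm s \<le> 1"
    and small: "Re (\<phi> (1 - s * s)) \<le> \<delta>\<^sup>2" and \<delta>: "0 \<le> \<delta>"
  shows "cmod (\<phi> (s * y * s) - \<phi> y) \<le> 2 * (\<delta> * sqrt (Re (\<phi> 1)) * norm y)"
proof -
  define P where "P = Re (\<phi> 1)"
  have P: "0 \<le> P" unfolding P_def by (rule pf_one_nonneg[OF \<phi>])
  have s1: "s \<preceq> 1" using le_norm[OF pos_star[OF s(1)] s(2)] by simp
  have sa: "star (1 - s) = 1 - s" by (simp add: star_diff pos_star[OF s(1)])
  have e: "Re (\<phi> ((1 - s) * (1 - s))) \<le> \<delta>\<^sup>2"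
    using pf_mono[OF \<phi> one_minus_square_le[OF s(1) s1]] small by linarith
  have e0: "0 \<le> Re (\<phi> ((1 - s) * (1 - s)))" using pf_nonneg[OF \<phi> pos_square[OF sa]] .
  have sq: "cmod c \<le> \<delta> * sqrt P * norm y"
    if "(cmod c)\<^sup>2 \<le> a * b" "a \<le> P * (norm y)\<^sup>2" "b \<le> \<delta>\<^sup>2" "0 \<le> b" for c a b
  proof -
    have "a * b \<le> (P * (norm y)\<^sup>2) * \<delta>\<^sup>2"
      using that P by (intro mult_mono) auto
    then have "(cmod c)\<^sup>2 \<le> (\<delta> * sqrt P * norm y)\<^sup>2"
      using that(1) P by (simp add: power_mult_distrib mult_ac)
    then show ?thesis by (rule power2_le_imp_le) (use \<delta> P in simp)
  qed
  have "norm (y * s) \<le> norm y"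
    using mult_left_mono[OF s(2), of "norm y"] by (intro order_trans[OF norm_mult_ineq]) auto
  then have "Re (\<phi> (star (y * s) * (y * s))) \<le> P * (norm y)\<^sup>2"
    unfolding P_def using pf_one_nonneg[OF \<phi>]
    by (intro order_trans[OF pf_star_mult_le[OF \<phi>]] mult_left_mono power_mono) auto
  then have 1: "cmod (\<phi> ((1 - s) * (y * s))) \<le> \<delta> * sqrt P * norm y"
    using cauchy_schwarz[OF \<phi>, of "1 - s" "y * s"] e e0 unfolding sa by (intro sq)
  have "Re (\<phi> (star (star y) * star y)) \<le> P * (norm y)\<^sup>2"
    using pf_star_mult_le[OF \<phi>, of "star y"] by (simp add: P_def)
  then have 2: "cmod (\<phi> (y * (1 - s))) \<le> \<delta> * sqrt P * norm y"
    using cauchy_schwarz[OF \<phi>, of "star y" "1 - s"] e e0 unfolding sa star_star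
    by (intro sq) (simp_all add: mult.commute)
  have "y - s * y * s = (1 - s) * (y * s) + y * (1 - s)" by (simp add: algebra_simps)
  then have "\<phi> y - \<phi> (s * y * s) = \<phi> ((1 - s) * (y * s)) + \<phi> (y * (1 - s))"
    by (simp only: dual_diff[OF pf_dual[OF \<phi>], symmetric] dual_add[OF pf_dual[OF \<phi>], symmetric])
  then have "cmod (\<phi> y - \<phi> (s * y * s)) \<le> \<delta> * sqrt P * norm y + \<delta> * sqrt P * norm y"
    using norm_triangle_mono[OF 1 2] by (simp only:)
  then show ?thesis unfolding norm_minus_commute[of "\<phi> y"] P_def by (simp only: mult_2)
qed

lemma compress_small:
  fixes \<phi> :: "'a::cstar_algebra \<Rightarrow> complex"
  assumes \<phi>: "positive_functional \<phi>" and t: "pos t" "norm t \<le> 1"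
    and small: "Re (\<phi> (t * t)) \<le> \<delta>\<^sup>2" and \<delta>: "0 \<le> \<delta>"
  shows "cmod (\<phi> (t * y * t)) \<le> \<delta> * sqrt (Re (\<phi> 1)) * norm y"
proof -
  define P where "P = Re (\<phi> 1)"
  have P: "0 \<le> P" unfolding P_def by (rule pf_one_nonneg[OF \<phi>])
  note st = pos_star[OF t(1)]
  have "norm (y * t) \<le> norm y"
    using mult_left_mono[OF t(2), of "norm y"] by (intro order_trans[OF norm_mult_ineq]) auto
  then have "Re (\<phi> (star (y * t) * (y * t))) \<le> P * (norm y)\<^sup>2"
    unfolding P_def using pf_one_nonneg[OF \<phi>]
    by (intro order_trans[OF pf_star_mult_le[OF \<phi>]] mult_left_mono power_mono) auto
  then have "Re (\<phi> (star (y * t) * (y * t))) * Re (\<phi> (t * t)) \<le> (P * (norm y)\<^sup>2) * \<delta>\<^sup>2"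
    using P small pf_nonneg[OF \<phi> pos_square[OF st]] by (intro mult_mono) auto
  moreover have "(cmod (\<phi> (t * (y * t))))\<^sup>2 \<le> Re (\<phi> (star (y * t) * (y * t))) * Re (\<phi> (t * t))"
    using cauchy_schwarz[OF \<phi>, of t "y * t"] by (simp only: st)
  ultimately have "(cmod (\<phi> (t * (y * t))))\<^sup>2 \<le> (\<delta> * sqrt P * norm y)\<^sup>2"
    using P by (simp add: power_mult_distrib mult_ac)
  then have "cmod (\<phi> (t * (y * t))) \<le> \<delta> * sqrt P * norm y"
    by (rule power2_le_imp_le) (use \<delta> P in simp)
  then show ?thesis by (simp add: P_def mult.assoc)
qed

text \<open>
  If \<open>\<psi>\<^sub>1\<close> takes \<open>p\<close> to \<open>\<rho>\<^sub>1\<close> and \<open>\<psi>\<^sub>2\<close> takes \<open>n\<close> to \<open>\<rho>\<^sub>2\<close>, approximately, then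
  \<open>\<psi> x = s * \<psi>\<^sub>1 x * s + t * \<psi>\<^sub>2 x * t\<close> does both.
\<close>

lemma hermitian_kraus_approximation:
  fixes \<omega> :: "'a::cstar_algebra \<Rightarrow> complex"
  assumes \<omega>: "hermitian_functional \<omega>" and j: "jordan_decomposition \<omega> p n"
    and r1: "positive_functional \<rho>\<^sub>1" "\<rho>\<^sub>1 1 = p 1"
      "\<And>J. closed_ideal J \<Longrightarrow> restr_norm \<rho>\<^sub>1 J \<le> restr_norm p J"
    and r2: "positive_functional \<rho>\<^sub>2" "\<rho>\<^sub>2 1 = n 1"
      "\<And>J. closed_ideal J \<Longrightarrow> restr_norm \<rho>\<^sub>2 J \<le> restr_norm n J"
    and F: "finite F" and eps: "0 < \<epsilon>"
  shows "\<exists>as. kraus as 1 = 1 \<and> (\<forall>x\<in>F. cmod (\<rho>\<^sub>1 x - \<rho>\<^sub>2 x - \<omega> (kraus as x)) < \<epsilon>)"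
proof -
  have p: "positive_functional p" and n: "positive_functional n" and om: "\<omega> = (\<lambda>x. p x - n x)"
    using j by (auto simp: jordan_decomposition_def)
  note dp = pf_dual[OF p] and dn = pf_dual[OF n]
  have e3: "0 < \<epsilon>/3" using eps by simp
  obtain as where as: "kraus as 1 = 1" "\<And>x. x \<in> F \<Longrightarrow> cmod (\<rho>\<^sub>1 x - p (kraus as x)) < \<epsilon>/3"
    using positive_kraus_approximation[OF p r1 F e3] by blast
  obtain bs where bs: "kraus bs 1 = 1" "\<And>x. x \<in> F \<Longrightarrow> cmod (\<rho>\<^sub>2 x - n (kraus bs x)) < \<epsilon>/3"
    using positive_kraus_approximation[OF n r2 F e3] by blast
  define B where "B = (\<Sum>x\<in>F. norm x)"
  have B: "norm x \<le> B" if "x \<in> F" for x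
    unfolding B_def using F that by (intro member_le_sum) auto
  define P where "P = sqrt (Re (p 1))"
  define N where "N = sqrt (Re (n 1))"
  have PN: "0 \<le> P" "0 \<le> N"
    using pf_one_nonneg[OF p] pf_one_nonneg[OF n] by (auto simp: P_def N_def)
  have B0: "0 \<le> B" by (simp add: B_def sum_nonneg)
  define C where "C = 3 * (P + N) * B + 1"
  have C: "0 < C" unfolding C_def using PN B0 by (intro add_nonneg_pos mult_nonneg_nonneg) auto
  define \<delta> where "\<delta> = \<epsilon> / (3 * C)"
  have \<delta>: "0 < \<delta>" using eps C by (simp add: \<delta>_def)
  have "0 < \<delta>\<^sup>2" using \<delta> by simp
  then obtain s t where st: "pos s" "pos t" "norm s \<le> 1" "norm t \<le> 1" "s * s + t * t = 1"
    and small: "Re (p (t * t)) \<le> \<delta>\<^sup>2" "Re (n (s * s)) \<le> \<delta>\<^sup>2"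
    using jordan_almost_orthogonal[OF \<omega> j] by metis
  define cs where "cs = map (\<lambda>a. a * s) as @ map (\<lambda>a. a * t) bs"
  have cs: "kraus cs x = s * kraus as x * s + t * kraus bs x * t" for x
    by (simp add: cs_def kraus_append kraus_map_mult pos_star[OF st(1)] pos_star[OF st(2)])
  have "kraus cs 1 = 1" unfolding cs as(1) bs(1) using st(5) by simp
  moreover have "cmod (\<rho>\<^sub>1 x - \<rho>\<^sub>2 x - \<omega> (kraus cs x)) < \<epsilon>" if x: "x \<in> F" for x
  proof -
    define y where "y = kraus as x"
    define z where "z = kraus bs x"
    have ny: "norm y \<le> B" "norm z \<le> B"
      using order_trans[OF norm_kraus_le B[OF x]] as(1) bs(1) by (auto simp: y_def z_def)
    have mono: "\<delta> * Q * norm w \<le> \<delta> * Q * B" if "norm w \<le> B" "0 \<le> Q" for Q and w :: 'a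
      using that \<delta> by (intro mult_left_mono) auto
    have t2: "1 - s * s = t * t" "1 - t * t = s * s" using st(5) by (auto simp: algebra_simps)
    have c1: "cmod (p (s * y * s) - p y) \<le> 2 * (\<delta> * P * B)"
      using compress_close[OF p st(1,3) small(1)[folded t2(1)] less_imp_le[OF \<delta>], of y]
        mono[OF ny(1) PN(1)] unfolding P_def[symmetric] by linarith
    have c2: "cmod (n (t * z * t) - n z) \<le> 2 * (\<delta> * N * B)"
      using compress_close[OF n st(2,4) small(2)[folded t2(2)] less_imp_le[OF \<delta>], of z]
        mono[OF ny(2) PN(2)] unfolding N_def[symmetric] by linarith
    have c3: "cmod (p (t * z * t)) \<le> \<delta> * P * B"
      using compress_small[OF p st(2,4) small(1) less_imp_le[OF \<delta>], of z] mono[OF ny(2) PN(1)]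
      unfolding P_def[symmetric] by linarith
    have c4: "cmod (n (s * y * s)) \<le> \<delta> * N * B"
      using compress_small[OF n st(1,3) small(2) less_imp_le[OF \<delta>], of y] mono[OF ny(1) PN(2)]
      unfolding N_def[symmetric] by linarith
    have "\<rho>\<^sub>1 x - \<rho>\<^sub>2 x - \<omega> (kraus cs x) = (\<rho>\<^sub>1 x - p y) - (\<rho>\<^sub>2 x - n z)
        - (p (s * y * s) - p y) - p (t * z * t) + (n (t * z * t) - n z) + n (s * y * s)"
      by (simp add: om cs y_def z_def dual_add[OF dp] dual_add[OF dn])
    also have "cmod \<dots> \<le> cmod (\<rho>\<^sub>1 x - p y) + cmod (\<rho>\<^sub>2 x - n z)
        + cmod (p (s * y * s) - p y) + cmod (p (t * z * t)) + cmod (n (t * z * t) - n z) + cmod (n (s * y * s))"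
      by (intro norm_triangle_le norm_triangle_le_diff add_right_mono order_refl)
    also have "\<dots> < \<epsilon>/3 + \<epsilon>/3 + (2 * (\<delta> * P * B) + \<delta> * P * B + 2 * (\<delta> * N * B) + \<delta> * N * B)"
      using as(2)[OF x] bs(2)[OF x] c1 c2 c3 c4 unfolding y_def[symmetric] z_def[symmetric] by linarith
    also have "2 * (\<delta> * P * B) + \<delta> * P * B + 2 * (\<delta> * N * B) + \<delta> * N * B = \<delta> * (C - 1)"
      by (simp add: C_def algebra_simps)
    also have "\<delta> * (C - 1) \<le> \<epsilon>/3"
      using C \<delta> eps by (simp add: \<delta>_def field_simps)
    finally show ?thesis by simp
  qed
  ultimately show ?thesis by blast
qed


section \<open>The weak* closure\<close>

lemma closure_pointwise:
  fixes S :: "('i \<Rightarrow> 'b::metric_space) set"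
  shows "\<rho> \<in> closure S \<longleftrightarrow> (\<forall>F \<epsilon>. finite F \<and> 0 < \<epsilon> \<longrightarrow> (\<exists>f\<in>S. \<forall>x\<in>F. dist (\<rho> x) (f x) < \<epsilon>))"
proof
  assume cl: "\<rho> \<in> closure S"
  show "\<forall>F \<epsilon>. finite F \<and> 0 < \<epsilon> \<longrightarrow> (\<exists>f\<in>S. \<forall>x\<in>F. dist (\<rho> x) (f x) < \<epsilon>)"
  proof (intro allI impI)
    fix F :: "'i set" and \<epsilon> :: real assume F: "finite F \<and> 0 < \<epsilon>"
    have "open {f. \<forall>x\<in>F. f x \<in> ball (\<rho> x) \<epsilon>}"
      using product_topology_basis'[of F "\<lambda>x. ball (\<rho> x) \<epsilon>" "\<lambda>x. x"] F by simp
    moreover have "\<rho> \<in> {f. \<forall>x\<in>F. f x \<in> ball (\<rho> x) \<epsilon>}" using F by simp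
    ultimately have "S \<inter> {f. \<forall>x\<in>F. f x \<in> ball (\<rho> x) \<epsilon>} \<noteq> {}"
      using cl by (metis (no_types, lifting) closure_iff_nhds_not_empty inf_commute order_refl)
    then show "\<exists>f\<in>S. \<forall>x\<in>F. dist (\<rho> x) (f x) < \<epsilon>" by auto
  qed
next
  assume near: "\<forall>F \<epsilon>. finite F \<and> 0 < \<epsilon> \<longrightarrow> (\<exists>f\<in>S. \<forall>x\<in>F. dist (\<rho> x) (f x) < \<epsilon>)"
  show "\<rho> \<in> closure S"
    unfolding closure_iff_nhds_not_empty
  proof (intro allI impI)
    fix A U :: "('i \<Rightarrow> 'b) set" assume U: "U \<subseteq> A" "open U" "\<rho> \<in> U"
    have "openin (product_topology (\<lambda>i. euclidean) UNIV) U" using U(2) by (simp add: open_fun_def)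
    from product_topology_open_contains_basis[OF this U(3)]
    obtain X where X: "\<rho> \<in> PiE UNIV X" "\<forall>i. openin euclidean (X i)"
      "finite {i. X i \<noteq> topspace euclidean}" "PiE UNIV X \<subseteq> U" by blast
    have "\<exists>e>0. ball (\<rho> i) e \<subseteq> X i" for i
      using X(1,2) by (simp add: open_openin[symmetric] open_contains_ball PiE_iff)
    then obtain e where e: "\<And>i. 0 < e i" "\<And>i. ball (\<rho> i) (e i) \<subseteq> X i" by metis
    define F where "F = {i. X i \<noteq> UNIV}"
    define \<epsilon> where "\<epsilon> = Min (insert 1 (e ` F))"
    have "finite F" "0 < \<epsilon>" using X(3) e(1) by (auto simp: F_def \<epsilon>_def)
    then obtain f where f: "f \<in> S" "\<And>x. x \<in> F \<Longrightarrow> dist (\<rho> x) (f x) < \<epsilon>" using near by blast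
    have "f i \<in> X i" for i
    proof (cases "i \<in> F")
      case True
      then have "\<epsilon> \<le> e i" using \<open>finite F\<close> by (auto simp: \<epsilon>_def)
      then have "f i \<in> ball (\<rho> i) (e i)" using f(2)[OF True] by simp
      then show ?thesis using e(2) by blast
    qed (auto simp: F_def)
    then have "f \<in> PiE UNIV X" by (simp add: PiE_iff)
    then show "S \<inter> A \<noteq> {}" using f(1) X(4) U(1) by blast
  qed
qed

lemma weak_star_closure:
  assumes "S \<subseteq> dual_space"
  shows "weak_star_topology closure_of S = dual_space \<inter> closure S"
  unfolding weak_star_topology_def euclidean_product_topology closure_of_subtopology
  using assms by (simp add: inf_absorb2)

definition dominated_positive :: "('a::cstar_algebra \<Rightarrow> complex) \<Rightarrow> ('a \<Rightarrow> complex) set" where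
  "dominated_positive \<phi> = {f. positive_functional f \<and> f 1 = \<phi> 1 \<and>
     (\<forall>J. closed_ideal J \<longrightarrow> restr_norm f J \<le> restr_norm \<phi> J)}"

text \<open>All conditions are closed, and \<open>\<bar>f x\<bar> \<le> \<phi> 1 * \<parallel>x\<parallel>\<close>, so Tychonoff's theorem applies.\<close>

lemma compact_dominated_positive:
  fixes \<phi> :: "'a::cstar_algebra \<Rightarrow> complex"
  assumes \<phi>: "positive_functional \<phi>"
  shows "compact (dominated_positive \<phi>)"
proof -
  note d = pf_dual[OF \<phi>]
  define K :: "('a \<Rightarrow> complex) set" where
    "K = PiE UNIV (\<lambda>x. cball 0 (Re (\<phi> 1) * norm x))"
  have "compactin (product_topology (\<lambda>_. euclidean) UNIV) K"
    unfolding K_def compactin_PiE by simp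
  then have K: "compact K" by (simp add: euclidean_product_topology)
  define Q :: "('a \<Rightarrow> complex) set" where
    "Q = {f. (\<forall>x y. f (x + y) = f x + f y) \<and> (\<forall>c x. f (c *\<^sub>C x) = c * f x) \<and>
      (\<forall>x. pos x \<longrightarrow> 0 \<le> Re (f x)) \<and> (\<forall>x. pos x \<longrightarrow> Im (f x) = 0) \<and> f 1 = \<phi> 1 \<and>
      (\<forall>J x. closed_ideal J \<and> x \<in> J \<longrightarrow> cmod (f x) \<le> restr_norm \<phi> J * norm x)}"
  have "closed Q"
    unfolding Q_def
    by (intro closed_Collect_conj closed_Collect_all closed_Collect_imp closed_Collect_eq
        closed_Collect_le continuous_intros continuous_on_product_coordinates) auto
  moreover have "dominated_positive \<phi> = K \<inter> Q"
  proof (intro equalityI subsetI)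
    fix f assume "f \<in> dominated_positive \<phi>"
    then have f: "positive_functional f" "f 1 = \<phi> 1"
      and le: "\<And>J. closed_ideal J \<Longrightarrow> restr_norm f J \<le> restr_norm \<phi> J"
      by (auto simp: dominated_positive_def)
    note df = pf_dual[OF f(1)]
    have "cmod (f x) \<le> restr_norm \<phi> J * norm x" if "closed_ideal J" "x \<in> J" for J x
      using order_trans[OF restr_norm_bound[OF df that(2)] mult_right_mono[OF le[OF that(1)]]] by simp
    then have "f \<in> Q"
      unfolding Q_def using f pf_nonneg[OF f(1)] pf_real[OF f(1)]
      by (auto simp: dual_add[OF df] dual_scaleC[OF df])
    moreover have "f \<in> K" using pf_bound[OF f(1)] f(2) by (simp add: K_def PiE_iff)
    ultimately show "f \<in> K \<inter> Q" by simp
  next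
    fix f assume f: "f \<in> K \<inter> Q"
    have "f \<in> dual_space"
      using f by (intro dual_spaceI[where K = "Re (\<phi> 1)"]) (auto simp: K_def Q_def)
    then have "positive_functional f" using f by (intro positive_functionalI) (auto simp: Q_def)
    moreover have "restr_norm f J \<le> restr_norm \<phi> J" if "closed_ideal J" for J
      using f that closed_idealD(1)[OF that] restr_norm_nonneg[OF d closed_idealD(1)[OF that]]
      by (intro restr_norm_leI) (auto simp: Q_def)
    ultimately show "f \<in> dominated_positive \<phi>" using f by (simp add: dominated_positive_def Q_def)
  qed
  ultimately show ?thesis using K compact_Int_closed by simp
qed

text \<open>
  A closed set containing every \<open>(p - n) \<circ> \<psi>\<close>: it is the image of a compact set under subtraction,
  which is how the limits of \<open>p \<circ> \<psi>\<close> and \<open>n \<circ> \<psi>\<close> are extracted simultaneously.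
\<close>

lemma closed_dominated_differences:
  assumes "positive_functional p" "positive_functional n"
  shows "closed ((\<lambda>(f, g) x. f x - g x) ` (dominated_positive p \<times> dominated_positive n))"
    (is "closed ?D")
proof -
  have c: "continuous_on UNIV (\<lambda>fg::('a \<Rightarrow> complex) \<times> ('a \<Rightarrow> complex). fst fg x)"
    "continuous_on UNIV (\<lambda>fg::('a \<Rightarrow> complex) \<times> ('a \<Rightarrow> complex). snd fg x)" for x :: 'a
    using continuous_on_compose2[OF continuous_on_product_coordinates[of x]
        continuous_on_fst[OF continuous_on_id]]
      continuous_on_compose2[OF continuous_on_product_coordinates[of x]
        continuous_on_snd[OF continuous_on_id]] by auto
  have "continuous_on (dominated_positive p \<times> dominated_positive n) (\<lambda>(f, g) x. f x - g x)"
    unfolding case_prod_beta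
    by (intro continuous_on_coordinatewise_then_product continuous_intros
        continuous_on_subset[OF c(1)] continuous_on_subset[OF c(2)]) auto
  then have "compact ?D"
    by (rule compact_continuous_image) (intro compact_Times compact_dominated_positive assms)
  then have "compactin euclidean ?D" by simp
  moreover have "Hausdorff_space (product_topology (\<lambda>_::'a. euclidean :: complex topology) UNIV)"
    unfolding Hausdorff_space_product_topology by simp
  then have "Hausdorff_space (euclidean :: ('a \<Rightarrow> complex) topology)"
    by (simp only: euclidean_product_topology)
  ultimately have "closedin euclidean ?D" by (rule compactin_imp_closedin[rotated])
  then show ?thesis unfolding closed_closedin .
qed

lemma comp_kraus_dual:
  assumes "f \<in> dual_space" "kraus as 1 = 1"
  shows "(\<lambda>x. f (kraus as x)) \<in> dual_space"
proof (rule dual_spaceI)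
  show "f (kraus as (x + y)) = f (kraus as x) + f (kraus as y)"
    "f (kraus as (c *\<^sub>C x)) = c * f (kraus as x)" for x y c
    by (simp_all add: kraus_add kraus_scaleC dual_add[OF assms(1)] dual_scaleC[OF assms(1)])
  show "cmod (f (kraus as x)) \<le> restr_norm f UNIV * norm x" for x
    using order_trans[OF restr_norm_bound[OF assms(1) UNIV_I] mult_left_mono[OF norm_kraus_le[OF assms(2)]]]
      restr_norm_nonneg[OF assms(1) UNIV_I] by blast
qed

lemma norm_comp_kraus_le:
  assumes "f \<in> dual_space" "kraus as 1 = 1" "closed_ideal J" "x \<in> J"
  shows "cmod (f (kraus as x)) \<le> restr_norm f J * norm x"
  using order_trans[OF restr_norm_bound[OF assms(1) kraus_in_ideal[OF assms(3,4)]]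
      mult_left_mono[OF norm_kraus_le[OF assms(2)]]]
    restr_norm_nonneg[OF assms(1) closed_idealD(1)[OF assms(3)]] by blast

lemma comp_kraus_dominated:
  assumes \<phi>: "positive_functional \<phi>" and as: "kraus as 1 = 1"
  shows "(\<lambda>x. \<phi> (kraus as x)) \<in> dominated_positive \<phi>"
proof -
  note d = pf_dual[OF \<phi>]
  have "positive_functional (\<lambda>x. \<phi> (kraus as x))"
    using pf_nonneg[OF \<phi>] pf_real[OF \<phi>] kraus_pos
    by (intro positive_functionalI comp_kraus_dual[OF d as]) auto
  moreover have "restr_norm (\<lambda>x. \<phi> (kraus as x)) J \<le> restr_norm \<phi> J" if J: "closed_ideal J" for J
    using closed_idealD(1)[OF J] restr_norm_nonneg[OF d] norm_comp_kraus_le[OF d as J]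
    by (intro restr_norm_leI) auto
  ultimately show ?thesis using as by (simp add: dominated_positive_def)
qed

lemma weak_star_closure_E_maps:
  fixes \<omega> \<rho> :: "'a::cstar_algebra \<Rightarrow> complex"
  assumes "\<omega> \<in> dual_space" "\<rho> \<in> dual_space"
  shows "\<rho> \<in> weak_star_topology closure_of ((\<lambda>\<psi>. \<omega> \<circ> \<psi>) ` E_maps) \<longleftrightarrow>
    \<rho> \<in> closure {\<lambda>x. \<omega> (kraus as x) | as. kraus as 1 = 1}"
proof -
  have eq: "(\<lambda>\<psi>. \<omega> \<circ> \<psi>) ` E_maps = {\<lambda>x. \<omega> (kraus as x) | as. kraus as 1 = 1}"
    unfolding E_maps_eq by (auto simp: o_def image_iff)
  have "{\<lambda>x. \<omega> (kraus as x) | as. kraus as 1 = 1} \<subseteq> dual_space"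
    using comp_kraus_dual[OF assms(1)] by auto
  then show ?thesis unfolding eq by (simp add: weak_star_closure assms(2))
qed

theorem theorem3p7:
  fixes \<omega> \<rho> :: "'a::cstar_algebra \<Rightarrow> complex"
  assumes "hermitian_functional \<omega>" and "hermitian_functional \<rho>"
  shows "(\<rho> \<in> weak_star_topology closure_of ((\<lambda>\<psi>. \<omega> \<circ> \<psi>) ` E_maps) \<longleftrightarrow>
            (\<exists>\<rho>\<^sub>1 \<rho>\<^sub>2. positive_functional \<rho>\<^sub>1 \<and> positive_functional \<rho>\<^sub>2 \<and>
                     condition_B \<omega> \<rho> \<rho>\<^sub>1 \<rho>\<^sub>2)) \<and>
         (\<rho> \<in> weak_star_topology closure_of ((\<lambda>\<psi>. \<omega> \<circ> \<psi>) ` E_maps) \<longrightarrow>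
            (\<forall>J. closed_ideal J \<longrightarrow> restr_norm \<rho> J \<le> restr_norm \<omega> J)) \<and>
         (positive_functional \<omega> \<longrightarrow>
            (\<rho> \<in> weak_star_topology closure_of ((\<lambda>\<psi>. \<omega> \<circ> \<psi>) ` E_maps) \<longleftrightarrow>
               \<rho> 1 = \<omega> 1 \<and>
               (\<forall>J. closed_ideal J \<longrightarrow> restr_norm \<rho> J \<le> restr_norm \<omega> J)))"
proof -
  have dw: "\<omega> \<in> dual_space" and dr: "\<rho> \<in> dual_space"
    using assms by (auto simp: hermitian_functional_def)
  define S where "S = {\<lambda>x. \<omega> (kraus as x) | as. kraus as (1::'a) = 1}"
  define p where "p = pos_part \<omega>"
  define n where "n = neg_part \<omega>"
  have j: "jordan_decomposition \<omega> p n"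
    unfolding p_def n_def by (rule jordan_decomposition_parts[OF assms(1)])
  then have p: "positive_functional p" and n: "positive_functional n" and om: "\<omega> = (\<lambda>x. p x - n x)"
    by (auto simp: jordan_decomposition_def)
  have inS: "(\<lambda>x. \<omega> (kraus as x)) \<in> S" if "kraus as 1 = 1" for as
    using that unfolding S_def by blast
  have close: "\<rho> \<in> closure S"
    if near: "\<And>F \<epsilon>. finite F \<Longrightarrow> 0 < \<epsilon> \<Longrightarrow> \<exists>as. kraus as 1 = 1 \<and> (\<forall>x\<in>F. cmod (\<rho> x - \<omega> (kraus as x)) < \<epsilon>)"
    unfolding closure_pointwise dist_norm
  proof (intro allI impI)
    fix F :: "'a set" and \<epsilon> :: real assume "finite F \<and> 0 < \<epsilon>"
    then obtain as where "kraus as 1 = 1" "\<forall>x\<in>F. cmod (\<rho> x - \<omega> (kraus as x)) < \<epsilon>"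
      using near by blast
    then show "\<exists>f\<in>S. \<forall>x\<in>F. cmod (\<rho> x - f x) < \<epsilon>" by (intro bexI[OF _ inS]) auto
  qed
  have approx: "\<exists>as. kraus as 1 = 1 \<and> cmod (\<rho> x - \<omega> (kraus as x)) < \<epsilon>"
    if cl: "\<rho> \<in> closure S" and "0 < \<epsilon>" for x \<epsilon>
  proof -
    have "finite {x} \<and> 0 < \<epsilon>" using that(2) by simp
    then obtain f where "f \<in> S" "\<forall>y\<in>{x}. dist (\<rho> y) (f y) < \<epsilon>"
      using cl unfolding closure_pointwise by blast
    then show ?thesis unfolding S_def by (auto simp: dist_norm)
  qed

  have B: "\<exists>\<rho>\<^sub>1 \<rho>\<^sub>2. positive_functional \<rho>\<^sub>1 \<and> positive_functional \<rho>\<^sub>2 \<and> condition_B \<omega> \<rho> \<rho>\<^sub>1 \<rho>\<^sub>2"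
    if "\<rho> \<in> closure S"
  proof -
    let ?D = "(\<lambda>(f, g) x. f x - g x) ` (dominated_positive p \<times> dominated_positive n)"
    have "S \<subseteq> ?D"
    proof
      fix f assume "f \<in> S"
      then obtain as where as: "kraus as (1::'a) = 1" "f = (\<lambda>x. \<omega> (kraus as x))"
        unfolding S_def by blast
      have "f = (\<lambda>(f, g) x. f x - g x) (\<lambda>x. p (kraus as x), \<lambda>x. n (kraus as x))"
        by (simp add: as(2) om)
      then show "f \<in> ?D"
        using comp_kraus_dominated[OF p as(1)] comp_kraus_dominated[OF n as(1)]
        by (intro image_eqI[where x = "(\<lambda>x. p (kraus as x), \<lambda>x. n (kraus as x))"]) auto
    qed
    then have "\<rho> \<in> ?D"
      using closure_minimal[OF _ closed_dominated_differences[OF p n]] that by blast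
    then obtain f g where fg: "f \<in> dominated_positive p" "g \<in> dominated_positive n" "\<rho> = (\<lambda>x. f x - g x)"
      by auto
    then have "condition_B \<omega> \<rho> f g"
      by (auto simp: condition_B_def dominated_positive_def p_def n_def)
    then show ?thesis using fg by (auto simp: dominated_positive_def)
  qed

  have from_B: "\<rho> \<in> closure S"
    if r: "positive_functional \<rho>\<^sub>1" "positive_functional \<rho>\<^sub>2" "condition_B \<omega> \<rho> \<rho>\<^sub>1 \<rho>\<^sub>2" for \<rho>\<^sub>1 \<rho>\<^sub>2
  proof (rule close)
    fix F :: "'a set" and \<epsilon> :: real assume F: "finite F" "0 < \<epsilon>"
    have "\<rho> x = \<rho>\<^sub>1 x - \<rho>\<^sub>2 x" for x using r(3) by (simp add: condition_B_def)
    moreover have "\<rho>\<^sub>1 1 = p 1" "\<rho>\<^sub>2 1 = n 1"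
      "\<And>J. closed_ideal J \<Longrightarrow> restr_norm \<rho>\<^sub>1 J \<le> restr_norm p J"
      "\<And>J. closed_ideal J \<Longrightarrow> restr_norm \<rho>\<^sub>2 J \<le> restr_norm n J"
      using r(3) by (auto simp: condition_B_def p_def n_def)
    ultimately show "\<exists>as. kraus as 1 = 1 \<and> (\<forall>x\<in>F. cmod (\<rho> x - \<omega> (kraus as x)) < \<epsilon>)"
      using hermitian_kraus_approximation[OF assms(1) j r(1) _ _ r(2) _ _ F] by simp
  qed

  have bound: "restr_norm \<rho> J \<le> restr_norm \<omega> J" if cl: "\<rho> \<in> closure S" and J: "closed_ideal J" for J
  proof (rule restr_norm_leI[OF closed_idealD(1)[OF J] restr_norm_nonneg[OF dw closed_idealD(1)[OF J]]])
    fix x assume x: "x \<in> J"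
    show "cmod (\<rho> x) \<le> restr_norm \<omega> J * norm x"
    proof (rule field_le_epsilon)
      fix e :: real assume "0 < e"
      then obtain as where as: "kraus as 1 = 1" "cmod (\<rho> x - \<omega> (kraus as x)) < e"
        using approx[OF cl] by blast
      show "cmod (\<rho> x) \<le> restr_norm \<omega> J * norm x + e"
        using norm_triangle_sub[of "\<rho> x" "\<omega> (kraus as x)"] norm_comp_kraus_le[OF dw as(1) J x] as(2)
        by linarith
    qed
  qed

  have unit: "\<rho> 1 = \<omega> 1" if cl: "\<rho> \<in> closure S"
  proof -
    have "cmod (\<rho> 1 - \<omega> 1) \<le> 0 + e" if "0 < e" for e
      using approx[OF cl that, of 1] by auto
    then have "cmod (\<rho> 1 - \<omega> 1) \<le> 0" by (rule field_le_epsilon)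
    then show ?thesis by simp
  qed

  \<comment> \<open>The ideal \<open>J = A\<close> gives \<open>\<parallel>\<rho>\<parallel> \<le> \<omega> 1 = \<rho> 1\<close>, so \<open>\<rho>\<close> is positive.\<close>
  have from_norms: "\<rho> \<in> closure S"
    if w: "positive_functional \<omega>" and one: "\<rho> 1 = \<omega> 1"
      and le: "\<And>J. closed_ideal J \<Longrightarrow> restr_norm \<rho> J \<le> restr_norm \<omega> J"
  proof (rule close)
    have "cmod (\<rho> x) \<le> Re (\<rho> 1) * norm x" for x
      using order_trans[OF restr_norm_bound[OF dr UNIV_I] mult_right_mono[OF le[OF closed_ideal_UNIV]]]
      by (simp add: pf_restr_norm_UNIV[OF w] one)
    then have r: "positive_functional \<rho>" by (rule positive_if_norm_le_one[OF assms(2)])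
    show "\<exists>as. kraus as 1 = 1 \<and> (\<forall>x\<in>F. cmod (\<rho> x - \<omega> (kraus as x)) < \<epsilon>)"
      if "finite F" "0 < \<epsilon>" for F \<epsilon>
      by (rule positive_kraus_approximation[OF w r one le that])
  qed

  show ?thesis
    unfolding weak_star_closure_E_maps[OF dw dr] S_def[symmetric]
    using B from_B bound unit from_norms by blast
qed

end
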